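(* There exist a bounded linear extension map $E:\mathcal T_\infty\to\mathrm{dom}_{L^\infty}\Delta(SG)$ and $E:\mathcal T_2\to\mathrm{dom}_{L^2}\Delta(SG)$ with $R\circ E=\mathrm{Id}$, where $Ru=\{(u(x_m),\partial_nu(x_m))\}_{m\ge1}$.
   Context: Let $q_0,q_1,q_2$ be the vertices of an equilateral triangle, $F_j(x)=(x+q_j)/2$, $SG$ the Sierpinski gasket ($SG=\bigcup_jF_jSG$ nonempty compact), $V_0=\{q_0,q_1,q_2\}$, $V_m=\bigcup_jF_jV_{m-1}$; $x\sim_my$ means $x\ne y$ in $V_m$ lie in a common level-$m$ cell $F_w SG=F_{w_1}\cdots F_{w_m}SG$. $\mathcal E_m(u,v)=\sum_{x\sim_my}(5/3)^m(u(x)-u(y))(v(x)-v(y))$ (unordered pairs), $\mathcal E(u,v)=\lim\mathcal E_m(u,v)$, $\mathcal E(u)=\mathcal E(u,u)$. $dx$ is the self-similar probability measure giving each level-$m$ cell measure $3^{-m}$. For $p\in\{2,\infty\}$, $\mathrm{dom}_{L^p}\Delta(SG)$ is the set of continuous $u$ on $SG$ with $\mathcal E(u)<\infty$ for which there is $f=:\Delta u\in L^p(SG)$ with $\mathcal E(u,v)=-\int fv\,dx$ for all $v$ with $\mathcal E(v)<\infty$, $v|_{V_0}=0$. Norms: $\|u\|_{L^\infty}+\|\Delta u\|_{L^\infty}$ for $p=\infty$, and $(\|u\|_{L^2}^2+\|\Delta u\|_{L^2}^2)^{1/2}$ for $p=2$. $x_m=F_0^{m-1}F_2q_1$ $(m\ge1)$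 (points on the symmetry line through $q_0$); $\overline Y_m=F_0^{m-1}F_1SG$ is the level-$m$ cell in the left half having $x_m=F_0^{m-1}F_1q_2$ as a boundary point. The normal derivative of $u$ at a boundary point $F_wq_j$ of a level-$n$ cell $F_wSG$ is $\lim_{k}(5/3)^{n+k}[2u(F_wq_j)-u(F_wF_j^kq_{j+1})-u(F_wF_j^kq_{j-1})]$ (indices mod 3); $\partial_nu(x_m)$ is taken with respect to $\overline Y_m$. $\|c_m\|_{\mathrm{Lip}}=\sup_{m\ge1}|c_{m+1}-c_m|$ (a norm on Lipschitz sequences modulo constants). $\mathcal T_\infty$ is the set of pairs of real sequences $\{(a_m,\eta_m)\}_{m\ge1}$ with $a_m=A_1+A_2(3/5)^m+a_m'$, $\|5^ma_m'\|_{\ell^\infty}<\infty$, $\|3^m\eta_m\|_{\mathrm{Lip}}<\infty$, with $\|\{(a_m,\eta_m)\}\|_{\mathcal T_\infty}=|A_1|+|A_2|+\|5^ma_m'\|_{\ell^\infty}+\|3^m\eta_m\|_{\mathrm{Lip}}$. $\mathcal T_2$ is the set of $\{(a_m,\eta_m)\}_{m\ge1}$ with $a_m=A_1+A_2(3/5)^m+a_m'$, $\|(25/3)^{m/2}a_m'\|_{\ell^2}<\infty$, $\|3^{m/2}\eta_m\|_{\ell^2}<\infty$, with $\|\{(a_m,\eta_m)\}\|_{\mathcal T_2}^2=|A_1|^2+|A_2|^2+\|(25/3)^{m/2}a_m'\|_{\ell^2}^2+\|3^{m/2}\eta_m\|_{\ell^2}^2$. (The constants $A_1,A_2$ are uniquely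 determined by $\{a_m\}$.)
   Formalization: The printed T_∞ norm vanishes at (0, 3^{-m}), so R∘E = Id cannot hold literally; proved instead: R∘E = Id with |3η_1| added to the T_∞ norm, and, with the printed norm, R∘E = Id modulo adding c·3^{-m} to η_m. The T_2 claim is unchanged. *)

theory Defs
  imports "HOL-Probability.Probability"
begin

section \<open>The Sierpinski gasket\<close>

text \<open>The vertices are indexed by the three-element type, whose arithmetic is modulo 3, so that
  \<open>j + 1\<close> and \<open>j - 1\<close> are the cyclic neighbours of \<open>j\<close>.\<close>

type_synonym point = "real^2"
type_synonym word = "3 list"

definition equilateral :: "(3 \<Rightarrow> point) \<Rightarrow> bool" where
  "equilateral q \<longleftrightarrow> (\<exists>s>0. \<forall>i j. i \<noteq> j \<longrightarrow> dist (q i) (q j) = s)"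

definition F :: "(3 \<Rightarrow> point) \<Rightarrow> 3 \<Rightarrow> point \<Rightarrow> point" where
  "F q j x = (1/2) *\<^sub>R (x + q j)"

fun Fw :: "(3 \<Rightarrow> point) \<Rightarrow> word \<Rightarrow> point \<Rightarrow> point" where
  "Fw q [] = id"
| "Fw q (j # w) = F q j \<circ> Fw q w"

definition SG :: "(3 \<Rightarrow> point) \<Rightarrow> point set" where
  "SG q = (THE K. compact K \<and> K \<noteq> {} \<and> K = (\<Union>j. F q j ` K))"

definition cell :: "(3 \<Rightarrow> point) \<Rightarrow> word \<Rightarrow> point set" where
  "cell q w = Fw q w ` SG q"

fun V :: "(3 \<Rightarrow> point) \<Rightarrow> nat \<Rightarrow> point set" where
  "V q 0 = range q"
| "V q (Suc m) = (\<Union>j. F q j ` V q m)"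

definition adj :: "(3 \<Rightarrow> point) \<Rightarrow> nat \<Rightarrow> point \<Rightarrow> point \<Rightarrow> bool" where
  "adj q m x y \<longleftrightarrow> x \<in> V q m \<and> y \<in> V q m \<and> x \<noteq> y \<and>
     (\<exists>w. length w = m \<and> x \<in> cell q w \<and> y \<in> cell q w)"

text \<open>The measure \<open>dx\<close> lives on the space \<open>SG q\<close> itself, so values of functions off the gasket
  never matter.\<close>

definition mu :: "(3 \<Rightarrow> point) \<Rightarrow> point measure" where
  "mu q = (THE \<mu>. sets \<mu> = sets (restrict_space borel (SG q)) \<and> prob_space \<mu> \<and>
     (\<forall>w. measure \<mu> (cell q w) = (1/3) ^ length w) \<and>
     (\<forall>A\<in>sets \<mu>. measure \<mu> A = (\<Sum>j\<in>UNIV. (1/3) * measure \<mu> (F q j -` A \<inter> SG q))))"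


section \<open>Energy and Laplacian\<close>

text \<open>The sum over ordered pairs counts every unordered pair twice, hence the division by 2.\<close>

definition energy_level :: "(3 \<Rightarrow> point) \<Rightarrow> nat \<Rightarrow> (point \<Rightarrow> real) \<Rightarrow> (point \<Rightarrow> real) \<Rightarrow> real" where
  "energy_level q m u v =
     (\<Sum>(x, y) \<in> {(x, y). adj q m x y}. (5/3) ^ m * (u x - u y) * (v x - v y)) / 2"

definition energy :: "(3 \<Rightarrow> point) \<Rightarrow> (point \<Rightarrow> real) \<Rightarrow> (point \<Rightarrow> real) \<Rightarrow> real" where
  "energy q u v = lim (\<lambda>m. energy_level q m u v)"

text \<open>The continuous functions of finite energy; \<open>convergent\<close> says that the limit defining the
  energy is a (finite) real number.\<close>

definition dom_energy :: "(3 \<Rightarrow> point) \<Rightarrow> (point \<Rightarrow> real) set" where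
  "dom_energy q = {u. continuous_on (SG q) u \<and> convergent (\<lambda>m. energy_level q m u u)}"

definition L2 :: "(3 \<Rightarrow> point) \<Rightarrow> (point \<Rightarrow> real) set" where
  "L2 q = {f \<in> borel_measurable (mu q). integrable (mu q) (\<lambda>x. (f x)\<^sup>2)}"

definition L2_norm :: "(3 \<Rightarrow> point) \<Rightarrow> (point \<Rightarrow> real) \<Rightarrow> real" where
  "L2_norm q f = sqrt (LINT x|mu q. (f x)\<^sup>2)"

definition Linf :: "(3 \<Rightarrow> point) \<Rightarrow> (point \<Rightarrow> real) set" where
  "Linf q = {f \<in> borel_measurable (mu q). esssup (mu q) (\<lambda>x. ereal \<bar>f x\<bar>) < \<infinity>}"

definition Linf_norm :: "(3 \<Rightarrow> point) \<Rightarrow> (point \<Rightarrow> real) \<Rightarrow> real" where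
  "Linf_norm q f = real_of_ereal (esssup (mu q) (\<lambda>x. ereal \<bar>f x\<bar>))"

text \<open>In the following three definitions \<open>L\<close> is one of \<open>L2 q\<close> and \<open>Linf q\<close>. The function
  \<open>laplacian q L u\<close> is determined up to a null set.\<close>

definition is_laplacian ::
  "(3 \<Rightarrow> point) \<Rightarrow> (point \<Rightarrow> real) set \<Rightarrow> (point \<Rightarrow> real) \<Rightarrow> (point \<Rightarrow> real) \<Rightarrow> bool" where
  "is_laplacian q L u f \<longleftrightarrow> f \<in> L \<and>
     (\<forall>v\<in>dom_energy q. (\<forall>x\<in>V q 0. v x = 0) \<longrightarrow> energy q u v = - (LINT x|mu q. f x * v x))"

definition laplacian ::
  "(3 \<Rightarrow> point) \<Rightarrow> (point \<Rightarrow> real) set \<Rightarrow> (point \<Rightarrow> real) \<Rightarrow> point \<Rightarrow> real" where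
  "laplacian q L u = (SOME f. is_laplacian q L u f)"

definition dom_laplacian ::
  "(3 \<Rightarrow> point) \<Rightarrow> (point \<Rightarrow> real) set \<Rightarrow> (point \<Rightarrow> real) set" where
  "dom_laplacian q L = {u \<in> dom_energy q. \<exists>f. is_laplacian q L u f}"

definition dom_L2_norm :: "(3 \<Rightarrow> point) \<Rightarrow> (point \<Rightarrow> real) \<Rightarrow> real" where
  "dom_L2_norm q u = sqrt ((L2_norm q u)\<^sup>2 + (L2_norm q (laplacian q (L2 q) u))\<^sup>2)"

definition dom_Linf_norm :: "(3 \<Rightarrow> point) \<Rightarrow> (point \<Rightarrow> real) \<Rightarrow> real" where
  "dom_Linf_norm q u = Linf_norm q u + Linf_norm q (laplacian q (Linf q) u)"


section \<open>Restriction to the points on the symmetry line\<close>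

definition has_normal_deriv ::
  "(3 \<Rightarrow> point) \<Rightarrow> (point \<Rightarrow> real) \<Rightarrow> word \<Rightarrow> 3 \<Rightarrow> real \<Rightarrow> bool" where
  "has_normal_deriv q u w j d \<longleftrightarrow>
     (\<lambda>k. (5/3) ^ (length w + k) *
        (2 * u (Fw q w (q j)) - u (Fw q (w @ replicate k j) (q (j + 1)))
                              - u (Fw q (w @ replicate k j) (q (j - 1))))) \<longlonglongrightarrow> d"

definition sym_point :: "(3 \<Rightarrow> point) \<Rightarrow> nat \<Rightarrow> point" where
  "sym_point q m = Fw q (replicate (m - 1) 0 @ [2]) (q 1)"

text \<open>The word of the cell \<open>F\<^sub>0\<^bsup>m-1\<^esup>F\<^sub>1SG\<close>; the point \<open>sym_point q m\<close> is its boundary point with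
  index 2.\<close>

definition left_word :: "nat \<Rightarrow> word" where
  "left_word m = replicate (m - 1) 0 @ [1]"

text \<open>Sequences \<open>(x\<^sub>m)\<close> with \<open>m \<ge> 1\<close> are functions on \<open>nat\<close> whose value at 0 is never looked at.
  \<open>has_restriction q u (a, \<eta>)\<close> says that the restriction \<open>Ru\<close> exists and equals \<open>(a, \<eta>)\<close>.\<close>

type_synonym seq_pair = "(nat \<Rightarrow> real) \<times> (nat \<Rightarrow> real)"

definition has_restriction :: "(3 \<Rightarrow> point) \<Rightarrow> (point \<Rightarrow> real) \<Rightarrow> seq_pair \<Rightarrow> bool" where
  "has_restriction q u = (\<lambda>(a, \<eta>). \<forall>m\<ge>1.
     u (sym_point q m) = a m \<and> has_normal_deriv q u (left_word m) 2 (\<eta> m))"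


section \<open>The trace spaces\<close>

definition remainder :: "(nat \<Rightarrow> real) \<Rightarrow> real \<times> real \<Rightarrow> nat \<Rightarrow> real" where
  "remainder a = (\<lambda>(A1, A2) m. a m - A1 - A2 * (3/5) ^ m)"

definition sup_finite :: "(nat \<Rightarrow> real) \<Rightarrow> bool" where
  "sup_finite c \<longleftrightarrow> bdd_above ((\<lambda>m. \<bar>c m\<bar>) ` {1..})"

definition sup_norm :: "(nat \<Rightarrow> real) \<Rightarrow> real" where
  "sup_norm c = (SUP m\<in>{1..}. \<bar>c m\<bar>)"

definition lip_finite :: "(nat \<Rightarrow> real) \<Rightarrow> bool" where
  "lip_finite c \<longleftrightarrow> bdd_above ((\<lambda>m. \<bar>c (m + 1) - c m\<bar>) ` {1..})"

definition lip_norm :: "(nat \<Rightarrow> real) \<Rightarrow> real" where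
  "lip_norm c = (SUP m\<in>{1..}. \<bar>c (m + 1) - c m\<bar>)"

definition l2_finite :: "(nat \<Rightarrow> real) \<Rightarrow> bool" where
  "l2_finite c \<longleftrightarrow> (\<lambda>m. (c m)\<^sup>2) summable_on {1..}"

definition l2_norm :: "(nat \<Rightarrow> real) \<Rightarrow> real" where
  "l2_norm c = sqrt (\<Sum>\<^sub>\<infinity>m\<in>{1..}. (c m)\<^sup>2)"

definition Tinf_remainder :: "(nat \<Rightarrow> real) \<Rightarrow> real \<times> real \<Rightarrow> nat \<Rightarrow> real" where
  "Tinf_remainder a A m = 5 ^ m * remainder a A m"

definition T2_remainder :: "(nat \<Rightarrow> real) \<Rightarrow> real \<times> real \<Rightarrow> nat \<Rightarrow> real" where
  "T2_remainder a A m = (25/3) powr (real m / 2) * remainder a A m"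

definition Tinf :: "seq_pair set" where
  "Tinf = {(a, \<eta>). (\<exists>A. sup_finite (Tinf_remainder a A)) \<and> lip_finite (\<lambda>m. 3 ^ m * \<eta> m)}"

text \<open>The pair of constants selected by \<open>THE\<close> here and below is unique, since \<open>5 * (3/5) > 1\<close> and
  \<open>(25/3) * (3/5)\<^sup>2 > 1\<close>.\<close>

definition Tinf_norm :: "seq_pair \<Rightarrow> real" where
  "Tinf_norm = (\<lambda>(a, \<eta>). let A = (THE A. sup_finite (Tinf_remainder a A)) in
     \<bar>fst A\<bar> + \<bar>snd A\<bar> + sup_norm (Tinf_remainder a A) + lip_norm (\<lambda>m. 3 ^ m * \<eta> m))"

text \<open>\<open>lip_norm\<close> vanishes on constants, so \<open>Tinf_norm\<close> is a norm on pairs \<open>(a, \<eta>)\<close> only after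
  identifying \<open>(a, \<eta>)\<close> with \<open>(a, \<eta> + c 3\<^bsup>-m\<^esup>)\<close>. On the pairs themselves the norm is obtained by
  restoring the lost constant, here as the first term of the sequence \<open>3\<^sup>m \<eta>\<^sub>m\<close>.\<close>

definition Tinf_full_norm :: "seq_pair \<Rightarrow> real" where
  "Tinf_full_norm s = Tinf_norm s + \<bar>3 * snd s 1\<bar>"

definition shift_const :: "real \<Rightarrow> seq_pair \<Rightarrow> seq_pair" where
  "shift_const c = (\<lambda>(a, \<eta>). (a, \<lambda>m. \<eta> m + c / 3 ^ m))"

definition T2 :: "seq_pair set" where
  "T2 = {(a, \<eta>). (\<exists>A. l2_finite (T2_remainder a A)) \<and>
                  l2_finite (\<lambda>m. 3 powr (real m / 2) * \<eta> m)}"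

definition T2_norm :: "seq_pair \<Rightarrow> real" where
  "T2_norm = (\<lambda>(a, \<eta>). let A = (THE A. l2_finite (T2_remainder a A)) in
     sqrt ((fst A)\<^sup>2 + (snd A)\<^sup>2 + (l2_norm (T2_remainder a A))\<^sup>2
           + (l2_norm (\<lambda>m. 3 powr (real m / 2) * \<eta> m))\<^sup>2))"


section \<open>Bounded linear maps from trace spaces to functions on the gasket\<close>

definition lincomb :: "real \<Rightarrow> seq_pair \<Rightarrow> real \<Rightarrow> seq_pair \<Rightarrow> seq_pair" where
  "lincomb c s d t =
     ((\<lambda>m. c * fst s m + d * fst t m), (\<lambda>m. c * snd s m + d * snd t m))"

text \<open>Equality of functions on the gasket is equality on \<open>SG q\<close>.\<close>

definition bounded_linear_into ::
  "(3 \<Rightarrow> point) \<Rightarrow> seq_pair set \<Rightarrow> (seq_pair \<Rightarrow> real) \<Rightarrow> (point \<Rightarrow> real) set \<Rightarrow>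
   ((point \<Rightarrow> real) \<Rightarrow> real) \<Rightarrow> (seq_pair \<Rightarrow> point \<Rightarrow> real) \<Rightarrow> bool" where
  "bounded_linear_into q T T_norm D D_norm E \<longleftrightarrow>
     (\<forall>s\<in>T. E s \<in> D) \<and>
     (\<forall>s\<in>T. \<forall>t\<in>T. \<forall>c d. \<forall>x\<in>SG q. E (lincomb c s d t) x = c * E s x + d * E t x) \<and>
     (\<exists>C. \<forall>s\<in>T. D_norm (E s) \<le> C * T_norm s)"

end

theory Submission
  imports Defs
begin

text \<open>Write \<open>b\<close> for the values of a function \<open>u\<close> at the three corners of a cell \<open>F\<^sub>w SG\<close>. The normal
derivatives of \<open>u\<close> at these corners differ from the graph Laplacian of \<open>b\<close> by a \<^emph>\<open>load\<close> \<open>K\<close>, which by the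
Gauss-Green formula is the integral of the Laplacian against the harmonic function that is 1 at the
corner and 0 at the other two. The pair \<open>(b, K)\<close> is the jet of \<open>u\<close> on the cell. The proof constructs the
extension through its jets.

If a jet is prescribed on every cell such that values and normal derivatives match at the junction
points, then summation by parts telescopes over the levels, and the graph energies of \<open>u\<close> against any
continuous \<open>v\<close> are a boundary term minus a Riemann sum for the integral of \<open>f v\<close>, where \<open>f\<close> is the density
whose integral over a cell is the sum of the three loads (\<open>energy_level_tendsto\<close>). So \<open>f\<close> is the Laplacian
of \<open>u\<close>, the energy is finite, and the normal derivatives are the prescribed ones (\<open>normal_deriv\<close>).

It remains to choose jets. The point \<open>x\<^sub>m\<^sub>+\<^sub>1\<close> is the common corner of the two wings \<open>F\<^sub>0\<^sup>mF\<^sub>1SG\<close> and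
\<open>F\<^sub>0\<^sup>mF\<^sub>2SG\<close>, and these wings, for all \<open>m\<close>, fill the gasket up to \<open>q 0\<close>. Put
\<open>\<theta>\<^sub>m = 3\<^sup>m\<eta>\<^sub>m\<close>. At the bottom corners of \<open>F\<^sub>0\<^sup>mSG\<close> the extension gets the values
\<open>A\<^sub>1 + 3/4 A\<^sub>2 (3/5)\<^sup>m\<close>, which continue a harmonic function, minus (left) and plus (right)
\<open>\<theta>\<^sub>m 5\<^sup>-\<^sup>m / 6\<close>. For constant \<open>\<theta>\<close> these odd values produce the normal derivatives
\<open>3\<^sup>-\<^sup>m\<theta>\<close> at the points \<open>x\<^sub>m\<close> with no load at all. Hence the loads on the wings of level \<open>m\<close> involve only \<open>5\<^sup>m a'\<^sub>m\<close> and the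
\<^emph>\<open>differences\<close> \<open>\<theta>\<^sub>m - \<theta>\<^sub>m\<^sub>-\<^sub>1\<close>; this is why the Lipschitz norm of \<open>3\<^sup>m\<eta>\<^sub>m\<close> enters for \<open>p = \<infinity>\<close>
(\<open>subdivides_apex\<close>, \<open>dens_le\<close>). Each wing is cut into three cells on which the Laplacian is the constant
that realises the loads (\<open>subdivides_child\<close>). The Laplacian on the wings of level \<open>m\<close> is therefore
bounded by a multiple of \<open>5\<^sup>m|a'\<^sub>m| + |\<theta>\<^sub>m - \<theta>\<^sub>m\<^sub>-\<^sub>1|\<close>. Its supremum gives the bound for \<open>p = \<infinity>\<close>; the sum of its
squares with the weights \<open>3\<^sup>-\<^sup>m\<close>, the measures of these wings, gives the bound for \<open>p = 2\<close>.
All choices are linear in the sequences.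

Three facts about the gasket are established on the way: the self-similar measure exists and is
unique (\<open>mu_eq_nu\<close>), vertex values whose oscillation decays geometrically extend continuously
(\<open>ext_continuous\<close>), and the Laplacian is unique almost everywhere (\<open>laplacian_unique\<close>), so that the
norms, which refer to an arbitrary choice of it, can be estimated through the density \<open>f\<close>. The last
fact uses harmonic splines as test functions.\<close>

section \<open>Arithmetic modulo three\<close>

lemma UNIV_word3: "(UNIV :: 3 set) = {0, 1, 2}"
  using UNIV_3 by auto

lemma sum3: "(\<Sum>j\<in>(UNIV::3 set). f j) = f 0 + f 1 + f 2"
proof -
  have "(0::3) \<noteq> 1" "(0::3) \<noteq> 2" "(1::3) \<noteq> 2" by auto
  then show ?thesis unfolding UNIV_word3 by (simp add: add.assoc)
qed

lemma all3: "(\<forall>j::3. P j) \<longleftrightarrow> P 0 \<and> P 1 \<and> P 2"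
  using UNIV_word3 by (metis UNIV_I insert_iff singletonD)

lemma cyc3: "(0::3) + 1 = 1" "(1::3) + 1 = 2" "(2::3) + 1 = 0" "(0::3) - 1 = 2" "(1::3) - 1 = 0" "(2::3) - 1 = 1"
  by simp_all

lemma neq3: "(0::3) \<noteq> 1" "(0::3) \<noteq> 2" "(1::3) \<noteq> 2" "(1::3) \<noteq> 0" "(2::3) \<noteq> 0" "(2::3) \<noteq> 1"
  by auto

lemma third3: "i \<noteq> j \<Longrightarrow> \<exists>k::3. k \<noteq> i \<and> k \<noteq> j \<and> UNIV = {i, j, k}"
proof -
  have "\<forall>i j::3. i \<noteq> j \<longrightarrow> (\<exists>k::3. k \<noteq> i \<and> k \<noteq> j)"
    unfolding all3 using neq3 by metis
  moreover assume "i \<noteq> j"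
  ultimately obtain k where k: "k \<noteq> i" "k \<noteq> j" by blast
  have "card {i, j, k} = CARD(3)" using \<open>i \<noteq> j\<close> k by auto
  then have "UNIV = {i, j, k}" using card_subset_eq[of UNIV "{i, j, k}"] by auto
  then show ?thesis using k by blast
qed

section \<open>Barycentric coordinates and the attractor\<close>

locale gasket =
  fixes q :: "3 \<Rightarrow> point"
  assumes equilateral_q: "equilateral q"
begin

definition side :: real where "side = dist (q 0) (q 1)"

definition cent :: point where "cent = (1/3) *\<^sub>R (q 0 + q 1 + q 2)"

text \<open>Barycentric coordinates: the vectors \<open>q j - cent\<close> have squared length \<open>side\<^sup>2 / 3\<close> and mutual inner
products \<open>- side\<^sup>2 / 6\<close>.\<close>

definition bary :: "3 \<Rightarrow> point \<Rightarrow> real" where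
  "bary j x = 1/3 + 2 / side\<^sup>2 * ((x - cent) \<bullet> (q j - cent))"

lemma dist_q: "i \<noteq> j \<Longrightarrow> dist (q i) (q j) = side" and side_pos: "side > 0"
proof -
  obtain s where s: "s > 0" "\<And>i j. i \<noteq> j \<Longrightarrow> dist (q i) (q j) = s"
    using equilateral_q unfolding equilateral_def by blast
  have "side = s" unfolding side_def using s(2)[of 0 1] by simp
  then show "i \<noteq> j \<Longrightarrow> dist (q i) (q j) = side" "side > 0" using s by auto
qed

lemma bary_q: "bary j (q i) = (if i = j then 1 else 0)"
proof -
  define a where "a = q 1 - q 0"
  define b where "b = q 2 - q 0"
  have q1: "q 1 = q 0 + a" and q2: "q 2 = q 0 + b" by (auto simp: a_def b_def)
  have aa: "a \<bullet> a = side\<^sup>2"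
    using dist_q[of 1 0] by (simp add: a_def dist_norm flip: power2_norm_eq_inner)
  have bb: "b \<bullet> b = side\<^sup>2"
    using dist_q[of 2 0] by (simp add: b_def dist_norm flip: power2_norm_eq_inner)
  have "(a - b) \<bullet> (a - b) = side\<^sup>2"
    using dist_q[of 1 2] by (simp add: a_def b_def dist_norm flip: power2_norm_eq_inner)
  then have ab: "a \<bullet> b = side\<^sup>2 / 2"
    using aa bb by (simp add: inner_diff inner_commute)
  have ba: "b \<bullet> a = side\<^sup>2 / 2" using ab by (simp add: inner_commute)
  have c: "cent = q 0 + (1/3) *\<^sub>R (a + b)"
    unfolding cent_def q1 q2 by (simp add: vec_eq_iff field_simps)
  have d: "q 0 - cent = - (1/3) *\<^sub>R a - (1/3) *\<^sub>R b" "q 1 - cent = (2/3) *\<^sub>R a - (1/3) *\<^sub>R b"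
     "q 2 - cent = (2/3) *\<^sub>R b - (1/3) *\<^sub>R a"
    unfolding q1 q2 c by (simp_all add: vec_eq_iff field_simps)
  have "\<forall>j i. bary j (q i) = (if i = j then 1 else 0)"
    unfolding all3 bary_def d using side_pos
    by (simp add: inner_diff_left inner_diff_right aa bb ab ba power2_eq_square neq3)
  then show ?thesis by blast
qed

lemma bary_sum: "(\<Sum>j\<in>UNIV. bary j x) = 1"
proof -
  \<comment> \<open>The coordinates are affine with linear parts that add up to zero.\<close>
  have z: "(q 0 - cent) + (q 1 - cent) + (q 2 - cent) = 0"
  proof -
    have "cent + cent + cent = (1/3 + 1/3 + 1/3) *\<^sub>R (q 0 + q 1 + q 2)"
      unfolding cent_def by (simp only: scaleR_add_left)
    then have "cent + cent + cent = q 0 + q 1 + q 2" by simp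
    moreover have "(q 0 - cent) + (q 1 - cent) + (q 2 - cent) = (q 0 + q 1 + q 2) - (cent + cent + cent)"
      by (simp only: add_diff_eq diff_add_eq diff_diff_eq)
    ultimately show ?thesis by simp
  qed
  have "(\<Sum>j\<in>UNIV. bary j x) = 1 + 2 / side\<^sup>2 * ((x - cent) \<bullet> ((q 0 - cent) + (q 1 - cent) + (q 2 - cent)))"
    unfolding sum3 bary_def by (simp only: inner_add_right ring_distribs)
  then show ?thesis unfolding z by simp
qed

lemma bary_F: "bary j (F q i x) = (bary j x + (if i = j then 1 else 0)) / 2"
proof -
  have "bary j (F q i x) = (bary j x + bary j (q i)) / 2"
    unfolding bary_def F_def
    using side_pos by (simp add: inner_diff_left inner_add_left field_simps)
  then show ?thesis by (simp add: bary_q)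
qed

lemma continuous_bary: "continuous_on S (bary j)"
  unfolding bary_def by (intro continuous_intros)

lemma F_eq_iff: "F q i x = F q i y \<longleftrightarrow> x = y"
  by (simp add: F_def)

lemma dist_F: "dist (F q i x) (F q i y) = dist x y / 2"
  by (simp add: F_def dist_norm flip: scaleR_diff_right)

lemma continuous_F: "continuous_on S (F q i)"
  unfolding F_def by (intro continuous_intros)

lemma F_fix: "F q i (q i) = q i"
  by (simp add: F_def flip: scaleR_2)

text \<open>The triangle spanned by the vertices. Its description by closed conditions that \<open>F q j\<close> preserves is
what passes to the gasket; the equation lets a point be recovered from its coordinates.\<close>

definition triangle :: "point set" where
  "triangle = {x. (\<forall>j. 0 \<le> bary j x) \<and> x = (\<Sum>j\<in>UNIV. bary j x *\<^sub>R q j)}"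

lemma q_triangle: "q i \<in> triangle"
proof -
  have "(\<Sum>j\<in>UNIV. bary j (q i) *\<^sub>R q j) = (\<Sum>j\<in>UNIV. if i = j then q j else 0)"
    by (intro sum.cong) (auto simp: bary_q)
  also have "\<dots> = q i" by simp
  finally have "(\<Sum>j\<in>UNIV. bary j (q i) *\<^sub>R q j) = q i" .
  then show ?thesis unfolding triangle_def by (auto simp: bary_q)
qed

lemma F_triangle: "x \<in> triangle \<Longrightarrow> F q i x \<in> triangle"
proof -
  assume x: "x \<in> triangle"
  have "(\<Sum>j\<in>UNIV. bary j (F q i x) *\<^sub>R q j) = (\<Sum>j\<in>UNIV. (1/2) *\<^sub>R (bary j x *\<^sub>R q j) + (1/2) *\<^sub>R (if i = j then q j else 0))"
    by (intro sum.cong) (auto simp: bary_F algebra_simps add_divide_distrib)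
  also have "\<dots> = (1/2) *\<^sub>R (\<Sum>j\<in>UNIV. bary j x *\<^sub>R q j) + (1/2) *\<^sub>R q i"
    by (simp only: sum.distrib scaleR_sum_right[symmetric] sum.delta' sum.delta finite UNIV_I if_True)
  also have "\<dots> = F q i x" using x unfolding triangle_def by (simp add: F_def algebra_simps)
  finally show ?thesis using x unfolding triangle_def by (auto simp: bary_F)
qed

lemma compact_triangle: "compact triangle"
proof -
  have "closed triangle"
    unfolding triangle_def
    by (intro closed_Collect_conj closed_Collect_all closed_Collect_le closed_Collect_eq continuous_intros continuous_bary)
  moreover have "bounded triangle"
  proof (rule boundedI)
    fix x assume x: "x \<in> triangle"
    have b: "bary j x \<le> 1" "0 \<le> bary j x" for j
    proof -
      show *: "0 \<le> bary j x" for j using x by (auto simp: triangle_def)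
      have "bary j x \<le> (\<Sum>j\<in>UNIV. bary j x)"
        using * by (intro member_le_sum) auto
      then show "bary j x \<le> 1" by (simp add: bary_sum)
    qed
    have "norm x = norm (\<Sum>j\<in>UNIV. bary j x *\<^sub>R q j)" using x by (auto simp: triangle_def)
    also have "\<dots> \<le> (\<Sum>j\<in>UNIV. norm (bary j x *\<^sub>R q j))" by (rule norm_sum)
    also have "\<dots> \<le> (\<Sum>j\<in>UNIV. norm (q j))"
      using b by (intro sum_mono) (auto intro: mult_left_le_one_le)
    finally show "norm x \<le> (\<Sum>j\<in>UNIV. norm (q j))" .
  qed
  ultimately show ?thesis by (simp add: compact_eq_bounded_closed)
qed

lemma triangle_eqI: "x \<in> triangle \<Longrightarrow> y \<in> triangle \<Longrightarrow> (\<And>j. bary j x = bary j y) \<Longrightarrow> x = y"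
  unfolding triangle_def by simp

lemma V_subset_triangle: "V q m \<subseteq> triangle"
  by (induction m) (auto intro: q_triangle F_triangle)

lemma V_mono: "V q m \<subseteq> V q (Suc m)"
proof (induction m)
  case 0
  show ?case
  proof
    fix x assume "x \<in> V q 0"
    then obtain i where "x = q i" by auto
    then have "x = F q i (q i)" by (simp only: F_fix)
    then show "x \<in> V q (Suc 0)" by auto
  qed
next
  case (Suc m)
  have "F q j ` V q m \<subseteq> F q j ` V q (Suc m)" for j by (rule image_mono[OF Suc])
  then show ?case unfolding V.simps(2)[of q m] V.simps(2)[of q "Suc m"] by (rule UN_mono[OF order_refl])
qed

text \<open>The largest distance of a point of \<open>K\<close> from \<open>K'\<close> is attained at some \<open>F q j y\<close>. Since \<open>F q j\<close> halves
distances and maps \<open>K'\<close> into itself, this largest distance is at most half of itself.\<close>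

lemma attractor_unique:
  assumes "compact K" "K \<noteq> {}" "K = (\<Union>j. F q j ` K)"
    and "compact K'" "K' \<noteq> {}" "K' = (\<Union>j. F q j ` K')"
  shows "K \<subseteq> K'"
proof -
  have "continuous_on K (\<lambda>x. infdist x K')"
    by (intro continuous_on_infdist continuous_on_id)
  from continuous_attains_sup[OF assms(1,2) this]
  obtain x where x: "x \<in> K" "\<And>y. y \<in> K \<Longrightarrow> infdist y K' \<le> infdist x K'" by blast
  obtain j y where y: "y \<in> K" "x = F q j y" using x(1) assms(3) by blast
  obtain z where z: "z \<in> K'" "infdist y K' = dist y z"
    using infdist_attains_inf[OF compact_imp_closed[OF assms(4)] assms(5)] by blast
  have "F q j z \<in> K'" using z(1) assms(6) by blast
  then have "infdist x K' \<le> dist x (F q j z)" by (rule infdist_le)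
  also have "\<dots> = infdist y K' / 2" unfolding y dist_F z ..
  also have "\<dots> \<le> infdist x K' / 2" using x(2)[OF y(1)] by simp
  finally have "infdist x K' \<le> 0" by linarith
  then have "infdist y K' = 0" if "y \<in> K" for y
    using x(2)[OF that] infdist_nonneg[of y K'] by linarith
  then show ?thesis
    using in_closed_iff_infdist_zero[OF compact_imp_closed[OF assms(4)] assms(5)] by auto
qed

text \<open>The closure of the union of all \<open>V q m\<close> is invariant, because \<open>F q j\<close> commutes with closures and the
sets \<open>V q m\<close> increase.\<close>

lemma SG_props: "compact (SG q)" "SG q \<noteq> {}" "SG q = (\<Union>j. F q j ` SG q)" "SG q \<subseteq> triangle"
  and q_SG: "q i \<in> SG q"
proof -
  define K where "K = closure (\<Union>m. V q m)"
  have sub: "K \<subseteq> triangle" unfolding K_def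
    using V_subset_triangle compact_triangle by (intro closure_minimal) (auto intro: compact_imp_closed)
  have "closed K" by (simp add: K_def)
  then have 1: "compact K"
    using compact_Int_closed[OF compact_triangle] sub by (metis inf.absorb_iff2 inf_commute)
  have 2: "K \<noteq> {}" unfolding K_def by (auto intro!: exI[of _ 0])
  have Fc: "F q j ` closure S = closure (F q j ` S)" for j S
  proof -
    have F': "F q j = (\<lambda>x. (1/2) *\<^sub>R q j + x) \<circ> (\<lambda>x. (1/2) *\<^sub>R x)"
      by (auto simp: F_def algebra_simps)
    show ?thesis unfolding F' image_comp[symmetric] closure_scaleR closure_translation ..
  qed
  have "(\<Union>j. F q j ` K) = (\<Union>j\<in>UNIV. closure (F q j ` (\<Union>m. V q m)))" unfolding K_def Fc ..
  also have "\<dots> = closure (\<Union>j\<in>UNIV. F q j ` (\<Union>m. V q m))" unfolding UNIV_word3 by simp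
  also have "(\<Union>j\<in>UNIV. F q j ` (\<Union>m. V q m)) = (\<Union>m. V q (Suc m))" by auto
  also have "\<dots> = (\<Union>m. V q m)" using V_mono by (intro equalityI UN_least) blast+
  finally have 3: "K = (\<Union>j. F q j ` K)" unfolding K_def by simp
  have SGK: "SG q = K" unfolding SG_def
  proof (rule the_equality)
    fix K' assume *: "compact K' \<and> K' \<noteq> {} \<and> K' = (\<Union>j. F q j ` K')"
    note K' = *[THEN conjunct1] *[THEN conjunct2, THEN conjunct1] *[THEN conjunct2, THEN conjunct2]
    show "K' = K"
      by (rule equalityI) (rule attractor_unique[OF 1 2 3 K'] attractor_unique[OF K' 1 2 3])+
  qed (intro conjI 1 2 3)
  have 4: "q i \<in> K" unfolding K_def by (intro subsetD[OF closure_subset] UN_I[of 0]) auto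
  show "compact (SG q)" "SG q \<noteq> {}" "SG q = (\<Union>j. F q j ` SG q)" "SG q \<subseteq> triangle" "q i \<in> SG q"
    unfolding SGK by (rule 1, rule 2, rule 3, rule sub, rule 4)
qed

end

section \<open>Cells and vertices\<close>

lemma Fw_append: "Fw q (w @ v) x = Fw q w (Fw q v x)"
  by (induction w) auto

lemma Fw_snoc: "Fw q (w @ [j]) x = Fw q w (F q j x)"
  by (simp add: Fw_append)

lemma Fw_swap: "Fw q (w @ [i]) (q j) = Fw q (w @ [j]) (q i)"
  by (simp add: Fw_append F_def add.commute)

text \<open>The Laplacian of the complete graph on the three corners, with the sign of the normal derivatives.\<close>

definition lap3 :: "(3 \<Rightarrow> real) \<Rightarrow> 3 \<Rightarrow> real" where
  "lap3 b i = 2 * b i - b (i + 1) - b (i - 1)"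

context gasket begin

lemma Fw_fix: "Fw q (w @ [i]) (q i) = Fw q w (q i)"
  by (simp add: Fw_snoc F_fix)

lemma Fw_replicate_fix: "Fw q (w @ replicate k i) (q i) = Fw q w (q i)"
  by (induction k) (simp_all add: replicate_append_same[symmetric] Fw_fix del: append_assoc replicate_Suc add: append_assoc[symmetric] replicate_Suc)

lemma dist_Fw: "dist (Fw q w x) (Fw q w y) = dist x y / 2 ^ length w"
  by (induction w) (auto simp: dist_F)

lemma Fw_eq_iff: "Fw q w x = Fw q w y \<longleftrightarrow> x = y"
  by (induction w) (auto simp: F_eq_iff)

lemma continuous_Fw: "continuous_on S (Fw q w)"
proof (induction w)
  case (Cons j w)
  show ?case unfolding Fw.simps by (rule continuous_on_compose[OF Cons continuous_F])
qed (auto simp: id_def)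

lemma F_SG: "x \<in> SG q \<Longrightarrow> F q j x \<in> SG q"
  by (subst SG_props(3)) blast

lemma Fw_SG: "x \<in> SG q \<Longrightarrow> Fw q w x \<in> SG q"
  by (induction w) (auto intro: F_SG)

lemma cell_Nil: "cell q [] = SG q"
  by (simp add: cell_def)

lemma cell_Cons: "cell q (j # w) = F q j ` cell q w"
  by (simp add: cell_def image_comp)

lemma cell_snoc: "cell q w = (\<Union>j. cell q (w @ [j]))"
proof -
  have "cell q (w @ [j]) = Fw q w ` F q j ` SG q" for j
    unfolding cell_def image_image Fw_snoc ..
  then have "(\<Union>j. cell q (w @ [j])) = Fw q w ` (\<Union>j. F q j ` SG q)" by (simp add: image_UN)
  also have "\<dots> = cell q w" unfolding SG_props(3)[symmetric] cell_def ..
  finally show ?thesis ..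
qed

lemma cell_append_subset: "cell q (w @ v) \<subseteq> cell q w"
  unfolding cell_def by (auto simp: Fw_append intro: Fw_SG)

lemma cell_subset_SG: "cell q w \<subseteq> SG q"
  unfolding cell_def by (auto intro: Fw_SG)

lemma compact_cell: "compact (cell q w)"
  unfolding cell_def by (intro compact_continuous_image continuous_Fw SG_props)

lemma vertex_in_cell: "Fw q w (q i) \<in> cell q w"
  unfolding cell_def by (intro imageI q_SG)

lemma cell_subcell: "x \<in> cell q w \<Longrightarrow> \<exists>v. length v = n \<and> x \<in> cell q (w @ v)"
proof (induction n)
  case (Suc n)
  then obtain v where v: "length v = n" "x \<in> cell q (w @ v)" by blast
  then obtain j where "x \<in> cell q ((w @ v) @ [j])" using cell_snoc[of "w @ v"] by blast
  then show ?case using v by (intro exI[of _ "v @ [j]"]) auto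
qed auto

lemma SG_cell: "x \<in> SG q \<Longrightarrow> \<exists>w. length w = n \<and> x \<in> cell q w"
  using cell_subcell[of x "[]" n] by (simp add: cell_Nil)

lemma finite_words: "finite {w :: word. length w = n}"
  using finite_lists_length_eq[of "UNIV :: 3 set" n] by simp

lemma card_words: "card {w :: word. length w = n} = 3 ^ n"
  using card_lists_length_eq[of "UNIV :: 3 set" n] by simp

lemma words_Suc: "{w :: word. length w = Suc n} = (\<lambda>(w, j). w @ [j]) ` ({w. length w = n} \<times> UNIV)"
proof (intro equalityI subsetI)
  fix w :: word assume "w \<in> {w. length w = Suc n}"
  then have "w = butlast w @ [last w]" "length (butlast w) = n" by (auto simp: length_Suc_conv)
  then show "w \<in> (\<lambda>(w, j). w @ [j]) ` ({w. length w = n} \<times> UNIV)"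
    by (metis (mono_tags, lifting) SigmaI UNIV_I case_prod_conv image_eqI mem_Collect_eq)
qed auto

lemma sum_words_Suc:
  "(\<Sum>w | length w = Suc n. f (w :: word)) = (\<Sum>w | length w = n. \<Sum>j\<in>UNIV. f (w @ [j]))"
proof -
  have "(\<Sum>w | length w = Suc n. f w) = (\<Sum>(w, j) \<in> {w. length w = n} \<times> UNIV. f (w @ [j]))"
    unfolding words_Suc by (subst sum.reindex) (auto simp: inj_on_def intro!: sum.cong)
  then show ?thesis by (simp add: sum.cartesian_product)
qed

text \<open>At level \<open>n\<close> the coordinates of all vertices are integers divided by \<open>2\<^sup>n\<close>. This is how \<open>V_cell\<close>
recognises the vertices inside a cell.\<close>

lemma bary_Fw: "\<exists>z::int. \<forall>x. bary j (Fw q w x) = (bary j x + of_int z) / 2 ^ length w"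
proof (induction w)
  case (Cons i w)
  then obtain z :: int where z: "\<And>x. bary j (Fw q w x) = (bary j x + of_int z) / 2 ^ length w" by blast
  show ?case
    by (rule exI[of _ "z + (if i = j then 2 ^ length w else 0)"])
       (auto simp: z bary_F field_simps)
qed (auto intro: exI[of _ 0])

lemma V_eq: "V q n = {Fw q w (q i) | w i. length w = n}"
proof (induction n)
  case (Suc n)
  have "V q (Suc n) = (\<Union>j. F q j ` {Fw q w (q i) | w i. length w = n})" by (simp only: V.simps Suc)
  also have "\<dots> = {Fw q w (q i) | w i. length w = Suc n}"
  proof (intro equalityI subsetI)
    fix x assume "x \<in> (\<Union>j. F q j ` {Fw q w (q i) | w i. length w = n})"
    then obtain j w i where "x = Fw q (j # w) (q i)" "length w = n" by auto
    then show "x \<in> {Fw q w (q i) | w i. length w = Suc n}"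
      by (intro CollectI exI[of _ "j # w"] exI[of _ i]) simp
  next
    fix x assume "x \<in> {Fw q w (q i) | w i. length w = Suc n}"
    then obtain w i where w: "x = Fw q w (q i)" "length w = Suc n" by blast
    then obtain j v where v: "w = j # v" "length v = n" by (auto simp: length_Suc_conv)
    have "Fw q v (q i) \<in> {Fw q w (q i) | w i. length w = n}" using v by blast
    then show "x \<in> (\<Union>j. F q j ` {Fw q w (q i) | w i. length w = n})"
      unfolding w v by (intro UN_I[of j] UNIV_I) (simp only: Fw.simps o_apply imageI)
  qed
  finally show ?case .
qed auto

lemma bary_SG: assumes "x \<in> SG q" shows "0 \<le> bary j x" "bary j x \<le> 1"
proof -
  show *: "0 \<le> bary j x" for j using assms SG_props(4) by (auto simp: triangle_def)
  have "bary j x \<le> (\<Sum>j\<in>UNIV. bary j x)" using * by (intro member_le_sum) auto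
  then show "bary j x \<le> 1" by (simp add: bary_sum)
qed

lemma SG_eq_q: assumes "x \<in> SG q" "bary i x = 1" shows "x = q i"
proof (rule triangle_eqI)
  show "x \<in> triangle" using assms(1) SG_props(4) by blast
  show "q i \<in> triangle" by (rule q_triangle)
  fix j
  have nn: "\<forall>j. 0 \<le> bary j x" using bary_SG(1)[OF assms(1)] by blast
  have "\<forall>i j. bary i x = 1 \<longrightarrow> bary j x = (if i = j then 1 else 0)"
    using bary_sum[of x] nn unfolding sum3 all3 by (auto simp: neq3)
  then show "bary j x = bary j (q i)" using assms(2) by (simp add: bary_q)
qed

text \<open>The coordinates of \<open>y\<close> are integers by \<open>bary_Fw\<close>, nonnegative, and their sum is 1.\<close>

lemma V_cell:
  assumes "y \<in> SG q" "Fw q w y \<in> V q (length w)"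
  shows "\<exists>i. y = q i"
proof -
  obtain w' i where w': "Fw q w y = Fw q w' (q i)" "length w' = length w"
    using assms(2) unfolding V_eq by auto
  have "bary j y \<in> \<int>" for j
  proof -
    obtain z where z: "\<And>x. bary j (Fw q w x) = (bary j x + of_int z) / 2 ^ length w" using bary_Fw by blast
    obtain z' where z': "\<And>x. bary j (Fw q w' x) = (bary j x + of_int z') / 2 ^ length w'" using bary_Fw by blast
    have "bary j y = bary j (q i) + of_int z' - of_int z"
      using z[of y] z'[of "q i"] w' by simp
    then show ?thesis by (simp add: bary_q)
  qed
  then have "bary j y = 0 \<or> bary j y = 1" for j
    using bary_SG[OF assms(1), of j] by (smt (verit) Ints_cases of_int_le_iff of_int_0_le_iff of_int_le_1_iff of_int_1 of_int_0)
  moreover have "bary 0 y + bary 1 y + bary 2 y = 1" using bary_sum[of y] by (simp add: sum3)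
  ultimately have "\<exists>i. bary i y = 1" by (metis add_0 zero_neq_one)
  then show ?thesis using SG_eq_q[OF assms(1)] by blast
qed

text \<open>A common point of the images under \<open>F q i\<close> and \<open>F q j\<close> has \<open>i\<close>-th and \<open>j\<close>-th coordinate at least one half,
so it is the midpoint of \<open>q i\<close> and \<open>q j\<close>.\<close>

lemma F_meet:
  assumes "x \<in> SG q" "y \<in> SG q" "i \<noteq> j" "F q i x = F q j y"
  shows "x = q j" "y = q i"
proof -
  have "bary i (F q i x) \<ge> 1/2" "bary j (F q j y) \<ge> 1/2"
    using bary_SG(1)[OF assms(1), of i] bary_SG(1)[OF assms(2), of j] by (simp_all add: bary_F)
  moreover have "bary i (F q i x) + bary j (F q i x) \<le> 1"
  proof -
    have "(\<Sum>k\<in>{i, j}. bary k (F q i x)) \<le> (\<Sum>k\<in>UNIV. bary k (F q i x))"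
      using bary_SG(1)[OF F_SG[OF assms(1)]] by (intro sum_mono2) auto
    then show ?thesis using assms(3) by (simp add: bary_sum)
  qed
  ultimately have "bary i (F q i x) = 1/2" "bary j (F q i x) = 1/2" using assms(4) by auto
  moreover have "bary j (F q i x) = bary j x / 2" "bary i (F q i x) = bary i y / 2"
    using assms(3) bary_F[of j i x] bary_F[of i j y] by (simp_all add: assms(4))
  ultimately have "bary j x = 1" "bary i y = 1" by simp_all
  then show "x = q j" "y = q i" using SG_eq_q assms by blast+
qed

lemma q_in_cell: "q l \<in> cell q w \<Longrightarrow> \<exists>i. q l = Fw q w (q i)"
proof -
  assume "q l \<in> cell q w"
  then obtain y where y: "y \<in> SG q" "q l = Fw q w y" by (auto simp: cell_def)
  have "V q 0 \<subseteq> V q n" for n using V_mono by (induction n) blast+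
  then have "Fw q w y \<in> V q (length w)" using y by (metis V.simps(1) rangeI subsetD)
  then show ?thesis using V_cell y by blast
qed

text \<open>At the first letter where the words differ, \<open>F_meet\<close> turns the common point into a corner \<open>q l\<close> seen
from inside the remaining cell, and \<open>q l\<close> is a corner of every cell that contains it.\<close>

lemma cells_meet_vertex:
  assumes "length w = length w'" "w \<noteq> w'" "x \<in> cell q w" "x \<in> cell q w'"
  shows "\<exists>i. x = Fw q w (q i)"
  using assms
proof (induction w w' arbitrary: x rule: list_induct2)
  case (Cons j w j' w')
  obtain y y' where y: "y \<in> cell q w" "x = F q j y" "y' \<in> cell q w'" "x = F q j' y'"
    using Cons.prems by (auto simp: cell_Cons)
  show ?case
  proof (cases "j = j'")
    case True
    then have "y' = y" using y by (simp add: F_eq_iff)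
    then show ?thesis using Cons.IH[of y] Cons.prems True y by auto
  next
    case False
    have "y \<in> SG q" "y' \<in> SG q" using y cell_subset_SG by blast+
    then have "y = q j'" using F_meet(1)[OF _ _ False] y by metis
    then obtain i where "y = Fw q w (q i)" using q_in_cell[of j' w] y(1) by blast
    then show ?thesis using y(2) by (intro exI[of _ i]) simp
  qed
qed simp

definition incomparable :: "word \<Rightarrow> word \<Rightarrow> bool" where
  "incomparable w w' \<longleftrightarrow> (\<exists>k<min (length w) (length w'). w ! k \<noteq> w' ! k)"

lemma incomparable_cells:
  assumes "incomparable w w'"
  shows "\<exists>p. cell q w \<inter> cell q w' \<subseteq> {p}"
  using assms
proof (induction w arbitrary: w')
  case (Cons j w)
  obtain j' v where w': "w' = j' # v" using Cons.prems by (cases w') (auto simp: incomparable_def)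
  show ?case
  proof (cases "j = j'")
    case True
    obtain k where k: "k < min (length (j # w)) (length w')" "(j # w) ! k \<noteq> w' ! k"
      using Cons.prems unfolding incomparable_def by blast
    then obtain k' where k': "k = Suc k'" using True w' by (cases k) auto
    have "incomparable w v" unfolding incomparable_def
      by (rule exI[of _ k']) (use k in \<open>simp add: k' w'\<close>)
    then obtain p where "cell q w \<inter> cell q v \<subseteq> {p}" using Cons.IH by blast
    then have "cell q (j # w) \<inter> cell q w' \<subseteq> {F q j p}"
    proof -
      assume *: "cell q w \<inter> cell q v \<subseteq> {p}"
      have "inj (F q j)" by (intro injI) (simp add: F_eq_iff)
      then have "cell q (j # w) \<inter> cell q w' = F q j ` (cell q w \<inter> cell q v)"
        unfolding w' cell_Cons True[symmetric] by (simp add: image_Int)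
      then show ?thesis using * by blast
    qed
    then show ?thesis by blast
  next
    case False
    have "cell q (j # w) \<inter> cell q w' \<subseteq> {F q j (q j')}"
    proof
      fix x assume "x \<in> cell q (j # w) \<inter> cell q w'"
      then obtain y y' where y: "y \<in> cell q w" "y' \<in> cell q v" "x = F q j y" "x = F q j' y'"
        unfolding w' cell_Cons by blast
      then have "y \<in> SG q" "y' \<in> SG q" using cell_subset_SG by blast+
      then have "y = q j'" using F_meet(1)[OF _ _ False] y by metis
      then show "x \<in> {F q j (q j')}" using y by simp
    qed
    then show ?thesis by blast
  qed
qed (auto simp: incomparable_def)

lemma same_length_incomparable: "length w = length w' \<Longrightarrow> w \<noteq> w' \<Longrightarrow> incomparable w w'"
  unfolding incomparable_def by (auto simp: list_eq_iff_nth_eq)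

text \<open>An edge of a level graph lies in a single cell, since two cells of the same level share at most one
point. Hence a sum over words counts every edge once.\<close>

lemma Fw_vertex_inj:
  assumes "length w = length w'" "Fw q w (q i) = Fw q w' (q i')" "Fw q w (q j) = Fw q w' (q j')" "i \<noteq> j"
  shows "w = w' \<and> i = i' \<and> j = j'"
proof -
  have qi: "q i = q j \<longleftrightarrow> i = j" for i j using dist_q[of i j] side_pos by (cases "i = j") auto
  have "w = w'"
  proof (rule ccontr)
    assume "w \<noteq> w'"
    then obtain p where p: "cell q w \<inter> cell q w' \<subseteq> {p}"
      using incomparable_cells same_length_incomparable assms(1) by blast
    have "Fw q w (q i) = p" "Fw q w (q j) = p"
      using p vertex_in_cell[of w i] vertex_in_cell[of w' i'] vertex_in_cell[of w j] vertex_in_cell[of w' j'] assms(2,3) by auto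
    then have "q i = q j" using Fw_eq_iff by metis
    then show False using assms(4) qi by simp
  qed
  then show ?thesis using assms by (simp add: Fw_eq_iff qi)
qed

section \<open>Graph energies as sums over cells\<close>

lemma adj_set: "{(x, y). adj q m x y} =
  (\<lambda>(w, i, j). (Fw q w (q i), Fw q w (q j))) ` ({w. length w = m} \<times> {(i, j). i \<noteq> j})"
proof (intro equalityI subsetI)
  fix p assume "p \<in> {(x, y). adj q m x y}"
  then obtain x y w where p: "p = (x, y)" and *: "x \<in> V q m" "y \<in> V q m" "x \<noteq> y" "length w = m" "x \<in> cell q w" "y \<in> cell q w"
    unfolding adj_def by blast
  then obtain i j where "x = Fw q w (q i)" "y = Fw q w (q j)"
    using V_cell unfolding cell_def by (metis imageE)
  then show "p \<in> (\<lambda>(w, i, j). (Fw q w (q i), Fw q w (q j))) ` ({w. length w = m} \<times> {(i, j). i \<noteq> j})"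
    using * p by (intro image_eqI[of _ _ "(w, i, j)"]) auto
next
  fix p assume "p \<in> (\<lambda>(w, i, j). (Fw q w (q i), Fw q w (q j))) ` ({w. length w = m} \<times> {(i, j). i \<noteq> j})"
  then obtain w i j where p: "p = (Fw q w (q i), Fw q w (q j))" "length w = m" "i \<noteq> j" by auto
  have "q i \<noteq> q j" using dist_q[OF p(3)] side_pos by auto
  then have "Fw q w (q i) \<noteq> Fw q w (q j)" by (simp add: Fw_eq_iff)
  moreover have "Fw q w (q i) \<in> V q m" for i unfolding V_eq using p(2) by blast
  ultimately have "adj q m (Fw q w (q i)) (Fw q w (q j))"
    unfolding adj_def using p(2) vertex_in_cell by blast
  then show "p \<in> {(x, y). adj q m x y}" unfolding p(1) by blast
qed

lemma energy_level_eq: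
  "energy_level q m u v = (5/3) ^ m * (\<Sum>w | length w = m. \<Sum>i\<in>UNIV. v (Fw q w (q i)) * lap3 (\<lambda>i. u (Fw q w (q i))) i)"
proof -
  define I where "I = ({w :: word. length w = m} \<times> {(i :: 3, j :: 3). i \<noteq> j})"
  have inj: "inj_on (\<lambda>(w, i, j). (Fw q w (q i), Fw q w (q j))) I"
  proof (rule inj_onI)
    fix p p' assume "p \<in> I" "p' \<in> I" and eq: "(\<lambda>(w, i, j). (Fw q w (q i), Fw q w (q j))) p = (\<lambda>(w, i, j). (Fw q w (q i), Fw q w (q j))) p'"
    have "\<exists>w i j. p = (w, i, j) \<and> length w = m \<and> i \<noteq> j" if "p \<in> I" for p
      using that unfolding I_def by auto
    with \<open>p \<in> I\<close> \<open>p' \<in> I\<close> obtain w i j w' i' j' where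
      p: "p = (w, i, j)" "length w = m" "i \<noteq> j" "p' = (w', i', j')" "length w' = m" by metis
    then show "p = p'" using eq Fw_vertex_inj[of w w' i i' j j'] by simp
  qed
  have two: "(\<Sum>(i, j) \<in> {(i :: 3, j :: 3). i \<noteq> j}. (b i - b j) * (c i - c j)) = 2 * (\<Sum>i\<in>UNIV. c i * lap3 b i)"
    for b c :: "3 \<Rightarrow> real"
  proof -
    have "(\<Sum>(i, j) \<in> {(i :: 3, j :: 3). i \<noteq> j}. (b i - b j) * (c i - c j)) = (\<Sum>(i, j) \<in> UNIV \<times> UNIV. (b i - b j) * (c i - c j))"
      by (intro sum.mono_neutral_left) (auto simp: finite_cartesian_product simp flip: UNIV_Times_UNIV)
    also have "\<dots> = (\<Sum>i\<in>UNIV. \<Sum>j\<in>UNIV. (b i - b j) * (c i - c j))" by (simp add: sum.cartesian_product)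
    also have "\<dots> = 2 * (\<Sum>i\<in>UNIV. c i * lap3 b i)"
      unfolding sum3 lap3_def cyc3 by (simp add: algebra_simps)
    finally show ?thesis .
  qed
  have "(\<Sum>(x, y) \<in> {(x, y). adj q m x y}. (5/3) ^ m * (u x - u y) * (v x - v y))
    = (\<Sum>(w, i, j) \<in> I. (5/3) ^ m * ((u (Fw q w (q i)) - u (Fw q w (q j))) * (v (Fw q w (q i)) - v (Fw q w (q j)))))"
    unfolding adj_set I_def[symmetric] by (subst sum.reindex[OF inj]) (auto intro!: sum.cong)
  also have "\<dots> = (\<Sum>w | length w = m. \<Sum>(i, j) \<in> {(i, j). i \<noteq> j}. (5/3) ^ m * ((u (Fw q w (q i)) - u (Fw q w (q j))) * (v (Fw q w (q i)) - v (Fw q w (q j)))))"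
    unfolding I_def by (subst sum.cartesian_product) (auto intro!: sum.cong)
  also have "\<dots> = (\<Sum>w | length w = m. (5/3) ^ m * (2 * (\<Sum>i\<in>UNIV. v (Fw q w (q i)) * lap3 (\<lambda>i. u (Fw q w (q i))) i)))"
  proof (intro sum.cong refl)
    fix w :: word
    show "(\<Sum>(i, j) \<in> {(i, j). i \<noteq> j}. (5/3) ^ m * ((u (Fw q w (q i)) - u (Fw q w (q j))) * (v (Fw q w (q i)) - v (Fw q w (q j)))))
     = (5/3) ^ m * (2 * (\<Sum>i\<in>UNIV. v (Fw q w (q i)) * lap3 (\<lambda>i. u (Fw q w (q i))) i))"
      unfolding two[of "\<lambda>i. u (Fw q w (q i))" "\<lambda>i. v (Fw q w (q i))", symmetric]
      by (simp add: sum_distrib_left case_prod_unfold)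
  qed
  finally show ?thesis unfolding energy_level_def by (simp only: sum_distrib_left[symmetric] nonzero_mult_div_cancel_left zero_neq_numeral not_False_eq_True mult.left_commute[of _ 2])
qed

end

section \<open>The self-similar measure\<close>

lemma finite_measure_eq_on_open:
  fixes M N :: "'a :: topological_space measure"
  assumes M: "finite_measure M" "sets M = sets (restrict_space borel S)"
    and N: "finite_measure N" "sets N = sets (restrict_space borel S)"
    and eq: "\<And>U. open U \<Longrightarrow> emeasure M (U \<inter> S) = emeasure N (U \<inter> S)"
  shows "M = N"
proof -
  have sp: "space M = S" "space N = S"
    using M(2) N(2) by (auto dest!: sets_eq_imp_space_eq simp: space_restrict_space)
  have m: "(\<lambda>x. x) \<in> measurable (restrict_space borel S) borel"
    by (intro measurable_restrict_space1) simp
  have mM: "(\<lambda>x. x) \<in> measurable M borel" and mN: "(\<lambda>x. x) \<in> measurable N borel"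
    using m M(2) N(2) by (simp_all cong: measurable_cong_sets)
  have e: "emeasure (distr M borel (\<lambda>x. x)) B = emeasure M (B \<inter> S)"
    "emeasure (distr N borel (\<lambda>x. x)) B = emeasure N (B \<inter> S)" if "B \<in> sets borel" for B
    using emeasure_distr[OF mM that] emeasure_distr[OF mN that] by (simp_all add: sp vimage_def Int_def)
  have "distr M borel (\<lambda>x. x) = distr N borel (\<lambda>x. x)"
  proof (rule measure_eqI_generator_eq[where \<Omega> = UNIV and E = "{U. open U}" and A = "\<lambda>_. UNIV"])
    show "Int_stable {U :: 'a set. open U}" by (auto simp: Int_stable_def)
    show "sets (distr M borel (\<lambda>x. x)) = sigma_sets UNIV {U. open U}"
      "sets (distr N borel (\<lambda>x. x)) = sigma_sets UNIV {U. open U}"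
      by (simp_all add: borel_def)
    show "emeasure (distr M borel (\<lambda>x. x)) UNIV \<noteq> \<infinity>"
      using finite_measure.emeasure_finite[OF M(1)] by (simp add: e)
  qed (auto simp: e eq)
  then have eqB: "emeasure M (B \<inter> S) = emeasure N (B \<inter> S)" if "B \<in> sets borel" for B
    using e[OF that] by simp
  show ?thesis
  proof (rule measure_eqI)
    show "sets M = sets N" using M N by simp
    fix A assume "A \<in> sets M"
    then obtain B where "B \<in> sets borel" "A = B \<inter> S"
      unfolding M(2) sets_restrict_space by auto
    then show "emeasure M A = emeasure N A" using eqB by simp
  qed
qed

context gasket begin

definition diam :: real where "diam = (SOME D. D > 0 \<and> (\<forall>x\<in>SG q. \<forall>y\<in>SG q. dist x y \<le> D))"

lemma diam: "diam > 0" "x \<in> SG q \<Longrightarrow> y \<in> SG q \<Longrightarrow> dist x y \<le> diam"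
proof -
  obtain D where D: "\<forall>x\<in>SG q. \<forall>y\<in>SG q. dist x y \<le> D"
    using bounded_two_points[of "SG q"] compact_imp_bounded[OF SG_props(1)] by blast
  have "\<exists>D. D > 0 \<and> (\<forall>x\<in>SG q. \<forall>y\<in>SG q. dist x y \<le> D)"
    by (rule exI[of _ "max D 1"]) (use D in \<open>auto simp: le_max_iff_disj\<close>)
  from someI_ex[OF this]
  have "diam > 0 \<and> (\<forall>x\<in>SG q. \<forall>y\<in>SG q. dist x y \<le> diam)" unfolding diam_def .
  then show "diam > 0" "x \<in> SG q \<Longrightarrow> y \<in> SG q \<Longrightarrow> dist x y \<le> diam" by blast+
qed

lemma cell_diam: "x \<in> cell q w \<Longrightarrow> y \<in> cell q w \<Longrightarrow> dist x y \<le> diam / 2 ^ length w"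
  unfolding cell_def by (auto simp: dist_Fw diam divide_right_mono)

lemma cells_small:
  assumes "e > 0"
  shows "\<exists>N. \<forall>n\<ge>N. diam / 2 ^ n < e"
proof -
  have "(\<lambda>n. diam * (1/2) ^ n) \<longlonglongrightarrow> diam * 0" by (intro tendsto_intros) auto
  then have "(\<lambda>n. diam / 2 ^ n) \<longlonglongrightarrow> 0" by (simp add: power_divide)
  from order_tendstoD(2)[OF this assms] show ?thesis unfolding eventually_sequentially .
qed

lemma cells_in_open:
  assumes "open U" "x \<in> U"
  shows "\<exists>N. \<forall>n\<ge>N. \<forall>w. length w = n \<longrightarrow> x \<in> cell q w \<longrightarrow> cell q w \<subseteq> U"
proof -
  obtain e where e: "e > 0" "ball x e \<subseteq> U" using assms open_contains_ball by blast
  obtain N where N: "\<And>n. n \<ge> N \<Longrightarrow> diam / 2 ^ n < e" using cells_small[OF e(1)] by blast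
  show ?thesis
  proof (intro exI[of _ N] allI impI subsetI)
    fix n w y assume "N \<le> n" "length w = n" "x \<in> cell q w" "y \<in> cell q w"
    then have "dist x y < e" using cell_diam[of x w y] N[of n] by simp
    then show "y \<in> U" using e(2) by auto
  qed
qed

lemma sets_cell: "cell q w \<in> sets (restrict_space borel (SG q))"
  unfolding sets_restrict_space
proof (rule image_eqI)
  show "cell q w = SG q \<inter> cell q w" using cell_subset_SG by blast
  show "cell q w \<in> sets borel" by (intro borel_closed compact_imp_closed compact_cell)
qed

text \<open>Subadditivity bounds the measure from above, for \<open>W\<close> and for its complement. The \<open>3\<^sup>n\<close> cells of level
\<open>n\<close> cover the gasket, and their measures add up to 1, so that both bounds are attained.\<close>

lemma card_measure_cells:
  assumes "prob_space M" "sets M = sets (restrict_space borel (SG q))"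
    and cell: "\<And>w. measure M (cell q w) = (1/3) ^ length w"
    and W: "W \<subseteq> {w. length w = n}"
  shows "measure M (\<Union>w\<in>W. cell q w) = card W * (1/3) ^ n"
proof -
  interpret prob_space M by fact
  have sp: "space M = SG q"
    using sets_eq_imp_space_eq[OF assms(2)] by (simp add: space_restrict_space)
  have s[measurable]: "cell q w \<in> sets M" for w using sets_cell assms(2) by simp
  have le: "measure M (\<Union>w\<in>W. cell q w) \<le> card W * (1/3) ^ n" if "W \<subseteq> {w. length w = n}" for W
  proof -
    have "finite W" using that finite_words finite_subset by blast
    then have "measure M (\<Union>w\<in>W. cell q w) \<le> (\<Sum>w\<in>W. measure M (cell q w))"
      by (intro measure_UNION_le) auto
    also have "\<dots> = card W * (1/3) ^ n" using that by (simp add: cell subset_iff)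
    finally show ?thesis .
  qed
  \<comment> \<open>Compare with the complement: both upper bounds together reach the total mass.\<close>
  define W' where "W' = {w. length w = n} - W"
  have finW: "finite W" "finite W'" using W finite_words finite_subset W'_def by blast+
  have "card W + card W' = 3 ^ n" unfolding W'_def
    using card_Diff_subset[OF finW(1) W] card_mono[OF finite_words W] by (simp add: card_words)
  then have "real (card W + card W') = real (3 ^ n)" by (rule arg_cong)
  then have c: "real (card W) + real (card W') = 3 ^ n" by simp
  have "SG q = (\<Union>w\<in>W. cell q w) \<union> (\<Union>w\<in>W'. cell q w)"
  proof (intro equalityI subsetI)
    fix x assume "x \<in> SG q"
    then obtain w where w: "length w = n" "x \<in> cell q w" using SG_cell by blast
    show "x \<in> (\<Union>w\<in>W. cell q w) \<union> (\<Union>w\<in>W'. cell q w)"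
      by (cases "w \<in> W") (use w W'_def in auto)
  next
    fix x assume "x \<in> (\<Union>w\<in>W. cell q w) \<union> (\<Union>w\<in>W'. cell q w)"
    then obtain w where "x \<in> cell q w" by blast
    then show "x \<in> SG q" using cell_subset_SG by (rule subsetD[rotated])
  qed
  then have "1 = measure M ((\<Union>w\<in>W. cell q w) \<union> (\<Union>w\<in>W'. cell q w))"
    using prob_space sp by simp
  also have "\<dots> \<le> measure M (\<Union>w\<in>W. cell q w) + measure M (\<Union>w\<in>W'. cell q w)"
    using finW by (intro measure_Un_le sets.finite_UN) auto
  finally have "1 \<le> measure M (\<Union>w\<in>W. cell q w) + card W' * (1/3) ^ n"
    using le[of W'] W'_def by fastforce
  moreover have "(real (card W) + real (card W')) * (1/3) ^ n = 1"
    unfolding c by (simp add: power_divide)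
  ultimately show ?thesis using le[OF W] by (simp add: algebra_simps)
qed

text \<open>A relatively open set is the increasing union of the cells of level \<open>n\<close> that it contains, and the
measure of such a union is found by counting cells.\<close>

lemma self_similar_measure_unique:
  assumes M: "prob_space M" "sets M = sets (restrict_space borel (SG q))"
      "\<And>w. measure M (cell q w) = (1/3) ^ length w"
    and N: "prob_space N" "sets N = sets (restrict_space borel (SG q))"
      "\<And>w. measure N (cell q w) = (1/3) ^ length w"
  shows "M = N"
proof (rule finite_measure_eq_on_open)
  interpret M: prob_space M by fact
  interpret N: prob_space N by fact
  show "finite_measure M" "finite_measure N" by unfold_locales
  show "sets M = sets (restrict_space borel (SG q))" "sets N = sets (restrict_space borel (SG q))" by fact+
  fix U :: "point set" assume U: "open U"
  define A where "A n = (\<Union>w\<in>{w. length w = n \<and> cell q w \<subseteq> U}. cell q w)" for n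
  have fin: "finite {w. length w = n \<and> cell q w \<subseteq> U}" for n
    by (rule finite_subset[OF _ finite_words[of n]]) auto
  have sA: "range A \<subseteq> sets (restrict_space borel (SG q))"
    unfolding A_def using fin sets_cell by (intro image_subsetI sets.finite_UN) auto
  have inc: "incseq A"
  proof (rule incseq_SucI, rule subsetI)
    fix n x assume "x \<in> A n"
    then obtain w where w: "length w = n" "cell q w \<subseteq> U" "x \<in> cell q w" unfolding A_def by blast
    then obtain j where j: "x \<in> cell q (w @ [j])" using cell_snoc[of w] by blast
    then show "x \<in> A (Suc n)" unfolding A_def using w cell_append_subset[of w "[j]"]
      by (intro UN_I[of "w @ [j]"]) auto
  qed
  have UN: "(\<Union>n. A n) = U \<inter> SG q"
  proof (intro equalityI subsetI)
    fix x assume x: "x \<in> U \<inter> SG q"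
    then obtain n where "\<forall>w. length w = n \<longrightarrow> x \<in> cell q w \<longrightarrow> cell q w \<subseteq> U"
      using cells_in_open[OF U, of x] by blast
    moreover obtain w where "length w = n" "x \<in> cell q w" using SG_cell x by blast
    ultimately show "x \<in> (\<Union>n. A n)" unfolding A_def by blast
  qed (use cell_subset_SG A_def in blast)
  have sub: "{w. length w = n \<and> cell q w \<subseteq> U} \<subseteq> {w. length w = n}" for n by blast
  have "measure M (A n) = measure N (A n)" for n
    unfolding A_def card_measure_cells[OF M sub] card_measure_cells[OF N sub] ..
  then have "(\<lambda>n. measure M (A n)) \<longlonglongrightarrow> measure N (U \<inter> SG q)"
    using N.finite_Lim_measure_incseq[OF _ inc] sA N(2) UN by simp
  moreover have "(\<lambda>n. measure M (A n)) \<longlonglongrightarrow> measure M (U \<inter> SG q)"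
    using M.finite_Lim_measure_incseq[OF _ inc] sA M(2) UN by simp
  ultimately have "measure M (U \<inter> SG q) = measure N (U \<inter> SG q)" by (rule LIMSEQ_unique[symmetric])
  then show "emeasure M (U \<inter> SG q) = emeasure N (U \<inter> SG q)"
    by (simp add: M.emeasure_eq_measure N.emeasure_eq_measure)
qed

text \<open>The point with address \<open>\<omega>\<close>, which is the limit of the points \<open>Fw q (stake n \<omega>) x\<close> for every \<open>x\<close>.\<close>

definition code :: "3 stream \<Rightarrow> point" where
  "code \<omega> = (\<Sum>n. (1/2) ^ Suc n *\<^sub>R q (\<omega> !! n))"

lemma code_term:
  "norm ((1/2) ^ Suc n *\<^sub>R q (\<omega> !! n)) \<le> (1/2) ^ Suc n * (\<Sum>j\<in>UNIV. norm (q j))"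
proof -
  have "norm (q (\<omega> !! n)) \<le> (\<Sum>j\<in>UNIV. norm (q j))" by (rule member_le_sum) auto
  then show ?thesis by (simp add: mult_left_mono divide_right_mono)
qed

lemma half_sums: "(\<lambda>n. (1/2) ^ Suc n * c) sums (c :: real)"
  using sums_mult2[OF power_half_series, of c] by simp

lemma code_summable: "summable (\<lambda>n. (1/2) ^ Suc n *\<^sub>R q (\<omega> !! n))"
  by (rule summable_comparison_test'[OF sums_summable[OF half_sums] code_term])

lemma code_Cons: "code (j ## \<omega>) = F q j (code \<omega>)"
proof -
  have "code (j ## \<omega>) = (\<Sum>n. (1/2) ^ Suc (Suc n) *\<^sub>R q ((j ## \<omega>) !! Suc n)) + (1/2) *\<^sub>R q j"
    unfolding code_def by (subst suminf_split_head[OF code_summable]) simp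
  also have "(\<Sum>n. (1/2) ^ Suc (Suc n) *\<^sub>R q ((j ## \<omega>) !! Suc n)) = (\<Sum>n. (1/2) *\<^sub>R ((1/2) ^ Suc n *\<^sub>R q (\<omega> !! n)))"
    by simp
  also have "\<dots> = (1/2) *\<^sub>R code \<omega>"
    unfolding code_def by (rule suminf_scaleR_right[OF code_summable, symmetric])
  finally show ?thesis by (simp add: F_def scaleR_add_right)
qed

lemma norm_code: "norm (code \<omega>) \<le> (\<Sum>j\<in>UNIV. norm (q j))"
proof -
  have "norm (code \<omega>) \<le> (\<Sum>n. (1/2) ^ Suc n * (\<Sum>j\<in>UNIV. norm (q j)))"
    unfolding code_def by (rule norm_suminf_le[OF code_term sums_summable[OF half_sums]])
  also have "\<dots> = (\<Sum>j\<in>UNIV. norm (q j))" by (rule sums_unique[OF half_sums, symmetric])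
  finally show ?thesis .
qed

lemma code_SG: "code \<omega> \<in> SG q"
proof -
  have "\<exists>w. length w = n \<and> (\<exists>\<omega>'. code \<omega> = Fw q w (code \<omega>'))" for n
  proof (induction n arbitrary: \<omega>)
    case (Suc n)
    obtain j \<omega>' where \<omega>: "\<omega> = j ## \<omega>'" by (cases \<omega>)
    obtain w \<omega>'' where "length w = n" "code \<omega>' = Fw q w (code \<omega>'')" using Suc by blast
    then show ?case unfolding \<omega> code_Cons by (intro exI[of _ "j # w"]) auto
  qed auto
  then obtain w \<omega>' where w: "\<And>n. length (w n) = n" "\<And>n. code \<omega> = Fw q (w n) (code (\<omega>' n))" by metis
  define B where "B = (\<Sum>j\<in>UNIV. norm (q j)) + norm (q 0)"
  have "(\<lambda>n. Fw q (w n) (q 0)) \<longlonglongrightarrow> code \<omega>"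
  proof (rule Lim_null_comparison[THEN LIM_zero_cancel])
    show "\<forall>\<^sub>F n in sequentially. norm (Fw q (w n) (q 0) - code \<omega>) \<le> B * (1/2) ^ n"
    proof (intro always_eventually allI)
      fix n
      have "norm (Fw q (w n) (q 0) - code \<omega>) = dist (q 0) (code (\<omega>' n)) / 2 ^ n"
        using dist_Fw[of "w n" "q 0" "code (\<omega>' n)"] w(2)[of n] by (simp add: dist_norm w(1))
      also have "dist (q 0) (code (\<omega>' n)) \<le> B"
        unfolding B_def dist_norm using norm_triangle_ineq4[of "q 0" "code (\<omega>' n)"] norm_code[of "\<omega>' n"] by simp
      finally show "norm (Fw q (w n) (q 0) - code \<omega>) \<le> B * (1/2) ^ n"
        by (simp add: power_divide divide_right_mono)
    qed
    have "(\<lambda>n. B * (1/2) ^ n) \<longlonglongrightarrow> B * 0" by (intro tendsto_intros) auto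
    then show "(\<lambda>n. B * (1/2) ^ n) \<longlonglongrightarrow> 0" by simp
  qed
  then show ?thesis
    by (rule closed_sequentially[OF compact_imp_closed[OF SG_props(1)], rotated]) (intro Fw_SG q_SG)
qed

definition coin :: "3 stream measure" where
  "coin = stream_space (measure_pmf (pmf_of_set UNIV))"

lemma prob_space_coin: "prob_space coin"
  unfolding coin_def by (intro prob_space.prob_space_stream_space measure_pmf.prob_space_axioms)

lemma measurable_code: "code \<in> measurable coin (restrict_space borel (SG q))"
proof (rule measurable_restrict_space2)
  have [measurable]: "q \<in> measurable (measure_pmf (pmf_of_set UNIV)) borel" by simp
  show "code \<in> borel_measurable coin" unfolding code_def coin_def by measurable
qed (simp add: code_SG)

text \<open>Prefixing a random letter to a random address does not change its law, and on points this prefixing is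
the application of a random \<open>F q j\<close>. Hence the law of the random point is self-similar.\<close>

definition nu :: "point measure" where
  "nu = distr coin (restrict_space borel (SG q)) code"

lemma sets_nu: "sets nu = sets (restrict_space borel (SG q))"
  by (simp add: nu_def)

lemma space_nu: "space nu = SG q"
  by (simp add: nu_def space_restrict_space)

lemma prob_space_nu: "prob_space nu"
  unfolding nu_def by (rule prob_space.prob_space_distr[OF prob_space_coin measurable_code])

lemma nu_self_similar:
  assumes A: "A \<in> sets nu"
  shows "measure nu A = (\<Sum>j\<in>UNIV. (1/3) * measure nu (F q j -` A \<inter> SG q))"
proof -
  interpret P: prob_space coin by (rule prob_space_coin)
  interpret N: prob_space nu by (rule prob_space_nu)
  have Am: "A \<in> sets (restrict_space borel (SG q))" using A sets_nu by simp
  have Fm: "F q j \<in> measurable (restrict_space borel (SG q)) (restrict_space borel (SG q))" for j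
  proof (rule measurable_restrict_space2)
    show "F q j \<in> borel_measurable (restrict_space borel (SG q))"
      by (intro measurable_restrict_space1 borel_measurable_continuous_onI continuous_F)
  qed (auto simp: space_restrict_space F_SG)
  have FA: "F q j -` A \<inter> SG q \<in> sets (restrict_space borel (SG q))" for j
    using measurable_sets[OF Fm Am] by (simp add: space_restrict_space)
  define X where "X = code -` A \<inter> space coin"
  have X: "X \<in> sets coin" unfolding X_def by (rule measurable_sets[OF measurable_code Am])
  have e: "emeasure coin {\<omega> \<in> space coin. j ## \<omega> \<in> X} = emeasure nu (F q j -` A \<inter> SG q)" for j
  proof -
    have "{\<omega> \<in> space coin. j ## \<omega> \<in> X} = code -` (F q j -` A \<inter> SG q) \<inter> space coin"
      unfolding X_def coin_def by (auto simp: code_Cons code_SG space_stream_space)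
    then show ?thesis unfolding nu_def using emeasure_distr[OF measurable_code FA] by simp
  qed
  have "emeasure nu A = emeasure coin X"
    unfolding nu_def X_def by (rule emeasure_distr[OF measurable_code Am])
  also have "\<dots> = (\<integral>\<^sup>+ j. emeasure coin {\<omega> \<in> space coin. j ## \<omega> \<in> X} \<partial>measure_pmf (pmf_of_set UNIV))"
    unfolding coin_def
    by (rule prob_space.emeasure_stream_space[OF measure_pmf.prob_space_axioms X[unfolded coin_def]])
  also have "\<dots> = (\<Sum>j\<in>UNIV. emeasure nu (F q j -` A \<inter> SG q)) / 3"
    unfolding e by (subst nn_integral_pmf_of_set) auto
  also have "\<dots> = ennreal ((\<Sum>j\<in>UNIV. measure nu (F q j -` A \<inter> SG q)) / 3)"
    by (simp add: N.emeasure_eq_measure sum_nonneg divide_ennreal[symmetric])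
  finally have "measure nu A = (\<Sum>j\<in>UNIV. measure nu (F q j -` A \<inter> SG q)) / 3"
    by (subst (asm) N.emeasure_eq_measure) (simp add: sum_nonneg)
  then show ?thesis by (simp only: sum_distrib_left[symmetric])
qed

lemma singleton_sets: "x \<in> SG q \<Longrightarrow> {x} \<in> sets (restrict_space borel (SG q))"
  unfolding sets_restrict_space by (rule image_eqI[of _ _ "{x}"]) auto

text \<open>Let \<open>s\<close> be the supremum of the measures of points. The three cells of level one have no common point, so
a point has at most two preimages, and self-similarity gives \<open>s \<le> 2/3 s\<close>.\<close>

lemma nu_singleton: "measure nu {x} = 0"
proof -
  interpret N: prob_space nu by (rule prob_space_nu)
  define s where "s = (SUP x. measure nu {x})"
  have bd: "bdd_above (range (\<lambda>x. measure nu {x}))"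
    using N.prob_le_1 by (intro bdd_aboveI[of _ 1]) blast
  have le: "measure nu {x} \<le> s" for x unfolding s_def by (rule cSUP_upper[OF UNIV_I bd])
  have s0: "0 \<le> s" using le[of x] measure_nonneg[of nu "{x}"] by linarith
  have "measure nu {x} \<le> 2/3 * s" for x
  proof (cases "x \<in> SG q")
    case False
    then have "{x} \<notin> sets nu" using sets.sets_into_space[of "{x}" nu] by (auto simp: space_nu)
    then show ?thesis using s0 by (simp add: measure_notin_sets)
  next
    case True
    define S where "S j = F q j -` {x} \<inter> SG q" for j
    have Sle: "measure nu (S j) \<le> s" for j
    proof (cases "S j = {}")
      case False
      then obtain y where "y \<in> S j" by blast
      then have "S j = {y}" unfolding S_def using F_eq_iff[of j] by auto
      then show ?thesis using le by simp
    qed (use s0 in simp)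
    have "S 0 = {} \<or> S 1 = {} \<or> S 2 = {}"
    proof (rule ccontr)
      assume "\<not> ?thesis"
      then obtain a b c where "a \<in> S 0" "b \<in> S 1" "c \<in> S 2" by blast
      then have "a = q 1" "a = q 2"
        using F_meet(1)[of a b 0 1] F_meet(1)[of a c 0 2] neq3 unfolding S_def by auto
      then show False using dist_q[of 1 2] side_pos neq3 by auto
    qed
    then have "measure nu (S 0) + measure nu (S 1) + measure nu (S 2) \<le> 2 * s"
      using Sle[of 0] Sle[of 1] Sle[of 2] s0 by auto
    moreover have "measure nu {x} = (\<Sum>j\<in>UNIV. (1/3) * measure nu (S j))"
      unfolding S_def by (rule nu_self_similar) (use True singleton_sets sets_nu in simp)
    ultimately show ?thesis unfolding sum3 by simp
  qed
  then have "s \<le> 2/3 * s" unfolding s_def by (intro cSUP_least) (auto simp: s_def)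
  then show ?thesis using s0 le[of x] measure_nonneg[of nu "{x}"] by linarith
qed

lemma nu_cell: "measure nu (cell q w) = (1/3) ^ length w"
proof (induction w)
  case Nil
  interpret N: prob_space nu by (rule prob_space_nu)
  show ?case using N.prob_space by (simp add: cell_Nil space_nu)
next
  case (Cons j w)
  interpret N: prob_space nu by (rule prob_space_nu)
  have m: "measure nu (F q i -` cell q (j # w) \<inter> SG q) = (if i = j then (1/3) ^ length w else 0)" for i
  proof (cases "i = j")
    case True
    have "F q i -` cell q (j # w) \<inter> SG q = cell q w"
      unfolding True cell_Cons using cell_subset_SG by (auto simp: F_eq_iff)
    then show ?thesis using Cons True by simp
  next
    case False
    have "F q i -` cell q (j # w) \<inter> SG q \<subseteq> {q j}"
    proof
      fix x assume "x \<in> F q i -` cell q (j # w) \<inter> SG q"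
      then obtain y where y: "y \<in> cell q w" "F q i x = F q j y" "x \<in> SG q" unfolding cell_Cons by auto
      then have "y \<in> SG q" using cell_subset_SG by blast
      then show "x \<in> {q j}" using F_meet(1)[OF y(3) _ False y(2)] by simp
    qed
    then have "measure nu (F q i -` cell q (j # w) \<inter> SG q) \<le> measure nu {q j}"
      using singleton_sets[OF q_SG] sets_nu by (intro N.finite_measure_mono) auto
    then show ?thesis using False nu_singleton measure_nonneg[of nu "F q i -` cell q (j # w) \<inter> SG q"]
      by (simp add: measure_le_0_iff)
  qed
  have "measure nu (cell q (j # w)) = (\<Sum>i\<in>UNIV. (1/3) * (if i = j then (1/3) ^ length w else 0))"
    unfolding m[symmetric] by (rule nu_self_similar) (use sets_cell sets_nu in simp)
  also have "\<dots> = (\<Sum>i\<in>UNIV. if i = j then (1/3) * (1/3) ^ length w else 0)"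
    by (intro sum.cong) auto
  also have "\<dots> = (1/3) ^ length (j # w)" by simp
  finally show ?case .
qed

lemma mu_eq_nu: "mu q = nu"
  unfolding mu_def
proof (rule the_equality)
  show "sets nu = sets (restrict_space borel (SG q)) \<and> prob_space nu \<and>
     (\<forall>w. measure nu (cell q w) = (1/3) ^ length w) \<and>
     (\<forall>A\<in>sets nu. measure nu A = (\<Sum>j\<in>UNIV. (1/3) * measure nu (F q j -` A \<inter> SG q)))"
    by (intro conjI ballI allI sets_nu prob_space_nu nu_cell nu_self_similar)
  fix M assume "sets M = sets (restrict_space borel (SG q)) \<and> prob_space M \<and>
     (\<forall>w. measure M (cell q w) = (1/3) ^ length w) \<and>
     (\<forall>A\<in>sets M. measure M A = (\<Sum>j\<in>UNIV. (1/3) * measure M (F q j -` A \<inter> SG q)))"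
  then show "M = nu"
    using self_similar_measure_unique[OF _ _ _ prob_space_nu sets_nu nu_cell, of M] by blast
qed

lemma sets_mu: "sets (mu q) = sets (restrict_space borel (SG q))"
  and space_mu: "space (mu q) = SG q"
  and measure_cell: "measure (mu q) (cell q w) = (1/3) ^ length w"
  and prob_space_mu: "prob_space (mu q)"
  unfolding mu_eq_nu by (rule sets_nu, rule space_nu, rule nu_cell, rule prob_space_nu)

sublocale mu: prob_space "mu q" by (rule prob_space_mu)

lemma cell_measurable [measurable]: "cell q w \<in> sets (mu q)"
  using sets_cell sets_mu by simp

lemma AE_neq: "AE x in mu q. x \<noteq> p"
proof (cases "p \<in> SG q")
  case True
  show ?thesis
  proof (rule AE_I)
    show "{x \<in> space (mu q). \<not> x \<noteq> p} \<subseteq> {p}" by blast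
    show "{p} \<in> sets (mu q)" using singleton_sets[OF True] sets_mu by simp
    show "emeasure (mu q) {p} = 0" using mu.emeasure_eq_measure[of "{p}"] by (simp add: mu_eq_nu nu_singleton)
  qed
qed (auto simp: space_mu intro!: AE_I2)

lemma countable_words: "countable (UNIV :: word set)"
  using countable_lists[of "UNIV :: 3 set"] by (simp add: countable_finite lists_UNIV)

lemma AE_cells_disjoint:
  "AE x in mu q. \<forall>w w'. incomparable w w' \<longrightarrow> x \<in> cell q w \<longrightarrow> x \<notin> cell q w'"
proof -
  have "AE x in mu q. \<forall>p\<in>UNIV. incomparable (fst p) (snd p) \<longrightarrow> x \<in> cell q (fst p) \<longrightarrow> x \<notin> cell q (snd p)"
  proof (rule AE_ball_countable')
    show "countable (UNIV :: (word \<times> word) set)"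
      using countable_SIGMA[OF countable_words, of "\<lambda>_. UNIV"] countable_words by simp
    fix p :: "word \<times> word"
    show "AE x in mu q. incomparable (fst p) (snd p) \<longrightarrow> x \<in> cell q (fst p) \<longrightarrow> x \<notin> cell q (snd p)"
    proof (cases "incomparable (fst p) (snd p)")
      case True
      then obtain c where "cell q (fst p) \<inter> cell q (snd p) \<subseteq> {c}" using incomparable_cells by blast
      then show ?thesis using AE_neq[of c] by (elim AE_mp) (auto intro!: AE_I2)
    qed simp
  qed
  then show ?thesis by simp
qed

lemma AE_indicator_cells:
  "AE x in mu q. \<forall>n. (\<Sum>w | length w = n. indicator (cell q w) x) = (1 :: real)"
  "AE x in mu q. \<forall>w. (\<Sum>j\<in>UNIV. indicator (cell q (w @ [j])) x) = (indicator (cell q w) x :: real)"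
proof -
  show "AE x in mu q. \<forall>n. (\<Sum>w | length w = n. indicator (cell q w) x) = (1 :: real)"
    using AE_cells_disjoint AE_space
  proof eventually_elim
    case (elim x)
    show ?case
    proof
      fix n
      obtain v where v: "length v = n" "x \<in> cell q v" using SG_cell elim(2) space_mu by blast
      have "(\<Sum>w | length w = n. indicator (cell q w) x) = (\<Sum>w | length w = n. if w = v then 1 else (0::real))"
      proof (intro sum.cong refl)
        fix w :: word assume "w \<in> {w. length w = n}"
        then have "w \<noteq> v \<Longrightarrow> incomparable v w" using v same_length_incomparable by auto
        then have "w \<noteq> v \<Longrightarrow> x \<notin> cell q w" using elim(1) v(2) by blast
        then show "indicator (cell q w) x = (if w = v then 1 else (0::real))" using v(2) by (cases "w = v") auto
      qed
      then show "(\<Sum>w | length w = n. indicator (cell q w) x) = (1 :: real)"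
        using v(1) finite_words[of n] by simp
    qed
  qed
  show "AE x in mu q. \<forall>w. (\<Sum>j\<in>UNIV. indicator (cell q (w @ [j])) x) = (indicator (cell q w) x :: real)"
    using AE_cells_disjoint
  proof eventually_elim
    case (elim x)
    show ?case
    proof
      fix w
      show "(\<Sum>j\<in>UNIV. indicator (cell q (w @ [j])) x) = (indicator (cell q w) x :: real)"
      proof (cases "x \<in> cell q w")
        case True
        then obtain i where i: "x \<in> cell q (w @ [i])" using cell_snoc[of w] by blast
        have "(\<Sum>j\<in>UNIV. indicator (cell q (w @ [j])) x) = (\<Sum>j\<in>UNIV. if j = i then 1 else (0::real))"
        proof (intro sum.cong refl)
          fix j
          have "j \<noteq> i \<Longrightarrow> incomparable (w @ [i]) (w @ [j])"
            by (rule same_length_incomparable) auto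
          then have "j \<noteq> i \<Longrightarrow> x \<notin> cell q (w @ [j])" using elim i by blast
          then show "indicator (cell q (w @ [j])) x = (if j = i then 1 else (0::real))" using i by (cases "j = i") auto
        qed
        then show ?thesis using True by simp
      next
        case False
        then have "x \<notin> cell q (w @ [j])" for j using cell_append_subset[of w "[j]"] by blast
        then show ?thesis using False by simp
      qed
    qed
  qed
qed

section \<open>Functions determined by their vertex values\<close>

text \<open>The number \<open>g w i\<close> is a value prescribed at the corner \<open>Fw q w (q i)\<close>. A corner keeps its value in the
subcell that contains it, and two subcells prescribe the same value at their common corner.\<close>

definition compat :: "(word \<Rightarrow> 3 \<Rightarrow> real) \<Rightarrow> bool" where
  "compat g \<longleftrightarrow> (\<forall>w i. g (w @ [i]) i = g w i) \<and> (\<forall>w i j. g (w @ [i]) j = g (w @ [j]) i)"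

lemma compatD: "compat g \<Longrightarrow> g (w @ [i]) i = g w i" "compat g \<Longrightarrow> g (w @ [i]) j = g (w @ [j]) i"
  unfolding compat_def by blast+

lemma compat_shift: "compat g \<Longrightarrow> compat (\<lambda>w. g (v @ w))"
  unfolding compat_def by (simp only: append_assoc[symmetric]) blast

lemma compat_replicate: "compat g \<Longrightarrow> g (w @ replicate k i) i = g w i"
proof (induction k)
  case (Suc k)
  have "w @ replicate (Suc k) i = (w @ replicate k i) @ [i]" by (simp add: replicate_append_same)
  then show ?case using compatD(1)[OF Suc.prems, of "w @ replicate k i" i] Suc by simp
qed simp

lemma compat_corner: "compat g \<Longrightarrow> Fw q w (q i) = q l \<Longrightarrow> g w i = g [] l"
proof (induction w arbitrary: g)
  case Nil
  then have "q i = q l" by simp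
  then have "i = l" using dist_q[of i l] side_pos by (cases "i = l") auto
  then show ?case by simp
next
  case (Cons j w)
  define y where "y = Fw q w (q i)"
  have y: "y \<in> SG q" unfolding y_def by (intro Fw_SG q_SG)
  have "bary l (F q j y) = 1" using Cons.prems(2) by (simp add: y_def bary_q)
  then have *: "bary l y + (if j = l then 1 else 0) = 2" by (simp add: bary_F)
  have "j = l" using * bary_SG(2)[OF y, of l] by (cases "j = l") auto
  with * have "y = q l" using SG_eq_q[OF y] by simp
  then have "g (j # w) i = g [j] l"
    using Cons.IH[OF compat_shift[OF Cons.prems(1), of "[j]"]] y_def by simp
  then show ?case using compatD(1)[OF Cons.prems(1), of "[]" l] \<open>j = l\<close> by simp
qed

text \<open>The conditions in \<open>compat\<close> concern a single subdivision; iterated, they say that the prescribed value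
depends only on the point.\<close>

lemma compat_vertex:
  "length w = length w' \<Longrightarrow> compat g \<Longrightarrow> Fw q w (q i) = Fw q w' (q i') \<Longrightarrow> g w i = g w' i'"
proof (induction w w' arbitrary: g rule: list_induct2)
  case Nil
  then have "q i = q i'" by simp
  then have "i = i'" using dist_q[of i i'] side_pos by (cases "i = i'") auto
  then show ?case by simp
next
  case (Cons j w j' w')
  note c = compat_shift[OF Cons.prems(1), of "[j]"] compat_shift[OF Cons.prems(1), of "[j']"]
  show ?case
  proof (cases "j = j'")
    case True
    then have "Fw q w (q i) = Fw q w' (q i')" using Cons.prems(2) by (simp add: F_eq_iff)
    then show ?thesis using Cons.IH[OF c(1)] True by simp
  next
    case False
    have eq: "F q j (Fw q w (q i)) = F q j' (Fw q w' (q i'))" using Cons.prems(2) by simp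
    note meet = F_meet[OF Fw_SG[OF q_SG] Fw_SG[OF q_SG] False eq]
    have "g (j # w) i = g [j] j'" "g (j' # w') i' = g [j'] j"
      using compat_corner[OF c(1) meet(1)] compat_corner[OF c(2) meet(2)] by simp_all
    then show ?thesis using compatD(2)[OF Cons.prems(1), of "[]" j j'] by simp
  qed
qed

definition sel :: "nat \<Rightarrow> point \<Rightarrow> word" where
  "sel n x = (SOME w. length w = n \<and> x \<in> cell q w)"

lemma sel: assumes "x \<in> SG q" shows "length (sel n x) = n" "x \<in> cell q (sel n x)"
  using someI_ex[OF SG_cell[OF assms, of n]] unfolding sel_def by blast+

text \<open>The cells \<open>sel n x\<close> shrink to \<open>x\<close>; for vertex values of decaying oscillation any other choice of such
cells gives the same limit.\<close>

definition ext :: "(word \<Rightarrow> 3 \<Rightarrow> real) \<Rightarrow> point \<Rightarrow> real" where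
  "ext g x = lim (\<lambda>n. g (sel n x) 0)"

definition osc :: "(word \<Rightarrow> 3 \<Rightarrow> real) \<Rightarrow> real \<Rightarrow> real \<Rightarrow> bool" where
  "osc g C r \<longleftrightarrow> compat g \<and> 0 < r \<and> r < 1 \<and> (\<forall>w i j k. \<bar>g (w @ [i]) j - g w k\<bar> \<le> C * r ^ length w)"

lemma osc_shift: "osc g C r \<Longrightarrow> osc (\<lambda>w. g (v @ w)) (C * r ^ length v) r"
proof -
  assume g: "osc g C r"
  have "\<bar>g (v @ w @ [i]) j - g (v @ w) k\<bar> \<le> C * r ^ length v * r ^ length w" for w i j k
  proof -
    have "\<bar>g ((v @ w) @ [i]) j - g (v @ w) k\<bar> \<le> C * r ^ length (v @ w)"
      using g unfolding osc_def by blast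
    then show ?thesis by (simp add: power_add mult.assoc)
  qed
  then show ?thesis using g compat_shift[of g v] unfolding osc_def by blast
qed

context
  fixes g :: "word \<Rightarrow> 3 \<Rightarrow> real" and C r :: real
  assumes g: "osc g C r"
begin

lemma osc_compat: "compat g" and osc_rate: "0 < r" "r < 1"
  and osc_step: "\<bar>g (w @ [i]) j - g w k\<bar> \<le> C * r ^ length w"
  using g unfolding osc_def by blast+

lemma osc_nonneg: "0 \<le> C"
  using osc_step[of "[]" 0 0 0] by (simp add: order_trans[OF abs_ge_zero])

lemma osc_cell: "\<bar>g w i - g w k\<bar> \<le> 2 * C * r ^ length w"
  using osc_step[of w 0 0 i] osc_step[of w 0 0 k] by linarith

text \<open>Two cells of the same level that contain \<open>x\<close> have a common corner.\<close>

lemma osc_meet: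
  assumes "x \<in> cell q w" "x \<in> cell q w'" "length w' = length w"
  shows "\<bar>g w k - g w' k'\<bar> \<le> 4 * C * r ^ length w"
proof (cases "w = w'")
  case True
  have "0 \<le> C * r ^ length w" using osc_nonneg osc_rate by simp
  then show ?thesis using True osc_cell[of w k k'] by simp
next
  case False
  obtain i where i: "x = Fw q w (q i)" using cells_meet_vertex[OF assms(3)[symmetric] False assms(1,2)] by blast
  obtain i' where i': "x = Fw q w' (q i')" using cells_meet_vertex[OF assms(3) False[symmetric] assms(2,1)] by blast
  have "g w i = g w' i'" using compat_vertex[OF assms(3)[symmetric] osc_compat] i i' by simp
  then show ?thesis using osc_cell[of w k i] osc_cell[of w' i' k'] assms(3) by simp
qed

lemma sel_step:
  assumes x: "x \<in> SG q"
  shows "\<bar>g (sel (Suc n) x) 0 - g (sel n x) 0\<bar> \<le> 5 * C * r ^ n"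
proof -
  obtain v j where v: "sel (Suc n) x = v @ [j]" "length v = n"
    using sel(1)[OF x, of "Suc n"] by (metis length_append_singleton old.nat.inject rev_exhaust list.size(3) nat.distinct(1))
  have "x \<in> cell q v" using sel(2)[OF x, of "Suc n"] cell_append_subset[of v "[j]"] v by auto
  then have "\<bar>g v 0 - g (sel n x) 0\<bar> \<le> 4 * C * r ^ n"
    using osc_meet[of x v "sel n x" 0 0] sel[OF x, of n] v(2) by simp
  then show ?thesis using osc_step[of v j 0 0] v by simp
qed

lemma ext_bound_sel:
  assumes x: "x \<in> SG q"
  shows "(\<lambda>n. g (sel n x) 0) \<longlonglongrightarrow> ext g x" "\<bar>ext g x - g (sel n x) 0\<bar> \<le> 5 * C / (1 - r) * r ^ n"
proof -
  define a where "a n = g (sel n x) 0" for n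
  define D where "D = 5 * C / (1 - r)"
  have D: "D * (1 - r) = 5 * C" "D \<ge> 0" unfolding D_def using osc_rate osc_nonneg by simp_all
  \<comment> \<open>The steps are bounded by a geometric series, whose partial sums are on the right.\<close>
  have diff: "\<bar>a (n + k) - a n\<bar> \<le> D * (r ^ n - r ^ (n + k))" for n k
  proof (induction k)
    case (Suc k)
    have "\<bar>a (Suc (n + k)) - a (n + k)\<bar> \<le> D * (1 - r) * r ^ (n + k)"
      using sel_step[OF x, of "n + k"] unfolding a_def D(1) .
    then show ?case using Suc by (simp add: algebra_simps)
  qed simp
  have bd: "\<bar>a (n + k) - a n\<bar> \<le> D * r ^ n" for n k
    by (rule order_trans[OF diff]) (use D osc_rate in \<open>simp add: mult_left_mono\<close>)
  have Dr: "(\<lambda>n. D * r ^ n) \<longlonglongrightarrow> 0"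
    using tendsto_mult[OF tendsto_const[of D] LIMSEQ_power_zero[of r]] osc_rate by simp
  have "Cauchy a"
  proof (rule CauchyI')
    fix e :: real assume "e > 0"
    then obtain N where N: "D * r ^ N < e"
      using order_tendstoD(2)[OF Dr] unfolding eventually_sequentially by blast
    show "\<exists>M. \<forall>m\<ge>M. \<forall>n>m. dist (a m) (a n) < e"
    proof (intro exI[of _ N] allI impI)
      fix m n :: nat assume "N \<le> m" "m < n"
      have "dist (a m) (a n) \<le> D * r ^ m"
        using bd[of m "n - m"] \<open>m < n\<close> by (simp add: dist_real_def abs_minus_commute)
      also have "\<dots> \<le> D * r ^ N" using D osc_rate \<open>N \<le> m\<close> by (intro mult_left_mono power_decreasing) auto
      finally show "dist (a m) (a n) < e" using N by simp
    qed
  qed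
  then have lim: "a \<longlonglongrightarrow> ext g x"
    unfolding ext_def a_def[symmetric] using Cauchy_convergent convergent_LIMSEQ_iff by blast
  then show "(\<lambda>n. g (sel n x) 0) \<longlonglongrightarrow> ext g x" unfolding a_def .
  have "(\<lambda>k. \<bar>a (n + k) - a n\<bar>) \<longlonglongrightarrow> \<bar>ext g x - a n\<bar>"
    using LIMSEQ_ignore_initial_segment[OF lim, of n] by (intro tendsto_intros) (simp add: add.commute)
  then have "\<bar>ext g x - a n\<bar> \<le> D * r ^ n"
    by (rule tendsto_upperbound) (use bd in auto)
  then show "\<bar>ext g x - g (sel n x) 0\<bar> \<le> 5 * C / (1 - r) * r ^ n" unfolding a_def D_def .
qed

text \<open>Of the 9, the amount 5 sums the steps along the selected cells, and 4 leads from the selected cell to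
\<open>w\<close>.\<close>

lemma ext_bound:
  assumes x: "x \<in> cell q w"
  shows "\<bar>ext g x - g w k\<bar> \<le> 9 * C / (1 - r) * r ^ length w"
proof -
  have xS: "x \<in> SG q" using x cell_subset_SG by blast
  have 1: "\<bar>g w k - g (sel (length w) x) 0\<bar> \<le> 4 * C * r ^ length w"
    using osc_meet[OF x sel(2)[OF xS]] sel(1)[OF xS] by simp
  have "4 * C \<le> 4 * C / (1 - r)"
    using osc_nonneg osc_rate by (simp add: le_divide_eq mult_left_le)
  then have 2: "4 * C * r ^ length w \<le> 4 * C / (1 - r) * r ^ length w"
    using osc_rate by (intro mult_right_mono) auto
  have 3: "9 * C / (1 - r) * r ^ length w = 5 * C / (1 - r) * r ^ length w + 4 * C / (1 - r) * r ^ length w"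
    by (simp add: algebra_simps add_divide_distrib[symmetric])
  show ?thesis using ext_bound_sel(2)[OF xS, of "length w"] 1 2 unfolding 3 by linarith
qed

lemma ext_eqI:
  assumes "\<And>n. \<exists>w k. n \<le> length w \<and> x \<in> cell q w \<and> \<bar>y - g w k\<bar> \<le> B * r ^ length w"
  shows "ext g x = y"
proof -
  define K where "K = 9 * C / (1 - r) + B"
  have "(\<lambda>n. K * r ^ n) \<longlonglongrightarrow> 0"
    using tendsto_mult[OF tendsto_const[of K] LIMSEQ_power_zero[of r]] osc_rate by simp
  have le: "\<exists>m\<ge>n. \<bar>ext g x - y\<bar> \<le> K * r ^ m" for n
  proof -
    obtain w k where w: "n \<le> length w" "x \<in> cell q w" "\<bar>y - g w k\<bar> \<le> B * r ^ length w" using assms by blast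
    have "\<bar>ext g x - y\<bar> \<le> K * r ^ length w"
      using ext_bound[OF w(2), of k] w(3) unfolding K_def by (simp add: algebra_simps)
    then show ?thesis using w(1) by blast
  qed
  show ?thesis
  proof (rule ccontr)
    assume "ext g x \<noteq> y"
    then have "0 < \<bar>ext g x - y\<bar>" by simp
    from order_tendstoD(2)[OF \<open>(\<lambda>n. K * r ^ n) \<longlonglongrightarrow> 0\<close> this]
    obtain N where "\<And>n. n \<ge> N \<Longrightarrow> K * r ^ n < \<bar>ext g x - y\<bar>" unfolding eventually_sequentially by blast
    then show False using le[of N] by (meson not_le)
  qed
qed

lemma ext_vertex: "ext g (Fw q w (q i)) = g w i"
proof (rule ext_eqI[where B = 0])
  fix n
  have "Fw q w (q i) \<in> cell q (w @ replicate n i)"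
    using vertex_in_cell[of "w @ replicate n i" i] by (simp add: Fw_replicate_fix)
  then show "\<exists>v k. n \<le> length v \<and> Fw q w (q i) \<in> cell q v \<and> \<bar>g w i - g v k\<bar> \<le> 0 * r ^ length v"
    using compat_replicate[OF osc_compat, of w n i]
    by (intro exI[of _ "w @ replicate n i"] exI[of _ i]) simp
qed

end

lemma ext_shift:
  assumes "osc g C r" "y \<in> SG q"
  shows "ext g (Fw q v y) = ext (\<lambda>w. g (v @ w)) y"
proof (rule ext_eqI[OF assms(1), where B = "9 * C / (1 - r)"])
  fix n
  obtain w where w: "length w = n" "y \<in> cell q w" using SG_cell assms(2) by blast
  have "\<bar>ext (\<lambda>w. g (v @ w)) y - g (v @ w) 0\<bar> \<le> 9 * (C * r ^ length v) / (1 - r) * r ^ length w"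
    by (rule ext_bound[OF osc_shift[OF assms(1)] w(2)])
  then have "\<bar>ext (\<lambda>w. g (v @ w)) y - g (v @ w) 0\<bar> \<le> 9 * C / (1 - r) * r ^ length (v @ w)"
    by (simp add: power_add mult.assoc)
  moreover have "Fw q v y \<in> cell q (v @ w)"
    using w(2) unfolding cell_def by (auto simp: Fw_append)
  ultimately show "\<exists>w k. n \<le> length w \<and> Fw q v y \<in> cell q w \<and>
      \<bar>ext (\<lambda>w. g (v @ w)) y - g w k\<bar> \<le> 9 * C / (1 - r) * r ^ length w"
    using w(1) by (intro exI[of _ "v @ w"] exI[of _ 0]) simp
qed

lemma ext_linear:
  assumes "osc g C r" "osc g' C' r'" "x \<in> SG q"
  shows "ext (\<lambda>w i. c * g w i + d * g' w i) x = c * ext g x + d * ext g' x"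
  unfolding ext_def[of "\<lambda>w i. c * g w i + d * g' w i"]
  by (intro limI tendsto_intros ext_bound_sel(1)[OF assms(1,3)] ext_bound_sel(1)[OF assms(2,3)])

text \<open>The cells of level \<open>n\<close> that do not contain \<open>x\<close> form a closed set, so every point near \<open>x\<close> shares a cell of
level \<open>n\<close> with \<open>x\<close>.\<close>

lemma continuous_on_SG_I:
  fixes u :: "point \<Rightarrow> real"
  assumes "\<And>e. e > 0 \<Longrightarrow> \<exists>n. \<forall>w. length w = n \<longrightarrow> (\<forall>x\<in>cell q w. \<forall>y\<in>cell q w. \<bar>u x - u y\<bar> < e)"
  shows "continuous_on (SG q) u"
  unfolding continuous_on_iff
proof (intro ballI allI impI)
  fix x and e :: real assume x: "x \<in> SG q" and "e > 0"
  then obtain n where n: "\<And>w x y. length w = n \<Longrightarrow> x \<in> cell q w \<Longrightarrow> y \<in> cell q w \<Longrightarrow> \<bar>u x - u y\<bar> < e"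
    using assms by blast
  define U where "U = - (\<Union>w\<in>{w. length w = n \<and> x \<notin> cell q w}. cell q w)"
  have "finite {w :: word. length w = n \<and> x \<notin> cell q w}"
    by (rule finite_subset[OF _ finite_words[of n]]) auto
  then have "open U" unfolding U_def open_Compl
    by (intro open_Compl closed_UN ballI compact_imp_closed compact_cell)
  moreover have "x \<in> U" unfolding U_def by blast
  ultimately obtain d where d: "d > 0" "ball x d \<subseteq> U" using open_contains_ball by blast
  show "\<exists>d>0. \<forall>y\<in>SG q. dist y x < d \<longrightarrow> dist (u y) (u x) < e"
  proof (intro exI[of _ d] conjI ballI impI d(1))
    fix y assume y: "y \<in> SG q" "dist y x < d"
    then have "y \<in> U" using d(2) by (auto simp: dist_commute)
    moreover obtain w where w: "length w = n" "y \<in> cell q w" using SG_cell y(1) by blast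
    ultimately have "x \<in> cell q w" unfolding U_def by blast
    then show "dist (u y) (u x) < e" using n[OF w] by (simp add: dist_real_def)
  qed
qed

lemma continuous_on_SG_D:
  fixes v :: "point \<Rightarrow> real"
  assumes "continuous_on (SG q) v" "e > 0"
  shows "\<exists>N. \<forall>n\<ge>N. \<forall>w. length w = n \<longrightarrow> (\<forall>x\<in>cell q w. \<forall>y\<in>cell q w. \<bar>v x - v y\<bar> < e)"
proof -
  obtain d where d: "d > 0" "\<And>x y. x \<in> SG q \<Longrightarrow> y \<in> SG q \<Longrightarrow> dist y x < d \<Longrightarrow> dist (v y) (v x) < e"
    using compact_uniformly_continuous[OF assms(1) SG_props(1)] assms(2)
    unfolding uniformly_continuous_on_def by metis
  obtain N where N: "\<And>n. n \<ge> N \<Longrightarrow> diam / 2 ^ n < d" using cells_small[OF d(1)] by blast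
  show ?thesis
  proof (intro exI[of _ N] allI impI ballI)
    fix n w x y assume n: "N \<le> n" "length w = n" and x: "x \<in> cell q w" and y: "y \<in> cell q w"
    have "x \<in> SG q" "y \<in> SG q" using x y cell_subset_SG by blast+
    moreover have "dist x y < d" using cell_diam[OF x y] N[OF n(1)] n(2) by simp
    ultimately show "\<bar>v x - v y\<bar> < e" using d(2)[of y x] by (simp add: dist_real_def)
  qed
qed

lemma ext_continuous: assumes "osc g C r" shows "continuous_on (SG q) (ext g)"
proof (rule continuous_on_SG_I)
  fix e :: real assume "e > 0"
  have r: "0 < r" "r < 1" using assms unfolding osc_def by blast+
  define K where "K = 9 * C / (1 - r)"
  have "(\<lambda>n. 2 * K * r ^ n) \<longlonglongrightarrow> 0"
    using tendsto_mult[OF tendsto_const[of "2 * K"] LIMSEQ_power_zero[of r]] r by simp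
  from order_tendstoD(2)[OF this \<open>e > 0\<close>] obtain n where n: "2 * K * r ^ n < e"
    unfolding eventually_sequentially by blast
  show "\<exists>n. \<forall>w. length w = n \<longrightarrow> (\<forall>x\<in>cell q w. \<forall>y\<in>cell q w. \<bar>ext g x - ext g y\<bar> < e)"
  proof (intro exI[of _ n] allI impI ballI)
    fix w x y assume w: "length w = n" "x \<in> cell q w" "y \<in> cell q w"
    show "\<bar>ext g x - ext g y\<bar> < e"
      using ext_bound[OF assms w(2), of 0] ext_bound[OF assms w(3), of 0] n
      unfolding K_def[symmetric] w(1) by (simp add: mult.assoc)
  qed
qed

section \<open>Integrals over cells\<close>

definition cint :: "(point \<Rightarrow> real) \<Rightarrow> word \<Rightarrow> real" where
  "cint f w = (LINT x|mu q. indicator (cell q w) x * f x)"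

lemma integrable_cell:
  fixes f :: "point \<Rightarrow> real"
  shows "integrable (mu q) f \<Longrightarrow> integrable (mu q) (\<lambda>x. indicator (cell q w) x * f x)"
  using integrable_mult_indicator[OF cell_measurable, of f w] by simp

lemma cint_mono:
  "integrable (mu q) f \<Longrightarrow> integrable (mu q) g \<Longrightarrow> (\<And>x. x \<in> cell q w \<Longrightarrow> f x \<le> g x) \<Longrightarrow> cint f w \<le> cint g w"
  unfolding cint_def by (intro integral_mono integrable_cell) (auto simp: indicator_def)

lemma cint_abs: "integrable (mu q) f \<Longrightarrow> \<bar>cint f w\<bar> \<le> cint (\<lambda>x. \<bar>f x\<bar>) w"
  unfolding cint_def
  using integral_abs_bound[of "mu q" "\<lambda>x. indicator (cell q w) x * f x"]
  by (simp add: abs_mult)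

lemma cint_const: "cint (\<lambda>_. c) w = c * (1/3) ^ length w"
proof -
  have "cint (\<lambda>_. c) w = c * measure (mu q) (space (mu q) \<inter> cell q w)"
    unfolding cint_def by (simp add: mult.commute)
  then show ?thesis using cell_subset_SG[of w] by (simp add: space_mu measure_cell Int_absorb1)
qed

lemma cint_AE_const:
  assumes "integrable (mu q) f" "AE x in mu q. x \<in> cell q w \<longrightarrow> f x = c"
  shows "cint f w = c * (1/3) ^ length w"
proof -
  have "cint f w = cint (\<lambda>_. c) w" unfolding cint_def
    by (rule integral_cong_AE) (use assms integrable_cell[THEN borel_measurable_integrable] in \<open>auto simp: indicator_def elim!: AE_mp\<close>)
  then show ?thesis by (simp add: cint_const)
qed

lemma cint_sum: "integrable (mu q) f \<Longrightarrow> (LINT x|mu q. f x) = (\<Sum>w | length w = n. cint f w)"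
proof -
  assume f: "integrable (mu q) f"
  have "(LINT x|mu q. f x) = (LINT x|mu q. (\<Sum>w | length w = n. indicator (cell q w) x * f x))"
  proof (rule integral_cong_AE)
    show "AE x in mu q. f x = (\<Sum>w | length w = n. indicator (cell q w) x * f x)"
      using AE_indicator_cells(1)
    proof eventually_elim
      case (elim x)
      have "(\<Sum>w | length w = n. indicator (cell q w) x * f x) = (\<Sum>w | length w = n. indicator (cell q w) x) * f x"
        by (simp add: sum_distrib_right)
      then show ?case using elim by simp
    qed
  qed (intro borel_measurable_sum integrable_cell[THEN borel_measurable_integrable] borel_measurable_integrable[OF f] f)+
  also have "\<dots> = (\<Sum>w | length w = n. cint f w)"
    unfolding cint_def by (rule Bochner_Integration.integral_sum) (intro integrable_cell f)
  finally show ?thesis .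
qed

lemma cint_split: "integrable (mu q) f \<Longrightarrow> cint f w = (\<Sum>j\<in>UNIV. cint f (w @ [j]))"
proof -
  assume f: "integrable (mu q) f"
  have "cint f w = (LINT x|mu q. (\<Sum>j\<in>UNIV. indicator (cell q (w @ [j])) x * f x))"
    unfolding cint_def
  proof (rule integral_cong_AE)
    show "AE x in mu q. indicator (cell q w) x * f x = (\<Sum>j\<in>UNIV. indicator (cell q (w @ [j])) x * f x)"
      using AE_indicator_cells(2)
    proof eventually_elim
      case (elim x)
      have "(\<Sum>j\<in>UNIV. indicator (cell q (w @ [j])) x * f x) = (\<Sum>j\<in>UNIV. indicator (cell q (w @ [j])) x) * f x"
        by (simp only: sum_distrib_right)
      also have "\<dots> = indicator (cell q w) x * f x" by (simp only: elim[rule_format, of w])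
      finally show ?case by (rule sym)
    qed
  qed (intro borel_measurable_sum integrable_cell[THEN borel_measurable_integrable] borel_measurable_integrable[OF f] f)+
  also have "\<dots> = (\<Sum>j\<in>UNIV. cint f (w @ [j]))"
    unfolding cint_def by (rule Bochner_Integration.integral_sum) (intro integrable_cell f)
  finally show ?thesis .
qed

text \<open>The cells shrink to a point, which is a null set.\<close>

lemma cint_shrink:
  assumes f: "integrable (mu q) f"
  shows "(\<lambda>k. cint f (w @ replicate k j)) \<longlonglongrightarrow> 0"
proof -
  have "(\<lambda>k. LINT x|mu q. indicator (cell q (w @ replicate k j)) x * f x) \<longlonglongrightarrow> (LINT x|mu q. 0 :: real)"
  proof (rule integral_dominated_convergence[where w = "\<lambda>x. \<bar>f x\<bar>"])
    show "AE x in mu q. (\<lambda>k. indicator (cell q (w @ replicate k j)) x * f x) \<longlonglongrightarrow> 0"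
      using AE_neq[of "Fw q w (q j)"]
    proof eventually_elim
      case (elim x)
      then have "dist x (Fw q w (q j)) > 0" by simp
      from cells_small[OF this] obtain N where N: "\<And>n. n \<ge> N \<Longrightarrow> diam / 2 ^ n < dist x (Fw q w (q j))" by blast
      have "x \<notin> cell q (w @ replicate k j)" if "k \<ge> N" for k
      proof
        assume x: "x \<in> cell q (w @ replicate k j)"
        have "Fw q w (q j) \<in> cell q (w @ replicate k j)"
          using vertex_in_cell[of "w @ replicate k j" j] by (simp add: Fw_replicate_fix)
        then have "dist x (Fw q w (q j)) \<le> diam / 2 ^ (length w + k)" using cell_diam[OF x] by simp
        then show False using N[of "length w + k"] that by simp
      qed
      then have "\<forall>\<^sub>F k in sequentially. indicator (cell q (w @ replicate k j)) x * f x = 0"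
        unfolding eventually_sequentially by (intro exI[of _ N]) auto
      then show ?case by (rule tendsto_eventually)
    qed
  qed (use f in \<open>auto intro!: integrable_cell[THEN borel_measurable_integrable] AE_I2 simp: indicator_def\<close>)
  then show ?thesis unfolding cint_def by simp
qed

lemma measurable_continuous: "continuous_on (SG q) v \<Longrightarrow> v \<in> borel_measurable (mu q)" for v :: "point \<Rightarrow> real"
  unfolding measurable_cong_sets[OF sets_mu refl] by (rule borel_measurable_continuous_on_restrict)

lemma continuous_bounded:
  fixes v :: "point \<Rightarrow> real"
  assumes "continuous_on (SG q) v"
  obtains B where "B > 0" "\<And>x. x \<in> SG q \<Longrightarrow> \<bar>v x\<bar> \<le> B"
proof -
  have "bounded (v ` SG q)" using compact_continuous_image[OF assms SG_props(1)] compact_imp_bounded by blast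
  then obtain B where "\<forall>x\<in>v ` SG q. norm x \<le> B" "B > 0" using bounded_pos by metis
  then show ?thesis using that[of B] by auto
qed

lemma integrable_mult_continuous:
  fixes v :: "point \<Rightarrow> real"
  assumes "continuous_on (SG q) v" "integrable (mu q) f"
  shows "integrable (mu q) (\<lambda>x. f x * v x)"
proof -
  obtain B where B: "B > 0" "\<And>x. x \<in> SG q \<Longrightarrow> \<bar>v x\<bar> \<le> B" using continuous_bounded[OF assms(1)] by blast
  show ?thesis
  proof (rule Bochner_Integration.integrable_bound)
    show "integrable (mu q) (\<lambda>x. B * f x)" using assms(2) by simp
    show "(\<lambda>x. f x * v x) \<in> borel_measurable (mu q)"
      using measurable_continuous[OF assms(1)] assms(2) by simp
    show "AE x in mu q. norm (f x * v x) \<le> norm (B * f x)"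
    proof (rule AE_I2)
      fix x assume "x \<in> space (mu q)"
      then have "\<bar>f x\<bar> * \<bar>v x\<bar> \<le> \<bar>f x\<bar> * B" using B(2)[of x] by (intro mult_left_mono) (auto simp: space_mu)
      then show "norm (f x * v x) \<le> norm (B * f x)" using B(1) by (simp add: abs_mult mult.commute)
    qed
  qed
qed

section \<open>The weak Laplacian of a family of jets\<close>

text \<open>The normal derivative at a corner, in terms of the corner values \<open>b w\<close> and the load \<open>K w\<close> of the cell.
Both are measured in the scale of the cell; the power of \<open>5/3\<close> converts to the scale of the gasket.\<close>

definition nderiv :: "(word \<Rightarrow> 3 \<Rightarrow> real) \<Rightarrow> (word \<Rightarrow> 3 \<Rightarrow> real) \<Rightarrow> word \<Rightarrow> 3 \<Rightarrow> real" where
  "nderiv b K w i = (5/3) ^ length w * (K w i + lap3 (b w) i)"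

text \<open>The matching conditions: the normal derivative at a corner is seen alike from the cell and from its
subcell at this corner, and the two normal derivatives at a new junction point cancel.\<close>

definition flux :: "(word \<Rightarrow> 3 \<Rightarrow> real) \<Rightarrow> (word \<Rightarrow> 3 \<Rightarrow> real) \<Rightarrow> bool" where
  "flux b K \<longleftrightarrow> (\<forall>w i. nderiv b K (w @ [i]) i = nderiv b K w i) \<and>
     (\<forall>w i j. i \<noteq> j \<longrightarrow> nderiv b K (w @ [i]) j = - nderiv b K (w @ [j]) i)"

lemma flux_replicate: "flux b K \<Longrightarrow> nderiv b K (w @ replicate k i) i = nderiv b K w i"
proof (induction k)
  case (Suc k)
  have "w @ replicate (Suc k) i = (w @ replicate k i) @ [i]" by (simp add: replicate_append_same)
  then show ?case using Suc unfolding flux_def by metis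
qed simp

text \<open>When the cells are subdivided, the terms of the new junction points cancel in pairs and the other
terms stay.\<close>

lemma flux_sum:
  assumes "flux b K"
  shows "(\<Sum>w | length w = n. \<Sum>i\<in>UNIV. v (Fw q w (q i)) * nderiv b K w i) = (\<Sum>i\<in>UNIV. v (q i) * nderiv b K [] i)"
proof (induction n)
  case (Suc n)
  have "(\<Sum>j\<in>UNIV. \<Sum>i\<in>UNIV. v (Fw q (w @ [j]) (q i)) * nderiv b K (w @ [j]) i)
    = (\<Sum>i\<in>UNIV. v (Fw q w (q i)) * nderiv b K w i)" for w
  proof -
    have d: "nderiv b K (w @ [i]) i = nderiv b K w i" for i using assms unfolding flux_def by blast
    have s: "nderiv b K (w @ [1]) 0 = - nderiv b K (w @ [0]) 1"
      "nderiv b K (w @ [2]) 0 = - nderiv b K (w @ [0]) 2"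
      "nderiv b K (w @ [2]) 1 = - nderiv b K (w @ [1]) 2"
      using assms neq3 unfolding flux_def by metis+
    show ?thesis
      unfolding sum3 Fw_swap[of q w 1 0] Fw_swap[of q w 2 0] Fw_swap[of q w 2 1] Fw_fix s d by simp
  qed
  then show ?case unfolding sum_words_Suc using Suc by simp
qed simp

text \<open>The Gauss-Green formula. On each level the energy is the boundary term, which \<open>flux_sum\<close> shows to be
constant, minus the sum of \<open>v\<close> against the loads. By \<open>mass\<close> and \<open>dom\<close> the latter differs from the integral
of \<open>f v\<close> by at most the oscillation of \<open>v\<close> on cells of that level, times a multiple of the integral of \<open>|f|\<close>.\<close>

lemma energy_level_tendsto:
  assumes flux: "flux b K" and f: "integrable (mu q) f"
    and mass: "\<And>w. cint f w = (5/3) ^ length w * (\<Sum>i\<in>UNIV. K w i)"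
    and dom: "\<And>w i. (5/3) ^ length w * \<bar>K w i\<bar> \<le> cint (\<lambda>x. \<bar>f x\<bar>) w"
    and u: "\<And>w i. u (Fw q w (q i)) = b w i"
    and v: "continuous_on (SG q) v"
  shows "(\<lambda>n. energy_level q n u v) \<longlonglongrightarrow> (\<Sum>i\<in>UNIV. v (q i) * nderiv b K [] i) - (LINT x|mu q. f x * v x)"
proof -
  define k where "k w i = (5/3) ^ length w * K w i" for w i
  define R where "R n = (\<Sum>w | length w = n. \<Sum>i\<in>UNIV. v (Fw q w (q i)) * k w i)" for n
  define I where "I = (LINT x|mu q. \<bar>f x\<bar>)"
  have fv: "integrable (mu q) (\<lambda>x. f x * v x)" by (rule integrable_mult_continuous[OF v f])
  have af: "integrable (mu q) (\<lambda>x. \<bar>f x\<bar>)" using f by simp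
  have I0: "0 \<le> I" unfolding I_def by simp
  have eq: "energy_level q n u v = (\<Sum>i\<in>UNIV. v (q i) * nderiv b K [] i) - R n" for n
  proof -
    have "energy_level q n u v = (\<Sum>w | length w = n. \<Sum>i\<in>UNIV. v (Fw q w (q i)) * nderiv b K w i - v (Fw q w (q i)) * k w i)"
      unfolding energy_level_eq u sum_distrib_left
      by (intro sum.cong) (auto simp: nderiv_def k_def algebra_simps)
    then show ?thesis unfolding sum_subtractf flux_sum[OF flux] R_def .
  qed
  have est: "\<bar>R n - (LINT x|mu q. f x * v x)\<bar> \<le> 4 * e * I"
    if e: "\<And>w x y. length w = n \<Longrightarrow> x \<in> cell q w \<Longrightarrow> y \<in> cell q w \<Longrightarrow> \<bar>v x - v y\<bar> < e" for n e
  proof -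
    have w: "\<bar>(\<Sum>i\<in>UNIV. v (Fw q w (q i)) * k w i) - cint (\<lambda>x. f x * v x) w\<bar> \<le> 4 * e * cint (\<lambda>x. \<bar>f x\<bar>) w"
      if w: "length w = n" for w
    proof -
      define p where "p = Fw q w (q 0)"
      have e0: "e > 0" using e[OF w vertex_in_cell[of w 0] vertex_in_cell[of w 0]] by simp
      have p: "p \<in> cell q w" unfolding p_def by (rule vertex_in_cell)
      have "(\<Sum>i\<in>UNIV. v (Fw q w (q i)) * k w i) - v p * cint f w = (\<Sum>i\<in>UNIV. (v (Fw q w (q i)) - v p) * k w i)"
        unfolding mass k_def sum_distrib_left by (simp add: sum_subtractf algebra_simps)
      also have "\<bar>\<dots>\<bar> \<le> (\<Sum>i\<in>(UNIV :: 3 set). e * cint (\<lambda>x. \<bar>f x\<bar>) w)"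
      proof (rule sum_abs[THEN order_trans], rule sum_mono)
        fix i
        have "\<bar>v (Fw q w (q i)) - v p\<bar> * \<bar>k w i\<bar> \<le> e * cint (\<lambda>x. \<bar>f x\<bar>) w"
          using e[OF w vertex_in_cell[of w i] p] dom[of w i] e0
          by (intro mult_mono) (auto simp: k_def abs_mult)
        then show "\<bar>(v (Fw q w (q i)) - v p) * k w i\<bar> \<le> e * cint (\<lambda>x. \<bar>f x\<bar>) w" by (simp add: abs_mult)
      qed
      also have "\<dots> = 3 * (e * cint (\<lambda>x. \<bar>f x\<bar>) w)" by simp
      finally have 1: "\<bar>(\<Sum>i\<in>UNIV. v (Fw q w (q i)) * k w i) - v p * cint f w\<bar> \<le> 3 * (e * cint (\<lambda>x. \<bar>f x\<bar>) w)" .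
      have "v p * cint f w - cint (\<lambda>x. f x * v x) w = cint (\<lambda>x. f x * v p - f x * v x) w"
        unfolding cint_def using integrable_cell[OF f, of w] integrable_cell[OF fv, of w]
        by (simp add: right_diff_distrib mult.assoc[symmetric])
      also have "\<bar>\<dots>\<bar> \<le> cint (\<lambda>x. \<bar>f x * v p - f x * v x\<bar>) w"
        by (rule cint_abs) (use f fv in simp)
      also have "\<dots> \<le> cint (\<lambda>x. e * \<bar>f x\<bar>) w"
      proof (rule cint_mono)
        show "integrable (mu q) (\<lambda>x. \<bar>f x * v p - f x * v x\<bar>)" using f fv by simp
        show "integrable (mu q) (\<lambda>x. e * \<bar>f x\<bar>)" using af by simp
        fix x assume x: "x \<in> cell q w"
        have "\<bar>f x * v p - f x * v x\<bar> = \<bar>v p - v x\<bar> * \<bar>f x\<bar>"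
          by (simp add: abs_mult[symmetric] algebra_simps)
        also have "\<dots> \<le> e * \<bar>f x\<bar>" using e[OF w p x] by (intro mult_right_mono) auto
        finally show "\<bar>f x * v p - f x * v x\<bar> \<le> e * \<bar>f x\<bar>" .
      qed
      also have "\<dots> = e * cint (\<lambda>x. \<bar>f x\<bar>) w"
        unfolding cint_def by (simp add: mult.left_commute)
      finally show ?thesis using 1 by (simp add: abs_if split: if_splits)
    qed
    have "R n - (LINT x|mu q. f x * v x) = (\<Sum>w | length w = n. (\<Sum>i\<in>UNIV. v (Fw q w (q i)) * k w i) - cint (\<lambda>x. f x * v x) w)"
      unfolding R_def cint_sum[OF fv, of n] sum_subtractf ..
    also have "\<bar>\<dots>\<bar> \<le> (\<Sum>w | length w = n. 4 * e * cint (\<lambda>x. \<bar>f x\<bar>) w)"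
      by (rule sum_abs[THEN order_trans], rule sum_mono) (use w in simp)
    also have "\<dots> = 4 * e * I" unfolding I_def cint_sum[OF af, of n] by (simp add: sum_distrib_left)
    finally show ?thesis .
  qed
  have "R \<longlonglongrightarrow> (LINT x|mu q. f x * v x)"
  proof (rule LIMSEQ_I)
    fix d :: real assume d: "d > 0"
    \<comment> \<open>The integral I of the absolute value may vanish, hence I + 1.\<close>
    define e where "e = (d / 4) / (I + 1)"
    have "e * (I + 1) = d / 4"
      unfolding e_def by (rule nonzero_eq_divide_eq[THEN iffD1, OF _ refl]) (use I0 in simp)
    then have "e * I + e = d / 4" by (simp only: distrib_left mult_1_right)
    moreover have e: "e > 0" unfolding e_def using d I0 by (intro divide_pos_pos) auto
    ultimately have "4 * (e * I) < d" by linarith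
    with e have e: "e > 0" "4 * e * I < d" by (simp_all only: mult.assoc)
    from continuous_on_SG_D[OF v e(1)]
    obtain N where N: "\<forall>n\<ge>N. \<forall>w. length w = n \<longrightarrow> (\<forall>x\<in>cell q w. \<forall>y\<in>cell q w. \<bar>v x - v y\<bar> < e)" by (rule exE)
    show "\<exists>no. \<forall>n\<ge>no. norm (R n - (LINT x|mu q. f x * v x)) < d"
    proof (intro exI[of _ N] allI impI)
      fix n assume "n \<ge> N"
      have "\<bar>R n - (LINT x|mu q. f x * v x)\<bar> \<le> 4 * e * I" by (rule est) (rule N[rule_format, OF \<open>n \<ge> N\<close>])
      then show "norm (R n - (LINT x|mu q. f x * v x)) < d" using e(2) by simp
    qed
  qed
  then show ?thesis unfolding eq by (intro tendsto_intros)
qed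

text \<open>On the cells that shrink to the corner, the difference quotient is the normal derivative minus the
load, and the loads tend to zero.\<close>

lemma normal_deriv:
  assumes flux: "flux b K" and f: "integrable (mu q) f"
    and dom: "\<And>w i. (5/3) ^ length w * \<bar>K w i\<bar> \<le> cint (\<lambda>x. \<bar>f x\<bar>) w"
    and u: "\<And>w i. u (Fw q w (q i)) = b w i"
  shows "has_normal_deriv q u w j (nderiv b K w j)"
proof -
  have "(\<lambda>k. (5/3) ^ length (w @ replicate k j) * K (w @ replicate k j) j) \<longlonglongrightarrow> 0"
  proof (rule Lim_null_comparison)
    show "\<forall>\<^sub>F k in sequentially. norm ((5/3) ^ length (w @ replicate k j) * K (w @ replicate k j) j) \<le> cint (\<lambda>x. \<bar>f x\<bar>) (w @ replicate k j)"
      using dom[of "w @ replicate _ j" j] by (intro always_eventually allI) (simp add: abs_mult)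
    show "(\<lambda>k. cint (\<lambda>x. \<bar>f x\<bar>) (w @ replicate k j)) \<longlonglongrightarrow> 0" by (rule cint_shrink) (use f in simp)
  qed
  then have "(\<lambda>k. nderiv b K w j - (5/3) ^ length (w @ replicate k j) * K (w @ replicate k j) j) \<longlonglongrightarrow> nderiv b K w j - 0"
    by (intro tendsto_intros)
  moreover have "nderiv b K w j - (5/3) ^ length (w @ replicate k j) * K (w @ replicate k j) j =
    (5/3) ^ (length w + k) * (2 * u (Fw q w (q j)) - u (Fw q (w @ replicate k j) (q (j + 1))) - u (Fw q (w @ replicate k j) (q (j - 1))))" for k
  proof -
    have "b (w @ replicate k j) j = u (Fw q w (q j))"
      using u[of "w @ replicate k j" j] by (simp add: Fw_replicate_fix)
    then have "(5/3) ^ length (w @ replicate k j) * lap3 (b (w @ replicate k j)) j =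
      (5/3) ^ (length w + k) * (2 * u (Fw q w (q j)) - u (Fw q (w @ replicate k j) (q (j + 1))) - u (Fw q (w @ replicate k j) (q (j - 1))))"
      unfolding lap3_def u by simp
    moreover have "nderiv b K (w @ replicate k j) j = (5/3) ^ length (w @ replicate k j) * K (w @ replicate k j) j
        + (5/3) ^ length (w @ replicate k j) * lap3 (b (w @ replicate k j)) j"
      unfolding nderiv_def by (rule distrib_left)
    moreover note flux_replicate[OF flux, of w k j]
    ultimately show ?thesis by simp
  qed
  ultimately show ?thesis unfolding has_normal_deriv_def by simp
qed

end

section \<open>Subdivision of jets\<close>

text \<open>The corner values and the loads of a cell.\<close>

type_synonym jet = "(3 \<Rightarrow> real) \<times> (3 \<Rightarrow> real)"

text \<open>Let the Laplacian be constant on each subcell of a cell with loads \<open>K\<close>, so that the three loads of the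
\<open>i\<close>-th subcell are equal, say to \<open>t i\<close>. Matching normal derivatives at the old corners amounts to
\<open>K i = 2 t i + (t 0 + t 1 + t 2)\<close>, which \<open>child_load\<close> solves for \<open>t\<close>. Cancellation at the midpoints then
determines the values there, which are those of \<open>child_value\<close>. For \<open>K = 0\<close> this is harmonic extension.\<close>

definition child_load :: "(3 \<Rightarrow> real) \<Rightarrow> 3 \<Rightarrow> real" where
  "child_load K i = (5 * K i - (\<Sum>j\<in>UNIV. K j)) / 10"

definition child_value :: "(3 \<Rightarrow> real) \<Rightarrow> (3 \<Rightarrow> real) \<Rightarrow> 3 \<Rightarrow> 3 \<Rightarrow> real" where
  "child_value b K i j = (if i = j then b i else
     ((\<Sum>l\<in>UNIV. b l - child_load K l) + (b i - child_load K i) + (b j - child_load K j)) / 5)"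

definition child :: "jet \<Rightarrow> 3 \<Rightarrow> jet" where
  "child s i = (child_value (fst s) (snd s) i, \<lambda>_. child_load (snd s) i)"

text \<open>The conditions of \<open>compat\<close> and \<open>flux\<close> for one subdivision; \<open>5/3\<close> is the ratio between the scales of
consecutive levels.\<close>

definition subdivides :: "jet \<Rightarrow> (3 \<Rightarrow> jet) \<Rightarrow> bool" where
  "subdivides s c \<longleftrightarrow> (\<forall>i. fst (c i) i = fst s i) \<and> (\<forall>i j. fst (c i) j = fst (c j) i) \<and>
     (\<forall>i. 5/3 * (snd (c i) i + lap3 (fst (c i)) i) = snd s i + lap3 (fst s) i) \<and>
     (\<forall>i j. i \<noteq> j \<longrightarrow> snd (c i) j + lap3 (fst (c i)) j = - (snd (c j) i + lap3 (fst (c j)) i))"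

lemma subdividesD:
  "subdivides s c \<Longrightarrow> fst (c i) i = fst s i"
  "subdivides s c \<Longrightarrow> fst (c i) j = fst (c j) i"
  "subdivides s c \<Longrightarrow> 5/3 * (snd (c i) i + lap3 (fst (c i)) i) = snd s i + lap3 (fst s) i"
  "subdivides s c \<Longrightarrow> i \<noteq> j \<Longrightarrow> snd (c i) j + lap3 (fst (c i)) j = - (snd (c j) i + lap3 (fst (c j)) i)"
  unfolding subdivides_def by (elim conjE allE, assumption)+ blast

lemma child_value_simps:
  "child_value b K i i = b i" "child_value b K i j = child_value b K j i"
  unfolding child_value_def by auto

lemma subdivides_child: "subdivides s (child s)"
proof -
  obtain b K where s: "s = (b, K)" by (cases s)
  show ?thesis
    unfolding subdivides_def child_def s fst_conv snd_conv
  proof (intro conjI allI impI)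
    show "child_value b K i i = b i" for i by (rule child_value_simps)
    show "child_value b K i j = child_value b K j i" for i j by (rule child_value_simps)
    have "\<forall>i. 5/3 * (child_load K i + lap3 (child_value b K i) i) = K i + lap3 b i"
      unfolding all3 lap3_def cyc3 child_value_def child_load_def sum3 by (simp add: neq3 field_simps)
    then show "5/3 * (child_load K i + lap3 (child_value b K i) i) = K i + lap3 b i" for i by blast
    have "\<forall>i j. i \<noteq> j \<longrightarrow> child_load K i + lap3 (child_value b K i) j = - (child_load K j + lap3 (child_value b K j) i)"
      unfolding all3 lap3_def cyc3 child_value_def child_load_def sum3 by (simp add: neq3 field_simps)
    then show "i \<noteq> j \<Longrightarrow> child_load K i + lap3 (child_value b K i) j = - (child_load K j + lap3 (child_value b K j) i)" for i j by blast
  qed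
qed

text \<open>Under subdivision the spread \<open>D\<close> of the values becomes at most \<open>3/5 D + 4/5 \<kappa>\<close> and the size \<open>\<kappa>\<close> of the
loads at most \<open>4/5 \<kappa>\<close>. With the weight 8 the combination \<open>D + 8 \<kappa>\<close> decreases by the factor \<open>9/10\<close>.\<close>

definition small :: "jet \<Rightarrow> real \<Rightarrow> bool" where
  "small s B \<longleftrightarrow> (\<exists>D \<kappa>. (\<forall>i j. \<bar>fst s i - fst s j\<bar> \<le> D) \<and> (\<forall>i. \<bar>snd s i\<bar> \<le> \<kappa>) \<and> D + 8 * \<kappa> \<le> B)"

lemma child_load_bound: "(\<And>i. \<bar>K i\<bar> \<le> \<kappa>) \<Longrightarrow> \<bar>child_load K i\<bar> \<le> 4/5 * \<kappa>"
proof -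
  assume "\<And>i. \<bar>K i\<bar> \<le> \<kappa>"
  then have "\<bar>K 0\<bar> \<le> \<kappa>" "\<bar>K 1\<bar> \<le> \<kappa>" "\<bar>K 2\<bar> \<le> \<kappa>" by blast+
  then have "\<forall>i. \<bar>child_load K i\<bar> \<le> 4/5 * \<kappa>"
    unfolding all3 child_load_def sum3 by (auto simp: abs_le_iff)
  then show ?thesis by blast
qed

lemma small_child:
  assumes "small s B"
  shows "small (child s i) (9/10 * B)" "\<bar>fst (child s i) j - fst s k\<bar> \<le> B"
proof -
  obtain b K where s: "s = (b, K)" by (cases s)
  obtain D \<kappa> where D: "\<And>i j. \<bar>b i - b j\<bar> \<le> D" and \<kappa>: "\<And>i. \<bar>K i\<bar> \<le> \<kappa>" and B: "D + 8 * \<kappa> \<le> B"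
    using assms unfolding small_def s by auto
  define T where "T = child_load K"
  define \<tau> where "\<tau> = 4/5 * \<kappa>"
  have T: "\<bar>T i\<bar> \<le> \<tau>" for i unfolding T_def \<tau>_def by (rule child_load_bound[OF \<kappa>])
  have p: "0 \<le> \<tau>" "0 \<le> D" using T[of 0] D[of 0 0] by simp_all
  have Tb: "- \<tau> \<le> T i" "T i \<le> \<tau>" for i using T[of i] by (simp_all add: abs_le_iff)
  have Db: "b i - b j \<le> D" for i j using D[of i j] by (simp add: abs_le_iff)
  have mid: "child_value b K i j = 2/5 * b i + 2/5 * b j + 1/5 * b k - 2/5 * T i - 2/5 * T j - 1/5 * T k"
    if "k \<noteq> i" "k \<noteq> j" "i \<noteq> j" "UNIV = {i, j, k}" for i j k
    unfolding child_value_def T_def[symmetric] that(4) using that(1-3) by (simp add: field_simps)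
  have d1: "\<bar>child_value b K i j - b i\<bar> \<le> 3/5 * D + \<tau>" for i j
  proof (cases "i = j")
    case False
    then obtain k where k: "k \<noteq> i" "k \<noteq> j" "UNIV = {i, j, k}" using third3 by blast
    show ?thesis unfolding mid[OF k(1,2) False k(3)]
      using Tb[of i] Tb[of j] Tb[of k] Db[of i j] Db[of j i] Db[of i k] Db[of k i] by linarith
  qed (use p in \<open>simp add: child_value_def\<close>)
  have d: "\<bar>child_value b K i j - child_value b K i k\<bar> \<le> 3/5 * D + \<tau>" for i j k
  proof (cases "i = j \<or> i = k \<or> j = k")
    case True
    then show ?thesis using d1[of i j] d1[of i k] p by (auto simp: child_value_simps(1) abs_minus_commute)
  next
    case False
    then have n: "k \<noteq> i" "k \<noteq> j" "i \<noteq> j" "j \<noteq> k" "j \<noteq> i" "i \<noteq> k" by auto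
    obtain l where l: "l \<noteq> i" "l \<noteq> j" "UNIV = {i, j, l}" using third3[OF n(3)] by blast
    have "l = k" using l(3) n by (metis UNIV_I insertE singletonD)
    then have "UNIV = {i, j, k}" "UNIV = {i, k, j}" using l by auto
    then show ?thesis unfolding mid[OF n(1,2,3) \<open>UNIV = {i, j, k}\<close>] mid[OF n(5,4) n(6) \<open>UNIV = {i, k, j}\<close>]
      using Tb[of j] Tb[of k] Db[of j k] Db[of k j] p by linarith
  qed
  have d2: "\<bar>child_value b K i j - b k\<bar> \<le> D + \<tau>" for i j k
  proof (cases "i = j")
    case True
    then show ?thesis using D[of i k] p by (simp add: child_value_def)
  next
    case False
    then obtain l where l: "l \<noteq> i" "l \<noteq> j" "UNIV = {i, j, l}" using third3 by blast
    show ?thesis unfolding mid[OF l(1,2) False l(3)]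
      using Tb[of i] Tb[of j] Tb[of l] Db[of i k] Db[of k i] Db[of j k] Db[of k j] Db[of l k] Db[of k l] by linarith
  qed
  show "small (child s i) (9/10 * B)"
    unfolding small_def child_def s fst_conv snd_conv
    by (rule exI[of _ "3/5 * D + \<tau>"], rule exI[of _ \<tau>])
       (use d T p B in \<open>simp add: T_def[symmetric] \<tau>_def\<close>)
  show "\<bar>fst (child s i) j - fst s k\<bar> \<le> B"
    unfolding child_def s fst_conv snd_conv
    by (rule order_trans[OF d2]) (use p B in \<open>simp add: \<tau>_def\<close>)
qed

definition descend :: "jet \<Rightarrow> word \<Rightarrow> jet" where "descend = foldl child"

lemma descend_simps: "descend s [] = s" "descend s (j # w) = descend (child s j) w" "descend s (w @ [j]) = child (descend s w) j"
  by (simp_all add: descend_def)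

lemma small_descend:
  assumes "small s B" shows "small (descend s w) (B * (9/10) ^ length w)"
proof (induction w rule: rev_induct)
  case (snoc j w)
  show ?case using small_child(1)[OF snoc, of j] by (simp add: descend_simps mult_ac)
qed (use assms in \<open>simp add: descend_simps\<close>)

lemma descend_osc:
  assumes "small s B"
  shows "\<bar>fst (descend s (w @ [i])) j - fst (descend s w) k\<bar> \<le> B * (9/10) ^ length w"
  unfolding descend_simps(3) by (rule small_child(2)[OF small_descend[OF assms]])

lemma descend_flat: "snd (descend (b, \<lambda>_. 0) w) = (\<lambda>_. 0)"
  by (induction w rule: rev_induct) (auto simp: descend_simps child_def child_load_def)

text \<open>Harmonic extension multiplies the energy of the triangle graph by \<open>3/5\<close>, so the renormalised energy
does not change.\<close>

lemma harmonic_energy: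
  "5/3 * (\<Sum>j\<in>UNIV. \<Sum>i\<in>UNIV. child_value b (\<lambda>_. 0) j i * lap3 (child_value b (\<lambda>_. 0) j) i) = (\<Sum>i\<in>UNIV. b i * lap3 b i)"
  unfolding sum3 lap3_def cyc3 child_value_def child_load_def by (simp add: neq3 field_simps)

context gasket begin

section \<open>Harmonic splines\<close>

text \<open>The values of \<open>\<phi>\<close> down to level \<open>n\<close>, and harmonic extension below.\<close>

definition spline_jet :: "nat \<Rightarrow> (point \<Rightarrow> real) \<Rightarrow> word \<Rightarrow> jet" where
  "spline_jet n \<phi> w = descend (\<lambda>i. \<phi> (Fw q (take n w) (q i)), \<lambda>_. 0) (drop n w)"

abbreviation spline_val :: "nat \<Rightarrow> (point \<Rightarrow> real) \<Rightarrow> word \<Rightarrow> 3 \<Rightarrow> real" where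
  "spline_val n \<phi> w \<equiv> fst (spline_jet n \<phi> w)"

definition spline :: "nat \<Rightarrow> (point \<Rightarrow> real) \<Rightarrow> point \<Rightarrow> real" where
  "spline n \<phi> = ext (spline_val n \<phi>)"

lemma spline_coarse: "length w \<le> n \<Longrightarrow> spline_val n \<phi> w i = \<phi> (Fw q w (q i))"
  by (simp add: spline_jet_def descend_simps)

lemma spline_fine: "n \<le> length w \<Longrightarrow> spline_jet n \<phi> (w @ [j]) = child (spline_jet n \<phi> w) j"
  by (simp add: spline_jet_def descend_simps)

lemma spline_append: "length w = n \<Longrightarrow> spline_jet n \<phi> (w @ v) = descend (\<lambda>i. \<phi> (Fw q w (q i)), \<lambda>_. 0) v"
  by (simp add: spline_jet_def)

lemma spline_compat: "compat (spline_val n \<phi>)"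
  unfolding compat_def
proof (intro conjI allI)
  fix w i j
  show "spline_val n \<phi> (w @ [i]) i = spline_val n \<phi> w i"
  proof (cases "n \<le> length w")
    case True
    then show ?thesis by (simp add: spline_fine child_def child_value_simps)
  next
    case False
    then show ?thesis by (simp add: spline_coarse Fw_fix)
  qed
  show "spline_val n \<phi> (w @ [i]) j = spline_val n \<phi> (w @ [j]) i"
  proof (cases "n \<le> length w")
    case True
    then show ?thesis using child_value_simps(2) by (simp add: spline_fine child_def)
  next
    case False
    then show ?thesis using Fw_swap[of q w i j] by (simp add: spline_coarse)
  qed
qed

lemma spline_osc:
  assumes \<Phi>: "\<And>x. x \<in> SG q \<Longrightarrow> \<bar>\<phi> x\<bar> \<le> \<Phi>" "0 \<le> \<Phi>"
  shows "osc (spline_val n \<phi>) (2 * \<Phi> * (10/9) ^ n) (9/10)"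
  unfolding osc_def
proof (intro conjI allI spline_compat)
  fix w i j k
  have b: "\<bar>\<phi> x - \<phi> y\<bar> \<le> 2 * \<Phi>" if "x \<in> SG q" "y \<in> SG q" for x y
    using \<Phi>(1)[OF that(1)] \<Phi>(1)[OF that(2)] by linarith
  show "\<bar>spline_val n \<phi> (w @ [i]) j - spline_val n \<phi> w k\<bar> \<le> 2 * \<Phi> * (10/9) ^ n * (9/10) ^ length w"
  proof (cases "n \<le> length w")
    case True
    define v u where "v = take n w" and "u = drop n w"
    have w: "w = v @ u" "length v = n" using True by (simp_all add: v_def u_def)
    have "small (\<lambda>i. \<phi> (Fw q v (q i)), \<lambda>_. 0) (2 * \<Phi>)"
      unfolding small_def by (rule exI[of _ "2 * \<Phi>"], rule exI[of _ 0]) (use b Fw_SG q_SG in simp)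
    from descend_osc[OF this, of u i j k]
    have "\<bar>spline_val n \<phi> (w @ [i]) j - spline_val n \<phi> w k\<bar> \<le> 2 * \<Phi> * (9/10) ^ length u"
      unfolding w(1) append_assoc spline_append[OF w(2)] .
    also have "(9/10 :: real) ^ length u = (10/9) ^ n * (9/10) ^ length w"
      unfolding w(1) length_append w(2) power_add by (simp add: power_mult_distrib[symmetric] mult.assoc[symmetric])
    finally show ?thesis by (simp add: mult.assoc)
  next
    case False
    have "\<bar>spline_val n \<phi> (w @ [i]) j - spline_val n \<phi> w k\<bar> \<le> 2 * \<Phi>"
      using False b[OF Fw_SG[OF q_SG] Fw_SG[OF q_SG]] by (simp add: spline_coarse)
    also have "1 \<le> (10/9 :: real) ^ (n - length w)" by (rule one_le_power) simp
    then have "2 * \<Phi> \<le> 2 * \<Phi> * (10/9) ^ (n - length w)" using \<Phi>(2) by (simp add: mult_left_mono[where a = 1 and c = "2 * \<Phi>", simplified])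
    also have "(10/9 :: real) ^ (n - length w) = (10/9) ^ (n - length w) * ((10/9) ^ length w * (9/10) ^ length w)"
      by (simp add: power_mult_distrib[symmetric])
    also have "\<dots> = (10/9) ^ n * (9/10) ^ length w"
      unfolding mult.assoc[symmetric] power_add[symmetric] using False by simp
    finally show ?thesis by (simp add: mult.assoc)
  qed
qed simp_all

lemma spline_dom_energy:
  assumes \<phi>: "continuous_on (SG q) \<phi>"
  shows "spline n \<phi> \<in> dom_energy q"
proof -
  obtain \<Phi> where \<Phi>: "\<Phi> > 0" "\<And>x. x \<in> SG q \<Longrightarrow> \<bar>\<phi> x\<bar> \<le> \<Phi>" using continuous_bounded[OF \<phi>] by blast
  have osc: "osc (spline_val n \<phi>) (2 * \<Phi> * (10/9) ^ n) (9/10)" by (rule spline_osc) (use \<Phi> in auto)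
  define E where "E m = energy_level q m (spline n \<phi>) (spline n \<phi>)" for m
  have E: "E m = (5/3) ^ m * (\<Sum>w | length w = m. \<Sum>i\<in>UNIV. spline_val n \<phi> w i * lap3 (spline_val n \<phi> w) i)" for m
    unfolding E_def energy_level_eq spline_def ext_vertex[OF osc] ..
  have "E (Suc m) = E m" if m: "n \<le> m" for m
  proof -
    have "5/3 * (\<Sum>j\<in>UNIV. \<Sum>i\<in>UNIV. spline_val n \<phi> (w @ [j]) i * lap3 (spline_val n \<phi> (w @ [j])) i)
      = (\<Sum>i\<in>UNIV. spline_val n \<phi> w i * lap3 (spline_val n \<phi> w) i)" if w: "length w = m" for w
    proof -
      have K: "snd (spline_jet n \<phi> w) = (\<lambda>_. 0)" unfolding spline_jet_def by (rule descend_flat)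
      have "spline_val n \<phi> (w @ [j]) = child_value (spline_val n \<phi> w) (\<lambda>_. 0) j" for j
        using m w by (simp add: spline_fine child_def K)
      then show ?thesis by (simp only: harmonic_energy)
    qed
    then have "5/3 * (\<Sum>w | length w = m. \<Sum>j\<in>UNIV. \<Sum>i\<in>UNIV. spline_val n \<phi> (w @ [j]) i * lap3 (spline_val n \<phi> (w @ [j])) i)
      = (\<Sum>w | length w = m. \<Sum>i\<in>UNIV. spline_val n \<phi> w i * lap3 (spline_val n \<phi> w) i)" (is "5/3 * ?S = ?T")
      unfolding sum_distrib_left[where A = "{w. length w = m}"] by (intro sum.cong refl) simp
    then have "(5/3) ^ m * (5/3 * ?S) = (5/3) ^ m * ?T" by (rule arg_cong)
    then show ?thesis unfolding E sum_words_Suc power_Suc by (simp only: mult_ac)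
  qed
  then have "E (n + k) = E n" for k by (induction k) auto
  then have "E (k + n) = E n" for k by (simp add: add.commute)
  then have "(\<lambda>k. E (k + n)) \<longlonglongrightarrow> E n" by simp
  then have "E \<longlonglongrightarrow> E n" by (rule LIMSEQ_offset)
  then have "convergent E" by (rule convergentI)
  moreover have "continuous_on (SG q) (spline n \<phi>)" unfolding spline_def by (rule ext_continuous[OF osc])
  ultimately show ?thesis unfolding dom_energy_def E_def by simp
qed

lemma spline_close:
  assumes \<phi>: "continuous_on (SG q) \<phi>"
    and e: "\<And>w x y. length w = n \<Longrightarrow> x \<in> cell q w \<Longrightarrow> y \<in> cell q w \<Longrightarrow> \<bar>\<phi> x - \<phi> y\<bar> < e"
    and x: "x \<in> SG q"
  shows "\<bar>spline n \<phi> x - \<phi> x\<bar> \<le> 91 * e"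
proof -
  obtain \<Phi> where \<Phi>: "\<Phi> > 0" "\<And>x. x \<in> SG q \<Longrightarrow> \<bar>\<phi> x\<bar> \<le> \<Phi>" using continuous_bounded[OF \<phi>] by blast
  have osc: "osc (spline_val n \<phi>) (2 * \<Phi> * (10/9) ^ n) (9/10)" by (rule spline_osc) (use \<Phi> in auto)
  obtain w where w: "length w = n" "x \<in> cell q w" using SG_cell[OF x] by blast
  then obtain y where y: "y \<in> SG q" "x = Fw q w y" unfolding cell_def by blast
  have S: "spline n \<phi> x = ext (\<lambda>v. spline_val n \<phi> (w @ v)) y"
    unfolding spline_def y(2) by (rule ext_shift[OF osc y(1)])
  have "small (\<lambda>i. \<phi> (Fw q w (q i)), \<lambda>_. 0) e"
    unfolding small_def
    by (rule exI[of _ e], rule exI[of _ 0]) (use e[OF w(1) vertex_in_cell vertex_in_cell] in \<open>auto intro: less_imp_le\<close>)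
  from descend_osc[OF this]
  have "\<bar>spline_val n \<phi> (w @ v @ [i]) j - spline_val n \<phi> (w @ v) k\<bar> \<le> e * (9/10) ^ length v" for v i j k
    unfolding spline_append[OF w(1)] .
  then have "osc (\<lambda>v. spline_val n \<phi> (w @ v)) e (9/10)"
    unfolding osc_def by (intro conjI allI compat_shift[OF spline_compat]) simp_all
  from ext_bound[OF this, of y "[]" 0]
  have "\<bar>ext (\<lambda>v. spline_val n \<phi> (w @ v)) y - spline_val n \<phi> w 0\<bar> \<le> 90 * e"
    using y(1) by (simp add: cell_Nil)
  moreover have "spline_val n \<phi> w 0 = \<phi> (Fw q w (q 0))" using w(1) by (simp add: spline_coarse)
  moreover have "\<bar>\<phi> (Fw q w (q 0)) - \<phi> x\<bar> < e" by (rule e[OF w(1) vertex_in_cell w(2)])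
  ultimately show ?thesis unfolding S by linarith
qed

section \<open>Uniqueness of the Laplacian\<close>

text \<open>The function \<open>\<phi>\<close> is the uniform limit of its splines, which are test functions.\<close>

lemma integral_continuous_zero:
  assumes h: "integrable (mu q) h"
    and test: "\<And>v. v \<in> dom_energy q \<Longrightarrow> (\<forall>x\<in>V q 0. v x = 0) \<Longrightarrow> (LINT x|mu q. h x * v x) = 0"
    and \<phi>: "continuous_on (SG q) \<phi>" "\<And>i. \<phi> (q i) = 0"
  shows "(LINT x|mu q. h x * \<phi> x) = 0"
proof -
  define I where "I = (LINT x|mu q. \<bar>h x\<bar>)"
  have I0: "0 \<le> I" unfolding I_def by simp
  obtain \<Phi> where \<Phi>: "\<Phi> > 0" "\<And>x. x \<in> SG q \<Longrightarrow> \<bar>\<phi> x\<bar> \<le> \<Phi>" using continuous_bounded[OF \<phi>(1)] by blast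
  have le: "\<bar>LINT x|mu q. h x * \<phi> x\<bar> \<le> 91 * e * I" if "e > 0" for e
  proof -
    from continuous_on_SG_D[OF \<phi>(1) that]
    obtain n where "\<forall>m\<ge>n. \<forall>w. length w = m \<longrightarrow> (\<forall>x\<in>cell q w. \<forall>y\<in>cell q w. \<bar>\<phi> x - \<phi> y\<bar> < e)" by (rule exE)
    note n = this[rule_format, OF order_refl]
    define v where "v = spline n \<phi>"
    have osc: "osc (spline_val n \<phi>) (2 * \<Phi> * (10/9) ^ n) (9/10)" by (rule spline_osc) (use \<Phi> in auto)
    have vd: "v \<in> dom_energy q" unfolding v_def by (rule spline_dom_energy[OF \<phi>(1)])
    have "v (q i) = 0" for i
      using ext_vertex[OF osc, of "[]" i] \<phi>(2)[of i] by (simp add: v_def spline_def spline_coarse)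
    then have v0: "(LINT x|mu q. h x * v x) = 0" by (intro test vd) auto
    have vc: "continuous_on (SG q) v" using vd unfolding dom_energy_def by blast
    note int = integrable_mult_continuous[OF vc h] integrable_mult_continuous[OF \<phi>(1) h]
    have "(LINT x|mu q. h x * \<phi> x) = (LINT x|mu q. h x * \<phi> x - h x * v x)"
      using int v0 by simp
    also have "\<bar>\<dots>\<bar> \<le> (LINT x|mu q. \<bar>h x * \<phi> x - h x * v x\<bar>)" by (rule integral_abs_bound)
    also have "\<dots> \<le> (LINT x|mu q. 91 * e * \<bar>h x\<bar>)"
    proof (rule integral_mono)
      show "integrable (mu q) (\<lambda>x. \<bar>h x * \<phi> x - h x * v x\<bar>)" using int by simp
      show "integrable (mu q) (\<lambda>x. 91 * e * \<bar>h x\<bar>)" using h by simp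
      fix x assume "x \<in> space (mu q)"
      then have "x \<in> SG q" by (simp only: space_mu)
      then have "\<bar>v x - \<phi> x\<bar> \<le> 91 * e"
        unfolding v_def by (intro spline_close[OF \<phi>(1)]) (rule n)
      then have "\<bar>v x - \<phi> x\<bar> * \<bar>h x\<bar> \<le> 91 * e * \<bar>h x\<bar>" by (intro mult_right_mono) auto
      moreover have "h x * \<phi> x - h x * v x = - ((v x - \<phi> x) * h x)" by (simp add: algebra_simps)
      ultimately show "\<bar>h x * \<phi> x - h x * v x\<bar> \<le> 91 * e * \<bar>h x\<bar>" by (simp only: abs_minus_cancel abs_mult)
    qed
    also have "\<dots> = 91 * e * I" unfolding I_def by simp
    finally show ?thesis .
  qed
  have "\<bar>LINT x|mu q. h x * \<phi> x\<bar> \<le> 0"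
  proof (rule field_le_epsilon)
    fix d :: real assume d: "0 < d"
    define e where "e = (d / 91) / (I + 1)"
    have e: "e > 0" unfolding e_def using d I0 by (intro divide_pos_pos) auto
    have "e * (I + 1) = d / 91"
      unfolding e_def by (rule nonzero_eq_divide_eq[THEN iffD1, OF _ refl]) (use I0 in simp)
    then have "91 * (e * I) \<le> d" using e by (simp add: distrib_left)
    then show "\<bar>LINT x|mu q. h x * \<phi> x\<bar> \<le> 0 + d" using le[OF e] by (simp add: mult.assoc)
  qed
  then show ?thesis by simp
qed

lemma sets_open: "open U \<Longrightarrow> U \<inter> SG q \<in> sets (mu q)"
  unfolding sets_mu sets_restrict_space by (rule image_eqI[of _ _ U]) auto

text \<open>The indicator function of \<open>U\<close> without the corners of the gasket is a limit of continuous functions that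
vanish at these corners.\<close>

lemma integral_open_zero:
  assumes h: "integrable (mu q) h"
    and test: "\<And>v. v \<in> dom_energy q \<Longrightarrow> (\<forall>x\<in>V q 0. v x = 0) \<Longrightarrow> (LINT x|mu q. h x * v x) = 0"
    and U: "open U"
  shows "(LINT x|mu q. indicator (U \<inter> SG q) x * h x) = 0"
proof -
  \<comment> \<open>The set where the approximating functions vanish; it contains the corners and is nonempty.\<close>
  define Q where "Q = - (U - range q)"
  have "open (U - range q)" by (intro open_Diff U finite_imp_closed) simp
  then have "closed Q" unfolding Q_def by (rule closed_Compl)
  moreover have "q 0 \<in> Q" unfolding Q_def by simp
  ultimately have Q: "closed Q" "Q \<noteq> {}" by blast+
  define \<phi> where "\<phi> k x = min 1 (real k * infdist x Q)" for k x
  have "(LINT x|mu q. h x * \<phi> k x) = 0" for k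
  proof (rule integral_continuous_zero[OF h])
    show "(LINT x|mu q. h x * v x) = 0" if "v \<in> dom_energy q" "\<forall>x\<in>V q 0. v x = 0" for v
      using that by (rule test)
    show "continuous_on (SG q) (\<phi> k)" unfolding \<phi>_def by (intro continuous_intros continuous_on_infdist)
    show "\<phi> k (q i) = 0" for i unfolding \<phi>_def Q_def by simp
  qed
  moreover have "(\<lambda>k. LINT x|mu q. h x * \<phi> k x) \<longlonglongrightarrow> (LINT x|mu q. indicator (U \<inter> SG q) x * h x)"
  proof (rule integral_dominated_convergence[where w = "\<lambda>x. \<bar>h x\<bar>"])
    show "(\<lambda>x. indicator (U \<inter> SG q) x * h x) \<in> borel_measurable (mu q)"
      using h sets_open[OF U] by measurable
    have "\<phi> k \<in> borel_measurable (mu q)" for k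
      by (rule measurable_continuous) (unfold \<phi>_def, intro continuous_intros continuous_on_infdist)
    then show "(\<lambda>x. h x * \<phi> k x) \<in> borel_measurable (mu q)" for k using h by simp
    show "integrable (mu q) (\<lambda>x. \<bar>h x\<bar>)" using h by simp
    show "AE x in mu q. norm (h x * \<phi> k x) \<le> \<bar>h x\<bar>" for k
    proof (rule AE_I2)
      fix x
      have "0 \<le> \<phi> k x" "\<phi> k x \<le> 1" unfolding \<phi>_def by (simp_all add: infdist_nonneg)
      then show "norm (h x * \<phi> k x) \<le> \<bar>h x\<bar>" by (simp add: abs_mult mult_left_le)
    qed
    have "AE x in mu q. \<forall>i\<in>UNIV. x \<noteq> q i" by (rule AE_finite_allI) (auto intro: AE_neq)
    then show "AE x in mu q. (\<lambda>k. h x * \<phi> k x) \<longlonglongrightarrow> indicator (U \<inter> SG q) x * h x"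
      using AE_space
    proof eventually_elim
      case (elim x)
      then have x: "x \<in> SG q" "x \<notin> range q" unfolding space_mu by auto
      show ?case
      proof (cases "x \<in> U")
        case False
        then have "\<phi> k x = 0" for k unfolding \<phi>_def Q_def by simp
        then show ?thesis using False by simp
      next
        case True
        then have "x \<notin> Q" unfolding Q_def using x(2) by simp
        then have pos: "infdist x Q > 0" using in_closed_iff_infdist_zero[OF Q] infdist_nonneg[of x Q] by (simp add: less_le)
        obtain N :: nat where N: "1 / infdist x Q < real N" using reals_Archimedean2 by blast
        have "\<phi> k x = 1" if "k \<ge> N" for k
        proof -
          have "1 / infdist x Q \<le> real k" using N that by simp
          then have "1 \<le> real k * infdist x Q" using pos by (simp add: divide_le_eq)
          then show ?thesis unfolding \<phi>_def by simp
        qed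
        then have "\<forall>\<^sub>F k in sequentially. h x * \<phi> k x = indicator (U \<inter> SG q) x * h x"
          unfolding eventually_sequentially using True x(1) by (intro exI[of _ N]) simp
        then show ?thesis by (rule tendsto_eventually)
      qed
    qed
  qed
  ultimately have "(\<lambda>k::nat. 0) \<longlonglongrightarrow> (LINT x|mu q. indicator (U \<inter> SG q) x * h x)" by simp
  then show ?thesis using LIMSEQ_unique tendsto_const by blast
qed

text \<open>The positive and the negative part of \<open>h\<close> are densities of measures that agree on open sets.\<close>

lemma test_functions_determine:
  assumes h: "integrable (mu q) h"
    and test: "\<And>v. v \<in> dom_energy q \<Longrightarrow> (\<forall>x\<in>V q 0. v x = 0) \<Longrightarrow> (LINT x|mu q. h x * v x) = 0"
  shows "AE x in mu q. h x = 0"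
proof -
  define hp where "hp x = max 0 (h x)" for x
  define hn where "hn x = max 0 (- h x)" for x
  have int: "integrable (mu q) hp" "integrable (mu q) hn"
    unfolding hp_def hn_def using h by (auto intro: integrable_max)
  have nn: "0 \<le> hp x" "0 \<le> hn x" "h x = hp x - hn x" for x unfolding hp_def hn_def by auto
  note [measurable] = borel_measurable_integrable[OF int(1)] borel_measurable_integrable[OF int(2)]
  have ind: "integrable (mu q) (\<lambda>x. indicator A x * g x)"
    if "A \<in> sets (mu q)" "integrable (mu q) g" for A and g :: "point \<Rightarrow> real"
    using integrable_mult_indicator[OF that] by (simp only: real_scaleR_def)
  have em: "emeasure (density (mu q) (\<lambda>x. ennreal (g x))) A = ennreal (LINT x|mu q. indicator A x * g x)"
    if g: "integrable (mu q) g" "\<And>x. 0 \<le> g x" and A: "A \<in> sets (mu q)" for g A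
  proof -
    have "emeasure (density (mu q) (\<lambda>x. ennreal (g x))) A = (\<integral>\<^sup>+x. ennreal (g x) * indicator A x \<partial>mu q)"
      by (rule emeasure_density) (use g A in auto)
    also have "\<dots> = (\<integral>\<^sup>+x. ennreal (indicator A x * g x) \<partial>mu q)"
      by (intro nn_integral_cong) (auto simp: indicator_def)
    also have "\<dots> = ennreal (LINT x|mu q. indicator A x * g x)"
      by (rule nn_integral_eq_integral) (use ind[OF A g(1)] g(2) in auto)
    finally show ?thesis .
  qed
  have fin: "finite_measure (density (mu q) (\<lambda>x. ennreal (g x)))"
    if g: "integrable (mu q) g" "\<And>x. 0 \<le> g x" for g
    by (rule finite_measureI) (simp add: em[OF g sets.top])
  have eq: "density (mu q) (\<lambda>x. ennreal (hp x)) = density (mu q) (\<lambda>x. ennreal (hn x))"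
  proof (rule finite_measure_eq_on_open[where S = "SG q"])
    fix U :: "point set" assume U: "open U"
    have "(LINT x|mu q. indicator (U \<inter> SG q) x * h x) =
        (LINT x|mu q. indicator (U \<inter> SG q) x * hp x) - (LINT x|mu q. indicator (U \<inter> SG q) x * hn x)"
      unfolding nn(3) right_diff_distrib
      by (intro Bochner_Integration.integral_diff ind sets_open[OF U] int)
    moreover have "(LINT x|mu q. indicator (U \<inter> SG q) x * h x) = 0"
      by (rule integral_open_zero[OF h _ U]) (rule test)
    ultimately have "(LINT x|mu q. indicator (U \<inter> SG q) x * hp x) = (LINT x|mu q. indicator (U \<inter> SG q) x * hn x)"
      by linarith
    then show "emeasure (density (mu q) (\<lambda>x. ennreal (hp x))) (U \<inter> SG q) = emeasure (density (mu q) (\<lambda>x. ennreal (hn x))) (U \<inter> SG q)"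
      by (simp only: em[OF int(1) nn(1) sets_open[OF U]] em[OF int(2) nn(2) sets_open[OF U]])
  qed (use fin int nn sets_mu in auto)
  have "AE x in mu q. hp x = hn x"
  proof (rule density_unique_real[OF int])
    fix A assume A: "A \<in> sets (mu q)"
    have "ennreal (LINT x|mu q. indicator A x * hp x) = ennreal (LINT x|mu q. indicator A x * hn x)"
      using em[OF int(1) nn(1) A] em[OF int(2) nn(2) A] eq by simp
    then show "(LINT x:A|mu q. hp x) = (LINT x:A|mu q. hn x)"
      unfolding set_lebesgue_integral_def using nn by (subst (asm) ennreal_inj) (auto intro!: integral_nonneg_AE)
  qed
  then show ?thesis by (rule AE_mp) (auto simp: nn(3))
qed

lemma laplacian_unique:
  assumes "is_laplacian q L u f" "is_laplacian q L u g" "integrable (mu q) f" "integrable (mu q) g"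
  shows "AE x in mu q. f x = g x"
proof -
  have "AE x in mu q. f x - g x = 0"
  proof (rule test_functions_determine)
    show "integrable (mu q) (\<lambda>x. f x - g x)" using assms by simp
    fix v assume v: "v \<in> dom_energy q" "\<forall>x\<in>V q 0. v x = 0"
    have c: "continuous_on (SG q) v" using v(1) unfolding dom_energy_def by blast
    have "- (LINT x|mu q. f x * v x) = - (LINT x|mu q. g x * v x)"
      using assms(1,2) v unfolding is_laplacian_def by metis
    then show "(LINT x|mu q. (f x - g x) * v x) = 0"
      using integrable_mult_continuous[OF c assms(3)] integrable_mult_continuous[OF c assms(4)]
      by (simp add: left_diff_distrib)
  qed
  then show ?thesis by simp
qed

end

section \<open>The jets of the extension\<close>

text \<open>A pair of sequences in the form \<open>a\<^sub>m = base + slope (3/5)\<^sup>m + rest m\<close>, \<open>\<eta>\<^sub>m = normal m\<close>.\<close>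

record trace =
  base :: real
  slope :: real
  rest :: "nat \<Rightarrow> real"
  normal :: "nat \<Rightarrow> real"

text \<open>The entry at 0 repeats the entry at 1. The largest wings then carry no load from \<open>\<theta>\<close>, which would
otherwise not be bounded by the Lipschitz norm.\<close>

definition theta :: "trace \<Rightarrow> nat \<Rightarrow> real" where
  "theta P m = (if m = 0 then 3 * normal P 1 else 3 ^ m * normal P m)"

text \<open>The power of 5 converts the increment of \<open>\<theta>\<close> to the scale of the wings \<open>F\<^sub>0\<^sup>mF\<^sub>jSG\<close>, in which loads are
measured.\<close>

definition dtheta :: "trace \<Rightarrow> nat \<Rightarrow> real" where
  "dtheta P m = (theta P (Suc m) - theta P m) / 5 ^ Suc m"

definition tri :: "real \<Rightarrow> real \<Rightarrow> real \<Rightarrow> 3 \<Rightarrow> real" where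
  "tri x y z i = (if i = 0 then x else if i = 1 then y else z)"

lemma tri_simps: "tri x y z 0 = x" "tri x y z 1 = y" "tri x y z 2 = z"
  by (simp_all add: tri_def neq3)

text \<open>The values at the corners \<open>F\<^sub>0\<^sup>mq\<^sub>1\<close> and \<open>F\<^sub>0\<^sup>mq\<^sub>2\<close>, and at \<open>x\<^sub>m\<close>. The factor \<open>3/4\<close> makes the part with
\<open>slope\<close> harmonic: the even harmonic function that vanishes at \<open>q 0\<close> and has the value \<open>(3/5)\<^sup>m\<close> at these
corners is \<open>4/3 (3/5)\<^sup>m\<close> at \<open>x\<^sub>m\<close>.\<close>

definition lval :: "trace \<Rightarrow> nat \<Rightarrow> real" where
  "lval P m = base P + 3/4 * (slope P * (3/5) ^ m) - theta P m / 5 ^ m / 6"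

definition rval :: "trace \<Rightarrow> nat \<Rightarrow> real" where
  "rval P m = base P + 3/4 * (slope P * (3/5) ^ m) + theta P m / 5 ^ m / 6"

definition cval :: "trace \<Rightarrow> nat \<Rightarrow> real" where
  "cval P m = base P + slope P * (3/5) ^ m + rest P m"

text \<open>The jet on \<open>F\<^sub>0\<^sup>mSG\<close>. Its normal derivatives are \<open>- 3/2 slope\<close> at \<open>q 0\<close>, \<open>3/4 slope - 3\<^sup>-\<^sup>m\<theta>\<^sub>m / 2\<close> at \<open>F\<^sub>0\<^sup>mq\<^sub>1\<close>, and
\<open>3/4 slope + 3\<^sup>-\<^sup>m\<theta>\<^sub>m / 2\<close> at \<open>F\<^sub>0\<^sup>mq\<^sub>2\<close>.\<close>

definition apex :: "trace \<Rightarrow> nat \<Rightarrow> jet" where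
  "apex P m = (tri (base P) (lval P m) (rval P m), \<lambda>_. 0)"

text \<open>The jets on \<open>F\<^sub>0\<^sup>mF\<^sub>1SG\<close> and \<open>F\<^sub>0\<^sup>mF\<^sub>2SG\<close>. The loads are what remains when the graph Laplacian of the
corner values is subtracted from the normal derivatives that the neighbouring cells \<open>apex P m\<close> and
\<open>apex P (Suc m)\<close> and the trace at \<open>x\<^sub>m\<^sub>+\<^sub>1\<close>, namely \<open>\<eta>\<^sub>m\<^sub>+\<^sub>1\<close> from the left and \<open>- \<eta>\<^sub>m\<^sub>+\<^sub>1\<close> from the right,
dictate.\<close>

definition wing :: "trace \<Rightarrow> nat \<Rightarrow> 3 \<Rightarrow> jet" where
  "wing P m j = (if j = 1
     then (tri (lval P (Suc m)) (lval P m) (cval P (Suc m)),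
           tri (rest P (Suc m) + 5/6 * dtheta P m) (rest P (Suc m) - 1/6 * dtheta P m) (- 2 * rest P (Suc m) + 5/6 * dtheta P m))
     else (tri (rval P (Suc m)) (cval P (Suc m)) (rval P m),
           tri (rest P (Suc m) - 5/6 * dtheta P m) (- 2 * rest P (Suc m) - 5/6 * dtheta P m) (rest P (Suc m) + 1/6 * dtheta P m)))"

text \<open>The jet of the cell \<open>F\<^sub>0\<^sup>mF\<^sub>wSG\<close>: special jets along the powers of \<open>F\<^sub>0\<close>, and the subdivision rule inside
the wings.\<close>

primrec jets :: "trace \<Rightarrow> nat \<Rightarrow> word \<Rightarrow> jet" where
  "jets P m [] = apex P m"
| "jets P m (j # w) = (if j = 0 then jets P (Suc m) w else descend (wing P m j) w)"

lemma jets_replicate: "jets P m (replicate n 0 @ w) = jets P (m + n) w"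
  by (induction n arbitrary: m) auto

lemma subdivides_apex: "subdivides (apex P m) (\<lambda>i. jets P m [i])"
proof -
  have t: "jets P m [0] = apex P (Suc m)" "jets P m [1] = wing P m 1" "jets P m [2] = wing P m 2"
    by (simp_all add: descend_simps neq3)
  have th: "theta P (Suc m) / 5 ^ m = theta P m / 5 ^ m + 5 * dtheta P m"
    by (simp add: dtheta_def field_simps)
  define x where "x = slope P * (3/5) ^ m"
  define y where "y = theta P m / 5 ^ m"
  define z where "z = dtheta P m"
  have l: "lval P m = base P + 3/4 * x - y / 6" "rval P m = base P + 3/4 * x + y / 6"
    "lval P (Suc m) = base P + 9/20 * x - (y / 5 + z) / 6" "rval P (Suc m) = base P + 9/20 * x + (y / 5 + z) / 6"
    "cval P (Suc m) = base P + 3/5 * x + rest P (Suc m)"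
    using th unfolding lval_def rval_def cval_def x_def y_def z_def by simp_all
  have s: "wing P m 1 = (tri (lval P (Suc m)) (lval P m) (cval P (Suc m)),
           tri (rest P (Suc m) + 5/6 * dtheta P m) (rest P (Suc m) - 1/6 * dtheta P m) (- 2 * rest P (Suc m) + 5/6 * dtheta P m))"
    "wing P m 2 = (tri (rval P (Suc m)) (cval P (Suc m)) (rval P m),
           tri (rest P (Suc m) - 5/6 * dtheta P m) (- 2 * rest P (Suc m) - 5/6 * dtheta P m) (rest P (Suc m) + 1/6 * dtheta P m))"
    by (simp_all add: wing_def neq3)
  show ?thesis
    unfolding subdivides_def all3 t s apex_def lap3_def cyc3 fst_conv snd_conv tri_simps l z_def[symmetric]
    by (simp add: neq3 field_simps)
qed

lemma subdivides_jets: "subdivides (jets P m w) (\<lambda>i. jets P m (w @ [i]))"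
proof (induction w arbitrary: m)
  case Nil
  show ?case using subdivides_apex by simp
next
  case (Cons j w)
  show ?case
  proof (cases "j = 0")
    case True
    then show ?thesis using Cons[of "Suc m"] by simp
  next
    case False
    then show ?thesis using subdivides_child[of "descend (wing P m j) w"] by (simp add: descend_simps)
  qed
qed

section \<open>Oscillation of the jets\<close>

lemma wing_load_bound: "\<bar>snd (wing P m j) k\<bar> \<le> 2 * \<bar>rest P (Suc m)\<bar> + \<bar>dtheta P m\<bar>"
proof -
  have "\<forall>k. \<bar>snd (wing P m j) k\<bar> \<le> 2 * \<bar>rest P (Suc m)\<bar> + \<bar>dtheta P m\<bar>"
    unfolding all3 wing_def by (cases "j = 1") (simp_all add: tri_simps, linarith+)
  then show ?thesis by blast
qed

text \<open>The decay rate \<open>3/5\<close> of \<open>rest\<close> is weak enough to hold in both trace spaces and strong enough to match the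
decay of the other terms.\<close>

definition bounded_trace :: "trace \<Rightarrow> real \<Rightarrow> bool" where
  "bounded_trace P B \<longleftrightarrow> \<bar>base P\<bar> \<le> B \<and> \<bar>slope P\<bar> \<le> B \<and>
     (\<forall>m\<ge>1. \<bar>rest P m\<bar> \<le> B * (3/5) ^ m \<and> \<bar>normal P m\<bar> \<le> B)"

context
  fixes P B assumes P: "bounded_trace P B"
begin

lemma bounded_trace_nonneg: "0 \<le> B"
  using P unfolding bounded_trace_def by linarith

lemma theta_bound: "\<bar>theta P m / 5 ^ m\<bar> \<le> 3 * (B * (3/5) ^ m)"
proof (cases "m = 0")
  case True
  have "\<bar>normal P 1\<bar> \<le> B" using P unfolding bounded_trace_def by blast
  then show ?thesis using True by (simp add: theta_def abs_mult)
next
  case False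
  then have "\<bar>normal P m\<bar> \<le> B" using P unfolding bounded_trace_def by simp
  then have "(3/5) ^ m * \<bar>normal P m\<bar> \<le> (3/5) ^ m * B" by (intro mult_left_mono) auto
  moreover have "\<bar>theta P m / 5 ^ m\<bar> = (3/5) ^ m * \<bar>normal P m\<bar>"
    using False by (simp add: theta_def abs_mult power_divide)
  moreover have "0 \<le> (3/5) ^ m * B" using bounded_trace_nonneg by simp
  ultimately show ?thesis by (simp add: mult.commute)
qed

lemma slope_bound: "\<bar>slope P * (3/5) ^ m\<bar> \<le> B * (3/5) ^ m"
proof -
  have "\<bar>slope P\<bar> * (3/5) ^ m \<le> B * (3/5) ^ m"
    using P unfolding bounded_trace_def by (intro mult_right_mono) auto
  then show ?thesis by (simp add: abs_mult)
qed

lemma rest_bound: "\<bar>rest P (Suc m)\<bar> \<le> 3/5 * (B * (3/5) ^ m)"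
  using P unfolding bounded_trace_def by (auto dest!: spec[of _ "Suc m"])

lemma dtheta_bound: "\<bar>dtheta P m\<bar> \<le> 12/5 * (B * (3/5) ^ m)"
proof -
  have e: "dtheta P m = theta P (Suc m) / 5 ^ Suc m - theta P m / 5 ^ m / 5"
    by (simp add: dtheta_def diff_divide_distrib)
  have "\<bar>theta P (Suc m) / 5 ^ Suc m\<bar> \<le> 9/5 * (B * (3/5) ^ m)"
    by (rule order_trans[OF theta_bound]) simp
  moreover have "\<bar>x - y / 5\<bar> \<le> 12/5 * E" if "\<bar>x\<bar> \<le> 9/5 * E" "\<bar>y\<bar> \<le> 3 * E" for x y E :: real
    using that by linarith
  ultimately show ?thesis unfolding e using theta_bound[of m] by blast
qed

lemma value_bounds:
  "\<bar>lval P m - base P\<bar> \<le> 2 * (B * (3/5) ^ m)" "\<bar>rval P m - base P\<bar> \<le> 2 * (B * (3/5) ^ m)"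
  "\<bar>lval P (Suc m) - base P\<bar> \<le> 2 * (B * (3/5) ^ m)" "\<bar>rval P (Suc m) - base P\<bar> \<le> 2 * (B * (3/5) ^ m)"
  "\<bar>cval P (Suc m) - base P\<bar> \<le> 2 * (B * (3/5) ^ m)"
proof -
  have E: "0 \<le> B * (3/5) ^ m" using bounded_trace_nonneg by simp
  have s: "B * (3/5) ^ Suc m = 3/5 * (B * (3/5) ^ m)" by simp
  have l: "\<bar>lval P n - base P\<bar> \<le> 2 * (B * (3/5) ^ n)" "\<bar>rval P n - base P\<bar> \<le> 2 * (B * (3/5) ^ n)" for n
  proof -
    have *: "\<bar>c + 3/4 * x - y / 6 - c\<bar> \<le> 2 * E \<and> \<bar>c + 3/4 * x + y / 6 - c\<bar> \<le> 2 * E"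
      if "\<bar>y\<bar> \<le> 3 * E" "\<bar>x\<bar> \<le> E" for c x y E :: real
      using that by (intro conjI; linarith)
    show "\<bar>lval P n - base P\<bar> \<le> 2 * (B * (3/5) ^ n)" "\<bar>rval P n - base P\<bar> \<le> 2 * (B * (3/5) ^ n)"
      using *[OF theta_bound[of n] slope_bound[of n], of "base P"] unfolding lval_def rval_def by blast+
  qed
  show "\<bar>lval P m - base P\<bar> \<le> 2 * (B * (3/5) ^ m)" "\<bar>rval P m - base P\<bar> \<le> 2 * (B * (3/5) ^ m)" by (rule l)+
  show "\<bar>lval P (Suc m) - base P\<bar> \<le> 2 * (B * (3/5) ^ m)" "\<bar>rval P (Suc m) - base P\<bar> \<le> 2 * (B * (3/5) ^ m)"
    using l[of "Suc m"] E unfolding s by linarith+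
  show "\<bar>cval P (Suc m) - base P\<bar> \<le> 2 * (B * (3/5) ^ m)"
    using slope_bound[of "Suc m"] rest_bound[of m] E unfolding s cval_def by linarith
qed

lemma apex_bound: "\<bar>fst (apex P m) k - base P\<bar> \<le> 2 * (B * (3/5) ^ m)"
proof -
  have "\<forall>k. \<bar>fst (apex P m) k - base P\<bar> \<le> 2 * (B * (3/5) ^ m)"
    unfolding all3 apex_def fst_conv tri_simps using value_bounds bounded_trace_nonneg by simp
  then show ?thesis by blast
qed

lemma wing_bound: "\<bar>fst (wing P m j) k - base P\<bar> \<le> 2 * (B * (3/5) ^ m)"
proof -
  have "\<forall>k. \<bar>fst (wing P m j) k - base P\<bar> \<le> 2 * (B * (3/5) ^ m)"
    unfolding all3 wing_def using value_bounds by (simp add: tri_simps)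
  then show ?thesis by blast
qed

lemma power_le: "B * (3/5) ^ m \<le> B * (9/10) ^ m"
  using bounded_trace_nonneg by (intro mult_left_mono power_mono) auto

lemma wing_small: "small (wing P m j) (36 * (B * (9/10) ^ m))"
  unfolding small_def
proof (intro exI conjI allI)
  fix i k
  show "\<bar>fst (wing P m j) i - fst (wing P m j) k\<bar> \<le> 4 * (B * (3/5) ^ m)"
    using wing_bound[of m j i] wing_bound[of m j k] by linarith
  show "\<bar>snd (wing P m j) i\<bar> \<le> 2 * \<bar>rest P (Suc m)\<bar> + \<bar>dtheta P m\<bar>" by (rule wing_load_bound)
  \<comment> \<open>4 + 8 (6/5 + 12/5) = 32.8\<close>
  show "4 * (B * (3/5) ^ m) + 8 * (2 * \<bar>rest P (Suc m)\<bar> + \<bar>dtheta P m\<bar>) \<le> 36 * (B * (9/10) ^ m)"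
  proof -
    have "4 * E + 8 * (2 * x + y) \<le> 36 * E'" if "x \<le> 3/5 * E" "y \<le> 12/5 * E" "E \<le> E'" "0 \<le> E" for x y E E' :: real
      unfolding distrib_left using that by linarith
    then show ?thesis using rest_bound[of m] dtheta_bound[of m] power_le[of m] bounded_trace_nonneg by simp
  qed
qed

lemma jets_osc:
  "\<bar>fst (jets P m (w @ [i])) j - fst (jets P m w) k\<bar> \<le> 40 * (B * (9/10) ^ (m + length w))"
proof (induction w arbitrary: m)
  case Nil
  have "\<bar>fst (jets P m [i]) j - base P\<bar> \<le> 2 * (B * (3/5) ^ m)"
  proof (cases "i = 0")
    case True
    have "\<bar>fst (apex P (Suc m)) j - base P\<bar> \<le> 2 * (B * (3/5) ^ Suc m)" by (rule apex_bound)
    also have "\<dots> \<le> 2 * (B * (3/5) ^ m)" using bounded_trace_nonneg by simp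
    finally show ?thesis using True by simp
  next
    case False
    then show ?thesis using wing_bound by (simp add: descend_simps)
  qed
  then show ?case using apex_bound[of m k] power_le[of m] bounded_trace_nonneg by simp
next
  case (Cons j' w)
  show ?case
  proof (cases "j' = 0")
    case True
    then show ?thesis using Cons[of "Suc m"] by simp
  next
    case False
    have "\<bar>fst (descend (wing P m j') (w @ [i])) j - fst (descend (wing P m j') w) k\<bar> \<le> 36 * (B * (9/10) ^ m) * (9/10) ^ length w"
      by (rule descend_osc[OF wing_small])
    also have "\<dots> = 40 * (B * (9/10) ^ (m + length (j' # w)))" by (simp add: power_add)
    finally show ?thesis using False by simp
  qed
qed

end

section \<open>The density prescribed by the jets\<close>

lemma descend_const:
  assumes "snd s = (\<lambda>_. c)"
  shows "snd (descend s w) = (\<lambda>_. c / 5 ^ length w)"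
proof (induction w rule: rev_induct)
  case (snoc j w)
  show ?case by (simp add: descend_simps child_def snoc child_load_def field_simps)
qed (simp add: descend_simps assms)

text \<open>After the first subdivision of a wing the three loads of a cell are equal, and every further
subdivision divides them by 5.\<close>

lemma jets_const:
  assumes "j \<noteq> 0"
  shows "snd (jets P 0 (replicate m 0 @ j # i # v)) = (\<lambda>_. child_load (snd (wing P m j)) i / 5 ^ length v)"
proof -
  have "jets P 0 (replicate m 0 @ j # i # v) = descend (child (wing P m j) i) v"
    using assms by (simp add: jets_replicate descend_simps)
  then show ?thesis using descend_const[of "child (wing P m j) i" _ v] by (simp add: child_def)
qed

lemma jets_zero: "snd (jets P 0 (replicate m 0)) = (\<lambda>_. 0)"
  using jets_replicate[of P 0 m "[]"] by (simp add: apex_def)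

text \<open>The integral of a density over a cell of level \<open>n\<close> is its mean divided by \<open>3\<^sup>n\<close>, and it is the sum of the
three loads times \<open>(5/3)\<^sup>n\<close>. So this is the constant value of the density on a cell with equal loads.\<close>

definition dens :: "trace \<Rightarrow> word \<Rightarrow> real" where
  "dens P w = 3 * 5 ^ length w * snd (jets P 0 w) 0"

definition dens_bound :: "trace \<Rightarrow> nat \<Rightarrow> real" where
  "dens_bound P m = 24 * (5 ^ Suc m * \<bar>rest P (Suc m)\<bar>) + 12 * \<bar>theta P (Suc m) - theta P m\<bar>"

lemma dens_bound_nonneg: "0 \<le> dens_bound P m"
  unfolding dens_bound_def by simp

lemma dens_const: "j \<noteq> 0 \<Longrightarrow> dens P (replicate m 0 @ j # i # v) = dens P (replicate m 0 @ [j, i])"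
  unfolding dens_def jets_const by (simp add: power_add)

lemma dens_le: "j \<noteq> 0 \<Longrightarrow> \<bar>dens P (replicate m 0 @ [j, i])\<bar> \<le> dens_bound P m"
proof -
  assume j: "j \<noteq> 0"
  have "\<bar>child_load (snd (wing P m j)) i\<bar> \<le> 4/5 * (2 * \<bar>rest P (Suc m)\<bar> + \<bar>dtheta P m\<bar>)"
    by (rule child_load_bound[OF wing_load_bound])
  then have "3 * 5 ^ (m + 2) * \<bar>child_load (snd (wing P m j)) i\<bar> \<le> 3 * 5 ^ (m + 2) * (4/5 * (2 * \<bar>rest P (Suc m)\<bar> + \<bar>dtheta P m\<bar>))"
    by (intro mult_left_mono) auto
  also have "\<dots> = 24 * (5 ^ Suc m * \<bar>rest P (Suc m)\<bar>) + 12 * (5 ^ Suc m * \<bar>dtheta P m\<bar>)"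
    by (simp add: algebra_simps)
  also have "5 ^ Suc m * \<bar>dtheta P m\<bar> = \<bar>theta P (Suc m) - theta P m\<bar>"
    unfolding dtheta_def by (simp add: abs_divide del: power_Suc)
  finally show ?thesis unfolding dens_def dens_bound_def jets_const[OF j] by (simp add: abs_mult)
qed

section \<open>Linear dependence on the trace\<close>

definition jlin :: "real \<Rightarrow> jet \<Rightarrow> real \<Rightarrow> jet \<Rightarrow> jet" where
  "jlin c s d t = (\<lambda>i. c * fst s i + d * fst t i, \<lambda>i. c * snd s i + d * snd t i)"

definition tlin :: "real \<Rightarrow> trace \<Rightarrow> real \<Rightarrow> trace \<Rightarrow> trace" where
  "tlin c P d Q = \<lparr>base = c * base P + d * base Q, slope = c * slope P + d * slope Q,
     rest = \<lambda>m. c * rest P m + d * rest Q m, normal = \<lambda>m. c * normal P m + d * normal Q m\<rparr>"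

lemma child_lin: "child (jlin c s d t) i = jlin c (child s i) d (child t i)"
  unfolding child_def jlin_def child_value_def child_load_def sum3
  by (auto simp: fun_eq_iff field_simps)

lemma descend_lin: "descend (jlin c s d t) w = jlin c (descend s w) d (descend t w)"
  by (induction w arbitrary: s t) (simp_all add: descend_simps child_lin)

lemma theta_lin: "theta (tlin c P d Q) m = c * theta P m + d * theta Q m"
  by (simp add: theta_def tlin_def algebra_simps)

lemma dtheta_lin: "dtheta (tlin c P d Q) m = c * dtheta P m + d * dtheta Q m"
  unfolding dtheta_def theta_lin by (simp add: field_simps)

lemma val_lin:
  "lval (tlin c P d Q) m = c * lval P m + d * lval Q m"
  "rval (tlin c P d Q) m = c * rval P m + d * rval Q m"
  "cval (tlin c P d Q) m = c * cval P m + d * cval Q m"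
  unfolding lval_def rval_def cval_def theta_lin
  by (simp_all add: tlin_def algebra_simps add_divide_distrib)

lemma rest_lin: "rest (tlin c P d Q) m = c * rest P m + d * rest Q m"
  "base (tlin c P d Q) = c * base P + d * base Q"
  by (simp_all add: tlin_def)

lemma tri_lin: "tri (c * x + d * x') (c * y + d * y') (c * z + d * z') = (\<lambda>i. c * tri x y z i + d * tri x' y' z' i)"
  by (auto simp: tri_def fun_eq_iff)

lemma apex_lin: "apex (tlin c P d Q) m = jlin c (apex P m) d (apex Q m)"
  unfolding apex_def jlin_def val_lin rest_lin tri_lin by simp

lemma wing_lin: "wing (tlin c P d Q) m j = jlin c (wing P m j) d (wing Q m j)"
  unfolding wing_def jlin_def val_lin rest_lin dtheta_lin
  by (auto simp: fun_eq_iff tri_def algebra_simps)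

lemma jets_lin: "jets (tlin c P d Q) m w = jlin c (jets P m w) d (jets Q m w)"
  by (induction w arbitrary: m) (simp_all add: apex_lin wing_lin descend_lin)

context gasket begin

section \<open>The extension of a trace and its Laplacian\<close>

definition jval :: "trace \<Rightarrow> word \<Rightarrow> 3 \<Rightarrow> real" where "jval P w = fst (jets P 0 w)"
definition jload :: "trace \<Rightarrow> word \<Rightarrow> 3 \<Rightarrow> real" where "jload P w = snd (jets P 0 w)"

lemma jval_compat: "compat (jval P)"
  unfolding compat_def jval_def
  by (intro conjI allI subdividesD(1)[OF subdivides_jets] subdividesD(2)[OF subdivides_jets])

lemma jval_flux: "flux (jval P) (jload P)"
  unfolding flux_def
proof (intro conjI allI impI)
  fix w i
  have "5/3 * (jload P (w @ [i]) i + lap3 (jval P (w @ [i])) i) = jload P w i + lap3 (jval P w) i"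
    unfolding jval_def jload_def by (rule subdividesD(3)[OF subdivides_jets])
  then show "nderiv (jval P) (jload P) (w @ [i]) i = nderiv (jval P) (jload P) w i"
    unfolding nderiv_def by simp
next
  fix w and i j :: 3 assume "i \<noteq> j"
  then have "jload P (w @ [i]) j + lap3 (jval P (w @ [i])) j = - (jload P (w @ [j]) i + lap3 (jval P (w @ [j])) i)"
    unfolding jval_def jload_def by (rule subdividesD(4)[OF subdivides_jets])
  then show "nderiv (jval P) (jload P) (w @ [i]) j = - nderiv (jval P) (jload P) (w @ [j]) i"
    unfolding nderiv_def by (simp only: length_append list.size mult_minus_right)
qed

text \<open>The total flux out of the cell, which has to be the integral of the Laplacian.\<close>

definition mass :: "trace \<Rightarrow> word \<Rightarrow> real" where
  "mass P w = (5/3) ^ length w * (\<Sum>i\<in>UNIV. jload P w i)"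

lemma mass_nderiv: "mass P w = (\<Sum>i\<in>UNIV. nderiv (jval P) (jload P) w i)"
  unfolding mass_def nderiv_def sum3 lap3_def cyc3 by (simp add: algebra_simps)

lemma mass_split: "mass P w = (\<Sum>j\<in>UNIV. mass P (w @ [j]))"
proof -
  have d: "nderiv (jval P) (jload P) (w @ [i]) i = nderiv (jval P) (jload P) w i" for i
    using jval_flux unfolding flux_def by blast
  have s: "nderiv (jval P) (jload P) (w @ [1]) 0 = - nderiv (jval P) (jload P) (w @ [0]) 1"
    "nderiv (jval P) (jload P) (w @ [2]) 0 = - nderiv (jval P) (jload P) (w @ [0]) 2"
    "nderiv (jval P) (jload P) (w @ [2]) 1 = - nderiv (jval P) (jload P) (w @ [1]) 2"
    using jval_flux[of P] neq3 unfolding flux_def by metis+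
  show ?thesis unfolding mass_nderiv sum3 s d by simp
qed

lemma mass_top: "mass P (replicate m 0) = 0"
  unfolding mass_def jload_def jets_zero by simp

text \<open>A function with the value \<open>c w\<close> on almost all of \<open>cell q w\<close>. The second condition excludes, at every
point, values that \<open>c\<close> does not allow there, so bounds on \<open>c\<close> become pointwise bounds.\<close>

definition is_step_function :: "word set \<Rightarrow> (word \<Rightarrow> real) \<Rightarrow> (point \<Rightarrow> real) \<Rightarrow> bool" where
  "is_step_function G c f \<longleftrightarrow> f \<in> borel_measurable (mu q) \<and>
    (\<forall>x. f x = 0 \<or> (\<exists>w\<in>G. x \<in> cell q w \<and> f x = c w)) \<and>
    (\<forall>w\<in>G. AE x in mu q. x \<in> cell q w \<longrightarrow> f x = c w)"

text \<open>The value at a point is taken from the first cell that contains it, in some enumeration of \<open>G\<close>.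
Different cells overlap in null sets.\<close>

lemma step_function_exists:
  assumes G: "G \<noteq> {}" and inc: "\<And>w w'. w \<in> G \<Longrightarrow> w' \<in> G \<Longrightarrow> w \<noteq> w' \<Longrightarrow> incomparable w w'"
  shows "\<exists>f. is_step_function G c f"
proof -
  have cG: "countable G" using countable_words countable_subset by blast
  define e where "e = from_nat_into G"
  have e: "e n \<in> G" for n unfolding e_def by (rule from_nat_into[OF G])
  have e_surj: "\<exists>n. w = e n" if "w \<in> G" for w using from_nat_into_surj[OF cG that] unfolding e_def by metis
  define N where "N x = (LEAST n. x \<in> cell q (e n))" for x
  define f where "f x = (if \<exists>n. x \<in> cell q (e n) then c (e (N x)) else 0)" for x
  have [measurable]: "N \<in> measurable (mu q) (count_space UNIV)"
    unfolding N_def by measurable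
  have f: "f \<in> borel_measurable (mu q)" unfolding f_def by measurable
  have NI: "x \<in> cell q (e (N x))" if "x \<in> cell q (e n)" for x n
    unfolding N_def by (rule LeastI[of "\<lambda>n. x \<in> cell q (e n)", OF that])
  have 1: "f x = 0 \<or> (\<exists>w\<in>G. x \<in> cell q w \<and> f x = c w)" for x
  proof (cases "\<exists>n. x \<in> cell q (e n)")
    case True
    then have "x \<in> cell q (e (N x))" using NI by blast
    then show ?thesis using e True unfolding f_def by auto
  qed (simp add: f_def)
  have 2: "AE x in mu q. x \<in> cell q w \<longrightarrow> f x = c w" if w: "w \<in> G" for w
    using AE_cells_disjoint
  proof eventually_elim
    case (elim x)
    show ?case
    proof
      assume x: "x \<in> cell q w"
      obtain n where n: "w = e n" using e_surj[OF w] by blast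
      have N: "x \<in> cell q (e (N x))" using NI x n by blast
      have "e (N x) = w"
      proof (rule ccontr)
        assume "e (N x) \<noteq> w"
        then have "incomparable (e (N x)) w" by (rule inc[OF e w])
        then show False using elim N x by blast
      qed
      then show "f x = c w" unfolding f_def using x n by auto
    qed
  qed
  show ?thesis unfolding is_step_function_def using f 1 2 by blast
qed

text \<open>The subcells of the wings, on each of which the Laplacian will be constant.\<close>

definition fine_words :: "word set" where
  "fine_words = {replicate m 0 @ [j, i] | m j i. j \<noteq> 0}"

lemma fine_incomparable:
  assumes "w \<in> fine_words" "w' \<in> fine_words" "w \<noteq> w'" shows "incomparable w w'"
proof -
  obtain m j i where w: "w = replicate m 0 @ [j, i]" "j \<noteq> 0" using assms(1) unfolding fine_words_def by blast
  obtain m' j' i' where w': "w' = replicate m' 0 @ [j', i']" "j' \<noteq> 0" using assms(2) unfolding fine_words_def by blast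
  consider "m = m'" | "m < m'" | "m' < m" by linarith
  then show ?thesis
  proof cases
    case 1
    then show ?thesis using assms(3) w w' by (intro same_length_incomparable) auto
  next
    case 2
    then show ?thesis unfolding incomparable_def w w' using w(2)
      by (intro exI[of _ m]) (simp add: nth_append)
  next
    case 3
    then show ?thesis unfolding incomparable_def w w' using w'(2)
      by (intro exI[of _ m']) (simp add: nth_append)
  qed
qed

lemma word_cases:
  obtains (top) m where "w = replicate m 0"
    | (side) m j where "j \<noteq> 0" "w = replicate m 0 @ [j]"
    | (deep) m j i v where "j \<noteq> 0" "w = replicate m 0 @ j # i # v"
proof -
  have "(\<exists>m. w = replicate m 0) \<or> (\<exists>m j v. j \<noteq> 0 \<and> w = replicate m 0 @ j # v)"
  proof (induction w)
    case Nil
    show ?case by (intro disjI1 exI[of _ 0]) simp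
  next
    case (Cons a w)
    show ?case
    proof (cases "a = 0")
      case False
      then show ?thesis by (intro disjI2 exI[of _ 0] exI[of _ a] exI[of _ w]) simp
    next
      case True
      from Cons show ?thesis
      proof
        assume "\<exists>m. w = replicate m 0"
        then obtain m where "w = replicate m 0" by blast
        then show ?thesis using True by (intro disjI1 exI[of _ "Suc m"]) simp
      next
        assume "\<exists>m j v. j \<noteq> 0 \<and> w = replicate m 0 @ j # v"
        then obtain m j v where "j \<noteq> 0" "w = replicate m 0 @ j # v" by blast
        then show ?thesis using True by (intro disjI2 exI[of _ "Suc m"] exI[of _ j] exI[of _ v]) simp
      qed
    qed
  qed
  then show ?thesis
  proof
    assume "\<exists>m. w = replicate m 0"
    then show ?thesis using top by blast
  next
    assume "\<exists>m j v. j \<noteq> 0 \<and> w = replicate m 0 @ j # v"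
    then obtain m j v where jv: "j \<noteq> 0" "w = replicate m 0 @ j # v" by blast
    show ?thesis
    proof (cases v)
      case Nil
      then show ?thesis using side jv by blast
    next
      case (Cons i v')
      then show ?thesis using deep jv by blast
    qed
  qed
qed

context
  fixes P :: trace and B :: real
  assumes P: "bounded_trace P B"
    and dens2: "summable (\<lambda>m. (dens_bound P m)\<^sup>2 / 3 ^ m)"
begin

definition trace_ext :: "point \<Rightarrow> real" where "trace_ext = ext (jval P)"

lemma jval_osc: "osc (jval P) (40 * B) (9/10)"
  unfolding osc_def
proof (intro conjI allI jval_compat)
  fix w i j k
  show "\<bar>jval P (w @ [i]) j - jval P w k\<bar> \<le> 40 * B * (9/10) ^ length w"
    using jets_osc[OF P, of 0 w i j k] by (simp add: jval_def mult.assoc)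
qed simp_all

lemma trace_ext_vertex: "trace_ext (Fw q w (q i)) = jval P w i"
  unfolding trace_ext_def by (rule ext_vertex[OF jval_osc])

text \<open>The constant is \<open>3601 = 1 + 9 * 40 / (1 - 9/10)\<close>, from \<open>ext_bound\<close> at the empty word.\<close>

lemma trace_ext_bound: "x \<in> SG q \<Longrightarrow> \<bar>trace_ext x\<bar> \<le> 3601 * B"
proof -
  assume x: "x \<in> SG q"
  have "\<bar>trace_ext x - jval P [] 0\<bar> \<le> 9 * (40 * B) / (1 - 9/10) * (9/10) ^ length ([] :: word)"
    unfolding trace_ext_def by (rule ext_bound[OF jval_osc]) (use x in \<open>simp add: cell_Nil\<close>)
  moreover have "jval P [] 0 = base P" by (simp add: jval_def apex_def tri_simps)
  moreover have "\<bar>base P\<bar> \<le> B" using P unfolding bounded_trace_def by blast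
  ultimately show ?thesis by simp
qed

lemma trace_ext_continuous: "continuous_on (SG q) trace_ext"
  unfolding trace_ext_def by (rule ext_continuous[OF jval_osc])

definition trace_lap :: "point \<Rightarrow> real" where
  "trace_lap = (SOME f. is_step_function fine_words (dens P) f)"

lemma trace_lap_step: "is_step_function fine_words (dens P) trace_lap"
proof -
  have "[1, 0] \<in> fine_words" unfolding fine_words_def
    by (intro CollectI exI[of _ 0] exI[of _ 1]) (simp add: neq3)
  then have "fine_words \<noteq> {}" by blast
  from someI_ex[OF step_function_exists[OF this fine_incomparable]] show ?thesis unfolding trace_lap_def .
qed

lemma trace_lap_measurable [measurable]: "trace_lap \<in> borel_measurable (mu q)"
  and trace_lap_cases: "trace_lap x = 0 \<or> (\<exists>w\<in>fine_words. x \<in> cell q w \<and> trace_lap x = dens P w)"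
  and trace_lap_AE: "w \<in> fine_words \<Longrightarrow> AE x in mu q. x \<in> cell q w \<longrightarrow> trace_lap x = dens P w"
  using trace_lap_step unfolding is_step_function_def by blast+

lemma trace_lap_le: "(\<And>m. dens_bound P m \<le> S) \<Longrightarrow> \<bar>trace_lap x\<bar> \<le> S"
proof -
  assume S: "\<And>m. dens_bound P m \<le> S"
  have S0: "0 \<le> S" using S[of 0] dens_bound_nonneg[of P 0] by linarith
  show ?thesis
  proof (rule disjE[OF trace_lap_cases[of x]])
    assume "\<exists>w\<in>fine_words. x \<in> cell q w \<and> trace_lap x = dens P w"
    then obtain m j i where "j \<noteq> 0" "trace_lap x = dens P (replicate m 0 @ [j, i])" unfolding fine_words_def by blast
    then show ?thesis using dens_le[of j P m i] S[of m] by simp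
  qed (use S0 in simp)
qed

text \<open>On the wings \<open>F\<^sub>0\<^sup>mF\<^sub>jSG\<close> the density is at most \<open>dens_bound P m\<close>, and they lie in \<open>F\<^sub>0\<^sup>mSG\<close>, which has
measure \<open>3\<^sup>-\<^sup>m\<close>.\<close>

lemma trace_lap_nn: "(\<integral>\<^sup>+x. ennreal ((trace_lap x)\<^sup>2) \<partial>mu q) \<le> ennreal (\<Sum>m. (dens_bound P m)\<^sup>2 / 3 ^ m)"
proof -
  have pw: "ennreal ((trace_lap x)\<^sup>2) \<le> (\<Sum>m. ennreal ((dens_bound P m)\<^sup>2) * indicator (cell q (replicate m 0)) x)" for x
  proof (rule disjE[OF trace_lap_cases[of x]])
    assume "\<exists>w\<in>fine_words. x \<in> cell q w \<and> trace_lap x = dens P w"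
    then obtain m j i where m: "j \<noteq> 0" "x \<in> cell q (replicate m 0 @ [j, i])" "trace_lap x = dens P (replicate m 0 @ [j, i])"
      unfolding fine_words_def by blast
    have "\<bar>trace_lap x\<bar> \<le> dens_bound P m" using dens_le[OF m(1)] m(3) by simp
    then have "(trace_lap x)\<^sup>2 \<le> (dens_bound P m)\<^sup>2" using power_mono[of "\<bar>trace_lap x\<bar>" "dens_bound P m" 2] by simp
    moreover have "x \<in> cell q (replicate m 0)" using m(2) cell_append_subset by blast
    ultimately have "ennreal ((trace_lap x)\<^sup>2) \<le> (\<Sum>m\<in>{m}. ennreal ((dens_bound P m)\<^sup>2) * indicator (cell q (replicate m 0)) x)"
      by (simp add: ennreal_leI)
    also have "\<dots> \<le> (\<Sum>m. ennreal ((dens_bound P m)\<^sup>2) * indicator (cell q (replicate m 0)) x)"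
      by (rule sum_le_suminf) auto
    finally show ?thesis .
  qed simp
  have "(\<integral>\<^sup>+x. ennreal ((trace_lap x)\<^sup>2) \<partial>mu q) \<le> (\<integral>\<^sup>+x. (\<Sum>m. ennreal ((dens_bound P m)\<^sup>2) * indicator (cell q (replicate m 0)) x) \<partial>mu q)"
    by (intro nn_integral_mono pw)
  also have "\<dots> = (\<Sum>m. (\<integral>\<^sup>+x. ennreal ((dens_bound P m)\<^sup>2) * indicator (cell q (replicate m 0)) x \<partial>mu q))"
    by (rule nn_integral_suminf) measurable
  also have "\<dots> = (\<Sum>m. ennreal ((dens_bound P m)\<^sup>2 / 3 ^ m))"
  proof (intro suminf_cong)
    fix m
    have "(\<integral>\<^sup>+x. ennreal ((dens_bound P m)\<^sup>2) * indicator (cell q (replicate m 0)) x \<partial>mu q) = ennreal ((dens_bound P m)\<^sup>2) * emeasure (mu q) (cell q (replicate m 0))"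
      by (rule nn_integral_cmult_indicator) simp
    also have "\<dots> = ennreal ((dens_bound P m)\<^sup>2 / 3 ^ m)"
      unfolding mu.emeasure_eq_measure measure_cell by (simp add: ennreal_mult[symmetric] power_divide)
    finally show "(\<integral>\<^sup>+x. ennreal ((dens_bound P m)\<^sup>2) * indicator (cell q (replicate m 0)) x \<partial>mu q) = ennreal ((dens_bound P m)\<^sup>2 / 3 ^ m)" .
  qed
  also have "\<dots> = ennreal (\<Sum>m. (dens_bound P m)\<^sup>2 / 3 ^ m)"
    by (rule suminf_ennreal2[OF _ dens2]) simp
  finally show ?thesis .
qed

lemma trace_lap_sq_integrable: "integrable (mu q) (\<lambda>x. (trace_lap x)\<^sup>2)"
proof (rule integrableI_bounded)
  have "(\<integral>\<^sup>+x. ennreal (norm ((trace_lap x)\<^sup>2)) \<partial>mu q) = (\<integral>\<^sup>+x. ennreal ((trace_lap x)\<^sup>2) \<partial>mu q)" by simp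
  also have "\<dots> < \<infinity>" by (rule le_less_trans[OF trace_lap_nn]) simp
  finally show "(\<integral>\<^sup>+x. ennreal (norm ((trace_lap x)\<^sup>2)) \<partial>mu q) < \<infinity>" .
qed measurable

lemma trace_lap_sq_bound: "(LINT x|mu q. (trace_lap x)\<^sup>2) \<le> (\<Sum>m. (dens_bound P m)\<^sup>2 / 3 ^ m)"
proof -
  have "ennreal (LINT x|mu q. (trace_lap x)\<^sup>2) = (\<integral>\<^sup>+x. ennreal ((trace_lap x)\<^sup>2) \<partial>mu q)"
    by (rule nn_integral_eq_integral[OF trace_lap_sq_integrable, symmetric]) simp
  then have "ennreal (LINT x|mu q. (trace_lap x)\<^sup>2) \<le> ennreal (\<Sum>m. (dens_bound P m)\<^sup>2 / 3 ^ m)" using trace_lap_nn by simp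
  moreover have "0 \<le> (\<Sum>m. (dens_bound P m)\<^sup>2 / 3 ^ m)" by (rule suminf_nonneg[OF dens2]) simp
  ultimately show ?thesis by (simp only: ennreal_le_iff)
qed

lemma trace_lap_L2: "trace_lap \<in> L2 q"
  unfolding L2_def using trace_lap_sq_integrable by simp

lemma trace_lap_integrable: "integrable (mu q) trace_lap"
  by (rule mu.square_integrable_imp_integrable[OF trace_lap_measurable trace_lap_sq_integrable])

lemma cint_fine:
  assumes "j \<noteq> 0" and w: "w = replicate m 0 @ j # i # v"
  shows "cint trace_lap w = mass P w" "cint (\<lambda>x. \<bar>trace_lap x\<bar>) w = \<bar>mass P w\<bar>"
    "jload P w k = (3/5) ^ length w * mass P w / 3"
proof -
  have "replicate m 0 @ [j, i] \<in> fine_words" unfolding fine_words_def using assms by blast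
  moreover have "cell q w \<subseteq> cell q (replicate m 0 @ [j, i])"
    using cell_append_subset[of "replicate m 0 @ [j, i]" v] by (simp add: w)
  ultimately have ae: "AE x in mu q. x \<in> cell q w \<longrightarrow> trace_lap x = dens P w"
    using trace_lap_AE[of "replicate m 0 @ [j, i]"] dens_const[OF assms(1), of P m i v] unfolding w[symmetric]
    by (auto elim!: AE_mp)
  have K: "jload P w k = jload P w 0" for k unfolding jload_def w jets_const[OF assms(1)] ..
  have m: "mass P w = dens P w * (1/3) ^ length w"
    unfolding mass_def sum3 K[of 1] K[of 2] unfolding dens_def jload_def by (simp add: power_divide)
  show "cint trace_lap w = mass P w"
    unfolding m by (rule cint_AE_const[OF trace_lap_integrable ae])
  have "AE x in mu q. x \<in> cell q w \<longrightarrow> \<bar>trace_lap x\<bar> = \<bar>dens P w\<bar>" using ae by (rule AE_mp) (auto intro!: AE_I2)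
  then show "cint (\<lambda>x. \<bar>trace_lap x\<bar>) w = \<bar>mass P w\<bar>"
    unfolding m abs_mult using cint_AE_const[of "\<lambda>x. \<bar>trace_lap x\<bar>" w "\<bar>dens P w\<bar>"] trace_lap_integrable by simp
  show "jload P w k = (3/5) ^ length w * mass P w / 3"
    unfolding mass_def sum3 K[of 1] K[of 2] K[of k] by (simp add: power_divide)
qed

lemma cint_side:
  assumes "j \<noteq> 0"
  shows "cint trace_lap (replicate m 0 @ [j]) = mass P (replicate m 0 @ [j])"
proof -
  have "cint trace_lap ((replicate m 0 @ [j]) @ [i]) = mass P ((replicate m 0 @ [j]) @ [i])" for i
    by (rule cint_fine(1)[OF assms]) simp
  then show ?thesis
    unfolding cint_split[OF trace_lap_integrable, of "replicate m 0 @ [j]"] mass_split[of P "replicate m 0 @ [j]"]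
    by (intro sum.cong refl)
qed

text \<open>The integral over \<open>F\<^sub>0\<^sup>mSG\<close> is independent of \<open>m\<close>, since the fluxes out of two wings add up to zero,
and it tends to zero because these cells shrink to \<open>q 0\<close>.\<close>

lemma cint_top: "cint trace_lap (replicate m 0) = 0"
proof -
  have step: "cint trace_lap (replicate m 0) = cint trace_lap (replicate (Suc m) 0)" for m
  proof -
    have "cint trace_lap (replicate m 0) = cint trace_lap (replicate m 0 @ [0]) + mass P (replicate m 0 @ [1]) + mass P (replicate m 0 @ [2])"
      unfolding cint_split[OF trace_lap_integrable, of "replicate m 0"] sum3 using cint_side neq3 by simp
    moreover have "mass P (replicate m 0) = mass P (replicate m 0 @ [0]) + mass P (replicate m 0 @ [1]) + mass P (replicate m 0 @ [2])"
      unfolding mass_split[of P "replicate m 0"] sum3 ..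
    moreover have "replicate m 0 @ [0] = replicate (Suc m) (0::3)" by (simp add: replicate_append_same)
    ultimately show ?thesis using mass_top[of P m] mass_top[of P "Suc m"] by simp
  qed
  have "cint trace_lap (replicate m 0) = cint trace_lap (replicate (m + k) 0)" for k
  proof (induction k)
    case (Suc k)
    then show ?case using step[of "m + k"] by simp
  qed simp
  then have c: "cint trace_lap (replicate m 0) = cint trace_lap (replicate k 0)" if "k \<ge> m" for k
    using that le_Suc_ex by metis
  have "(\<lambda>k. cint trace_lap ([] @ replicate k 0)) \<longlonglongrightarrow> 0" by (rule cint_shrink[OF trace_lap_integrable])
  moreover have "(\<lambda>k. cint trace_lap ([] @ replicate k 0)) \<longlonglongrightarrow> cint trace_lap (replicate m 0)"
    by (rule tendsto_eventually) (use c in \<open>auto simp: eventually_sequentially intro!: exI[of _ m]\<close>)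
  ultimately show ?thesis using LIMSEQ_unique by blast
qed

lemma cint_mass: "cint trace_lap w = mass P w"
  proof (cases w rule: word_cases)
  case (deep m j i v)
  then show ?thesis by (rule cint_fine(1))
qed (simp_all add: cint_top mass_top cint_side)

text \<open>The loads are integrals of the Laplacian against functions with values between 0 and 1. On a wing this
shows in the relation \<open>K i = 2 t i + (t 0 + t 1 + t 2)\<close> to the loads \<open>t\<close> of the subcells.\<close>

lemma jload_dominated: "(5/3) ^ length w * \<bar>jload P w i\<bar> \<le> cint (\<lambda>x. \<bar>trace_lap x\<bar>) w"
proof (cases w rule: word_cases)
  case (top m)
  have "0 \<le> cint (\<lambda>x. \<bar>trace_lap x\<bar>) w" unfolding cint_def by (intro integral_nonneg_AE) simp
  then show ?thesis unfolding top jload_def jets_zero by simp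
next
  case (deep m j k v)
  have "(5/3) ^ length w * \<bar>jload P w i\<bar> = \<bar>mass P w\<bar> / 3"
    using cint_fine(3)[OF deep, of i] by (simp add: abs_mult power_divide)
  then show ?thesis using cint_fine(2)[OF deep] by simp
next
  case (side m j)
  define c where "c k = mass P (w @ [k])" for k
  have w: "w @ [k] = replicate m 0 @ j # k # []" for k unfolding side by simp
  have af: "integrable (mu q) (\<lambda>x. \<bar>trace_lap x\<bar>)" using trace_lap_integrable by simp
  have c: "cint (\<lambda>x. \<bar>trace_lap x\<bar>) w = (\<Sum>k\<in>UNIV. \<bar>c k\<bar>)"
    unfolding cint_split[OF af, of w] c_def cint_fine(2)[OF side(1) w] ..
  have sK: "jload P w = snd (wing P m j)"
    unfolding jload_def side(2) using side(1) by (simp add: jets_replicate descend_simps)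
  have t: "c k = 3 * (5/3) ^ Suc (length w) * child_load (jload P w) k" for k
    unfolding c_def mass_def w jload_def jets_const[OF side(1)] sK[unfolded jload_def]
    by (simp add: side(2))
  \<comment> \<open>The equation that defines the loads of the subcells.\<close>
  have inv: "K i = 2 * child_load K i + (\<Sum>k\<in>UNIV. child_load K k)" for K :: "3 \<Rightarrow> real"
    unfolding child_load_def sum3 by (simp add: field_simps)
  have "(5/3) ^ length w * jload P w i = (2 * c i + (\<Sum>k\<in>UNIV. c k)) / 5"
    unfolding t sum3 by (subst inv) (simp add: sum3 field_simps)
  then have "(5/3) ^ length w * \<bar>jload P w i\<bar> = \<bar>2 * c i + (\<Sum>k\<in>UNIV. c k)\<bar> / 5"
    by (metis abs_divide abs_mult abs_numeral abs_of_nonneg power_abs zero_le_divide_iff zero_le_numeral zero_le_power)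
  moreover have "\<bar>c i\<bar> \<le> (\<Sum>k\<in>UNIV. \<bar>c k\<bar>)" by (rule member_le_sum) auto
  moreover have "\<bar>\<Sum>k\<in>UNIV. c k\<bar> \<le> (\<Sum>k\<in>UNIV. \<bar>c k\<bar>)" by (rule sum_abs)
  moreover have "0 \<le> (\<Sum>k\<in>UNIV. \<bar>c k\<bar>)" by (intro sum_nonneg) simp
  moreover have "x \<le> S" if "x = \<bar>2 * a + b\<bar> / 5" "\<bar>a\<bar> \<le> S" "\<bar>b\<bar> \<le> S" "0 \<le> S" for x a b S :: real
  proof -
    have "\<bar>2 * a + b\<bar> \<le> 5 * S" using that(2-4) by linarith
    then show ?thesis using that(1) by simp
  qed
  ultimately show ?thesis unfolding c by blast
qed

lemma energy_u:
  assumes "continuous_on (SG q) v"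
  shows "(\<lambda>n. energy_level q n trace_ext v) \<longlonglongrightarrow> (\<Sum>i\<in>UNIV. v (q i) * nderiv (jval P) (jload P) [] i) - (LINT x|mu q. trace_lap x * v x)"
  by (rule energy_level_tendsto[OF jval_flux trace_lap_integrable cint_mass[unfolded mass_def] jload_dominated trace_ext_vertex assms])

lemma trace_ext_dom_energy: "trace_ext \<in> dom_energy q"
  unfolding dom_energy_def using energy_u[OF trace_ext_continuous] trace_ext_continuous by (auto intro: convergentI)

lemma trace_ext_weak_laplacian:
  assumes "v \<in> dom_energy q" "\<forall>x\<in>V q 0. v x = 0"
  shows "energy q trace_ext v = - (LINT x|mu q. trace_lap x * v x)"
proof -
  have "continuous_on (SG q) v" using assms(1) unfolding dom_energy_def by blast
  from energy_u[OF this] have "energy q trace_ext v = (\<Sum>i\<in>UNIV. v (q i) * nderiv (jval P) (jload P) [] i) - (LINT x|mu q. trace_lap x * v x)"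
    unfolding energy_def by (rule limI)
  also have "(\<Sum>i\<in>UNIV. v (q i) * nderiv (jval P) (jload P) [] i) = 0" using assms(2) by simp
  finally show ?thesis by simp
qed

lemma trace_ext_restriction:
  "has_restriction q trace_ext (\<lambda>m. base P + slope P * (3/5) ^ m + rest P m, normal P)"
  unfolding has_restriction_def prod.case
proof (intro allI impI conjI)
  fix m :: nat assume m: "1 \<le> m"
  then obtain n where n: "m = Suc n" by (cases m) auto
  have "trace_ext (sym_point q m) = jval P (replicate n 0 @ [2]) 1"
    unfolding sym_point_def n using trace_ext_vertex by simp
  also have "\<dots> = cval P m"
    unfolding jval_def jets_replicate n by (simp add: descend_simps wing_def neq3 tri_simps)
  finally show "trace_ext (sym_point q m) = base P + slope P * (3/5) ^ m + rest P m" unfolding cval_def .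
  have "has_normal_deriv q trace_ext (left_word m) 2 (nderiv (jval P) (jload P) (left_word m) 2)"
    by (rule normal_deriv[OF jval_flux trace_lap_integrable jload_dominated trace_ext_vertex])
  moreover have "nderiv (jval P) (jload P) (left_word m) 2 = normal P m"
  proof -
    have w: "left_word m = replicate n 0 @ [1]" unfolding left_word_def n by simp
    have j: "jets P 0 (left_word m) = wing P n 1"
      unfolding w jets_replicate by (simp add: descend_simps neq3)
    have "jload P (left_word m) 2 + lap3 (jval P (left_word m)) 2 =
      - 2 * rest P m + 5/6 * dtheta P n + (2 * cval P m - lval P m - lval P n)"
      unfolding jload_def jval_def j lap3_def cyc3 unfolding n by (simp add: wing_def tri_simps)
    also have "\<dots> = theta P m / 5 ^ m"
    proof -
      define X where "X = theta P m / 5 ^ m"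
      define r where "r = slope P * (3/5) ^ n"
      have "theta P n / 5 ^ n = 5 * (X - dtheta P n)"
        unfolding dtheta_def X_def n by (simp add: field_simps)
      then have "lval P n = base P + 3/4 * r - 5 * (X - dtheta P n) / 6" by (simp add: lval_def r_def)
      moreover have "lval P m = base P + 9/20 * r - X / 6" by (simp add: lval_def r_def X_def n)
      moreover have "cval P m = base P + 3/5 * r + rest P m" by (simp add: cval_def r_def n)
      ultimately show ?thesis unfolding X_def[symmetric] by (simp add: field_simps)
    qed
    finally have e: "jload P (left_word m) 2 + lap3 (jval P (left_word m)) 2 = theta P m / 5 ^ m" .
    have "length (left_word m) = m" by (simp add: left_word_def n)
    then have "nderiv (jval P) (jload P) (left_word m) 2 = (5/3) ^ m * (theta P m / 5 ^ m)"
      unfolding nderiv_def e by simp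
    also have "\<dots> = normal P m" by (simp add: theta_def n power_divide)
    finally show ?thesis .
  qed
  ultimately show "has_normal_deriv q trace_ext (left_word m) 2 (normal P m)" by simp
qed

end

section \<open>Norms of the extension\<close>

lemma Linf_I:
  assumes "f \<in> borel_measurable (mu q)" "AE x in mu q. \<bar>f x\<bar> \<le> S" "0 \<le> S"
  shows "f \<in> Linf q" "Linf_norm q f \<le> S"
proof -
  have e: "esssup (mu q) (\<lambda>x. ereal \<bar>f x\<bar>) \<le> ereal S"
    by (rule esssup_I) (use assms in auto)
  have "ereal S < \<infinity>" by simp
  then show "f \<in> Linf q" unfolding Linf_def using assms(1) le_less_trans[OF e] by blast
  show "Linf_norm q f \<le> S" unfolding Linf_norm_def
    using e assms(3) by (cases "esssup (mu q) (\<lambda>x. ereal \<bar>f x\<bar>)") auto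
qed

lemma Linf_integrable: assumes "f \<in> Linf q" shows "integrable (mu q) f"
proof -
  define e where "e = esssup (mu q) (\<lambda>x. ereal \<bar>f x\<bar>)"
  have f: "f \<in> borel_measurable (mu q)" "e < \<infinity>" using assms unfolding Linf_def e_def by auto
  have "AE x in mu q. ereal \<bar>f x\<bar> \<le> e" unfolding e_def by (rule esssup_AE)
  then have "AE x in mu q. norm (f x) \<le> real_of_ereal e"
  proof eventually_elim
    case (elim x)
    then show ?case using f(2) by (cases e) auto
  qed
  then show ?thesis using f(1) by (rule mu.integrable_const_bound)
qed

lemma L2_integrable: "f \<in> L2 q \<Longrightarrow> integrable (mu q) f"
  unfolding L2_def by (auto intro: mu.square_integrable_imp_integrable)

lemma is_laplacian_laplacian: "is_laplacian q L u f \<Longrightarrow> is_laplacian q L u (laplacian q L u)"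
  unfolding laplacian_def by (rule someI[of "is_laplacian q L u"])

lemma is_laplacian_mem: "is_laplacian q L u f \<Longrightarrow> f \<in> L"
  unfolding is_laplacian_def by blast

text \<open>The norm refers to a chosen Laplacian, which agrees with \<open>f\<close> almost everywhere.\<close>

lemma dom_Linf_norm_le:
  assumes u: "continuous_on (SG q) u" "\<And>x. x \<in> SG q \<Longrightarrow> \<bar>u x\<bar> \<le> U" "0 \<le> U"
    and f: "is_laplacian q (Linf q) u f" "\<And>x. \<bar>f x\<bar> \<le> S" "0 \<le> S"
  shows "dom_Linf_norm q u \<le> U + S"
proof -
  define g where "g = laplacian q (Linf q) u"
  have g: "is_laplacian q (Linf q) u g" unfolding g_def by (rule is_laplacian_laplacian[OF f(1)])
  have gL: "g \<in> Linf q" by (rule is_laplacian_mem[OF g])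
  have "AE x in mu q. f x = g x"
    by (rule laplacian_unique[OF f(1) g Linf_integrable[OF is_laplacian_mem[OF f(1)]] Linf_integrable[OF gL]])
  then have "AE x in mu q. \<bar>g x\<bar> \<le> S"
  proof eventually_elim
    case (elim x)
    then show ?case using f(2)[of x] by simp
  qed
  moreover have "g \<in> borel_measurable (mu q)" using gL unfolding Linf_def by blast
  ultimately have "Linf_norm q g \<le> S" using Linf_I(2) f(3) by blast
  moreover have "Linf_norm q u \<le> U"
    by (rule Linf_I(2)[OF measurable_continuous[OF u(1)] _ u(3)]) (use u(2) space_mu in \<open>auto intro!: AE_I2\<close>)
  ultimately show ?thesis unfolding dom_Linf_norm_def g_def by linarith
qed

lemma dom_L2_norm_le:
  assumes u: "continuous_on (SG q) u" "\<And>x. x \<in> SG q \<Longrightarrow> \<bar>u x\<bar> \<le> U" "0 \<le> U"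
    and f: "is_laplacian q (L2 q) u f" "(LINT x|mu q. (f x)\<^sup>2) \<le> S\<^sup>2" "0 \<le> S"
  shows "dom_L2_norm q u \<le> U + S"
proof -
  define g where "g = laplacian q (L2 q) u"
  have g: "is_laplacian q (L2 q) u g" unfolding g_def by (rule is_laplacian_laplacian[OF f(1)])
  have gL: "g \<in> L2 q" and fL: "f \<in> L2 q" by (rule is_laplacian_mem[OF g], rule is_laplacian_mem[OF f(1)])
  have ae: "AE x in mu q. f x = g x"
    by (rule laplacian_unique[OF f(1) g L2_integrable[OF fL] L2_integrable[OF gL]])
  have "(LINT x|mu q. (g x)\<^sup>2) = (LINT x|mu q. (f x)\<^sup>2)"
  proof (rule integral_cong_AE)
    show "(\<lambda>x. (g x)\<^sup>2) \<in> borel_measurable (mu q)" "(\<lambda>x. (f x)\<^sup>2) \<in> borel_measurable (mu q)"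
      using gL fL unfolding L2_def by auto
    show "AE x in mu q. (g x)\<^sup>2 = (f x)\<^sup>2" using ae by eventually_elim simp
  qed
  then have "(L2_norm q g)\<^sup>2 \<le> S\<^sup>2" unfolding L2_norm_def using f(2) by simp
  moreover have "(L2_norm q u)\<^sup>2 \<le> U\<^sup>2"
  proof -
    have le: "(u x)\<^sup>2 \<le> U\<^sup>2" if "x \<in> SG q" for x
      using power_mono[OF u(2)[OF that], of 2] by simp
    have m: "u \<in> borel_measurable (mu q)" by (rule measurable_continuous[OF u(1)])
    have "integrable (mu q) (\<lambda>x. (u x)\<^sup>2)"
    proof (rule mu.integrable_const_bound[where B = "U\<^sup>2"])
      show "AE x in mu q. norm ((u x)\<^sup>2) \<le> U\<^sup>2" by (rule AE_I2) (use le space_mu in simp)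
      show "(\<lambda>x. (u x)\<^sup>2) \<in> borel_measurable (mu q)" using m by simp
    qed
    then have "(LINT x|mu q. (u x)\<^sup>2) \<le> U\<^sup>2"
      by (rule mu.integral_le_const) (rule AE_I2, use le space_mu in simp)
    then show ?thesis unfolding L2_norm_def by simp
  qed
  ultimately have "(L2_norm q u)\<^sup>2 + (L2_norm q g)\<^sup>2 \<le> (U + S)\<^sup>2"
    using u(3) f(3) unfolding power2_sum by (smt (verit) mult_nonneg_nonneg)
  then show ?thesis unfolding dom_L2_norm_def g_def[symmetric]
    using u(3) f(3) by (intro real_le_lsqrt) auto
qed

lemma trace_is_laplacian:
  assumes "bounded_trace P B" "summable (\<lambda>m. (dens_bound P m)\<^sup>2 / 3 ^ m)" "trace_lap P \<in> L"
  shows "is_laplacian q L (trace_ext P) (trace_lap P)"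
  unfolding is_laplacian_def using trace_ext_weak_laplacian[OF assms(1,2)] assms(3) by blast

lemma trace_in_Linf:
  assumes P: "bounded_trace P B" "summable (\<lambda>m. (dens_bound P m)\<^sup>2 / 3 ^ m)"
    and S: "\<And>m. dens_bound P m \<le> S"
  shows "trace_ext P \<in> dom_laplacian q (Linf q)" "dom_Linf_norm q (trace_ext P) \<le> 3601 * B + S"
proof -
  have S0: "0 \<le> S" using S[of 0] dens_bound_nonneg[of P 0] by linarith
  have B0: "0 \<le> B" by (rule bounded_trace_nonneg[OF P(1)])
  have le: "\<bar>trace_lap P x\<bar> \<le> S" for x by (rule trace_lap_le[OF P]) (rule S)
  have "trace_lap P \<in> Linf q" by (rule Linf_I(1)[OF trace_lap_measurable[OF P] _ S0]) (use le in simp)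
  then have lap: "is_laplacian q (Linf q) (trace_ext P) (trace_lap P)" by (rule trace_is_laplacian[OF P])
  then show "trace_ext P \<in> dom_laplacian q (Linf q)"
    unfolding dom_laplacian_def using trace_ext_dom_energy[OF P] by blast
  show "dom_Linf_norm q (trace_ext P) \<le> 3601 * B + S"
    by (rule dom_Linf_norm_le[OF trace_ext_continuous[OF P] trace_ext_bound[OF P] _ lap le S0]) (use B0 in simp_all)
qed

lemma trace_in_L2:
  assumes P: "bounded_trace P B" "summable (\<lambda>m. (dens_bound P m)\<^sup>2 / 3 ^ m)"
    and S: "(\<Sum>m. (dens_bound P m)\<^sup>2 / 3 ^ m) \<le> S\<^sup>2" "0 \<le> S"
  shows "trace_ext P \<in> dom_laplacian q (L2 q)" "dom_L2_norm q (trace_ext P) \<le> 3601 * B + S"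
proof -
  have B0: "0 \<le> B" by (rule bounded_trace_nonneg[OF P(1)])
  have lap: "is_laplacian q (L2 q) (trace_ext P) (trace_lap P)" by (rule trace_is_laplacian[OF P trace_lap_L2[OF P]])
  then show "trace_ext P \<in> dom_laplacian q (L2 q)"
    unfolding dom_laplacian_def using trace_ext_dom_energy[OF P] by blast
  have sq: "(LINT x|mu q. (trace_lap P x)\<^sup>2) \<le> S\<^sup>2" by (rule order_trans[OF trace_lap_sq_bound[OF P] S(1)])
  show "dom_L2_norm q (trace_ext P) \<le> 3601 * B + S"
    by (rule dom_L2_norm_le[OF trace_ext_continuous[OF P] trace_ext_bound[OF P] _ lap sq S(2)]) (use B0 in simp_all)
qed

lemma trace_ext_linear:
  assumes P: "bounded_trace P B" "summable (\<lambda>m. (dens_bound P m)\<^sup>2 / 3 ^ m)"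
    and Q: "bounded_trace Q B'" "summable (\<lambda>m. (dens_bound Q m)\<^sup>2 / 3 ^ m)"
    and R: "bounded_trace (tlin c P d Q) B''" "summable (\<lambda>m. (dens_bound (tlin c P d Q) m)\<^sup>2 / 3 ^ m)"
    and x: "x \<in> SG q"
  shows "trace_ext (tlin c P d Q) x = c * trace_ext P x + d * trace_ext Q x"
proof -
  have "jval (tlin c P d Q) = (\<lambda>w i. c * jval P w i + d * jval Q w i)"
    unfolding jval_def jets_lin jlin_def fst_conv ..
  then show ?thesis
    unfolding trace_ext_def[OF P] trace_ext_def[OF Q] trace_ext_def[OF R]
    using ext_linear[OF jval_osc[OF P] jval_osc[OF Q] x] by simp
qed

end

section \<open>The trace spaces\<close>

text \<open>Letting \<open>m\<close> tend to infinity gives \<open>x = 0\<close>; then \<open>(3/5)\<^sup>m\<close> decays more slowly than \<open>(2/5)\<^sup>m\<close>.\<close>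

lemma powers_unique:
  fixes x y B :: real
  assumes "\<And>m::nat. m \<ge> 1 \<Longrightarrow> \<bar>x + y * (3/5) ^ m\<bar> \<le> B * (2/5) ^ m"
  shows "x = 0 \<and> y = 0"
proof -
  have B: "(\<lambda>m. B * r ^ m) \<longlonglongrightarrow> 0" if "0 \<le> r" "r < 1" for B r :: real
    using tendsto_mult[OF tendsto_const[of B] LIMSEQ_power_zero[of r]] that by simp
  have "(\<lambda>m. x + y * (3/5) ^ m) \<longlonglongrightarrow> 0"
  proof (rule Lim_null_comparison)
    show "\<forall>\<^sub>F m in sequentially. norm (x + y * (3/5) ^ m) \<le> B * (2/5) ^ m"
      unfolding eventually_sequentially using assms by (intro exI[of _ 1]) simp
  qed (rule B, simp_all)
  moreover have "(\<lambda>m. x + y * (3/5) ^ m) \<longlonglongrightarrow> x + 0" by (intro tendsto_intros B) simp_all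
  ultimately have x: "x = 0" using LIMSEQ_unique by force
  have "(\<lambda>m::nat. y) \<longlonglongrightarrow> 0"
  proof (rule Lim_null_comparison)
    show "\<forall>\<^sub>F m in sequentially. norm y \<le> B * (2/3) ^ m"
      unfolding eventually_sequentially
    proof (intro exI[of _ 1] allI impI)
      fix m :: nat assume "1 \<le> m"
      then have "\<bar>y\<bar> * (3/5) ^ m \<le> B * (2/5) ^ m" using assms[of m] x by (simp add: abs_mult)
      also have "(2/5 :: real) ^ m = (2/3) ^ m * (3/5) ^ m" by (simp add: power_mult_distrib[symmetric])
      finally have "\<bar>y\<bar> * (3/5) ^ m \<le> (B * (2/3) ^ m) * (3/5) ^ m" by (simp only: mult.assoc)
      then show "norm y \<le> B * (2/3) ^ m" unfolding real_norm_def by (rule mult_right_le_imp_le) simp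
    qed
  qed (rule B, simp_all)
  then have "y = 0" using LIMSEQ_unique tendsto_const by blast
  with x show ?thesis by simp
qed

text \<open>The remainders are at most of order \<open>(2/5)\<^sup>m\<close>. The lower bound on the weights holds for \<open>5\<^sup>m\<close> and for
\<open>(25/3)\<^bsup>m/2\<^esup>\<close>.\<close>

lemma coefficients_unique:
  assumes W: "\<And>m. (5/2) ^ m \<le> W m"
    and A: "\<And>m. m \<ge> 1 \<Longrightarrow> \<bar>W m * remainder a A m\<bar> \<le> B"
    and A': "\<And>m. m \<ge> 1 \<Longrightarrow> \<bar>W m * remainder a A' m\<bar> \<le> B'"
  shows "A = A'"
proof -
  have bd: "\<bar>y\<bar> \<le> C * (2/5) ^ m" if "\<bar>W m * y\<bar> \<le> C" for y C m
  proof -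
    have "(5/2) ^ m * \<bar>y\<bar> \<le> W m * \<bar>y\<bar>" using W by (intro mult_right_mono) auto
    also have "W m * \<bar>y\<bar> = \<bar>W m * y\<bar>"
      using order_trans[OF _ W[of m], of 0] by (simp add: abs_mult)
    also have "\<dots> \<le> C" by fact
    finally have "(2/5) ^ m * ((5/2) ^ m * \<bar>y\<bar>) \<le> (2/5) ^ m * C" by (intro mult_left_mono) auto
    moreover have "(2/5) ^ m * ((5/2) ^ m * \<bar>y\<bar>) = \<bar>y\<bar>"
    proof -
      have "(2/5 :: real) ^ m * (5/2) ^ m = 1" unfolding power_mult_distrib[symmetric] by simp
      then show ?thesis by (simp only: mult.assoc[symmetric] mult_1_left)
    qed
    ultimately have "\<bar>y\<bar> \<le> (2/5) ^ m * C" by (simp only:)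
    then show ?thesis by (simp only: mult.commute)
  qed
  have "fst A - fst A' = 0 \<and> snd A - snd A' = 0"
  proof (rule powers_unique)
    fix m :: nat assume m: "m \<ge> 1"
    have "(fst A - fst A') + (snd A - snd A') * (3/5) ^ m = remainder a A' m - remainder a A m"
      unfolding remainder_def by (simp add: case_prod_unfold algebra_simps)
    then show "\<bar>(fst A - fst A') + (snd A - snd A') * (3/5) ^ m\<bar> \<le> (B + B') * (2/5) ^ m"
      using bd[OF A[OF m]] bd[OF A'[OF m]] by (simp add: distrib_right)
  qed
  then show ?thesis by (simp add: prod_eq_iff)
qed

definition to_trace :: "real \<times> real \<Rightarrow> seq_pair \<Rightarrow> trace" where
  "to_trace A s = \<lparr>base = fst A, slope = snd A, rest = remainder (fst s) A, normal = snd s\<rparr>"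

lemma to_trace_restriction:
  "(\<lambda>m. base (to_trace A s) + slope (to_trace A s) * (3/5) ^ m + rest (to_trace A s) m, normal (to_trace A s)) = s"
  by (simp add: to_trace_def remainder_def case_prod_unfold)

definition coeffs_lincomb :: "real \<Rightarrow> real \<times> real \<Rightarrow> real \<Rightarrow> real \<times> real \<Rightarrow> real \<times> real" where
  "coeffs_lincomb c A d A' = (c * fst A + d * fst A', c * snd A + d * snd A')"

lemma remainder_lincomb:
  "remainder (fst (lincomb c s d t)) (coeffs_lincomb c A d A') m =
    c * remainder (fst s) A m + d * remainder (fst t) A' m"
  by (simp add: coeffs_lincomb_def lincomb_def remainder_def case_prod_unfold algebra_simps)

lemma to_trace_lincomb:
  "to_trace (coeffs_lincomb c A d A') (lincomb c s d t) = tlin c (to_trace A s) d (to_trace A' t)"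
proof -
  have "remainder (fst (lincomb c s d t)) (coeffs_lincomb c A d A') =
    (\<lambda>m. c * remainder (fst s) A m + d * remainder (fst t) A' m)"
    by (rule ext) (rule remainder_lincomb)
  moreover have "snd (lincomb c s d t) = (\<lambda>m. c * snd s m + d * snd t m)" by (simp add: lincomb_def)
  ultimately show ?thesis unfolding to_trace_def tlin_def by (simp add: coeffs_lincomb_def)
qed

lemma sup_finite_le: "sup_finite c \<Longrightarrow> m \<ge> 1 \<Longrightarrow> \<bar>c m\<bar> \<le> sup_norm c"
  unfolding sup_finite_def sup_norm_def by (rule cSUP_upper) auto

lemma lip_finite_le: "lip_finite c \<Longrightarrow> m \<ge> 1 \<Longrightarrow> \<bar>c (m + 1) - c m\<bar> \<le> lip_norm c"
  unfolding lip_finite_def lip_norm_def by (rule cSUP_upper) auto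

lemma sup_finiteI: "(\<And>m. m \<ge> 1 \<Longrightarrow> \<bar>c m\<bar> \<le> B) \<Longrightarrow> sup_finite c"
  unfolding sup_finite_def by (intro bdd_aboveI[of _ B]) auto

definition Tinf_coeffs :: "seq_pair \<Rightarrow> real \<times> real" where
  "Tinf_coeffs s = (THE A. sup_finite (Tinf_remainder (fst s) A))"

lemma Tinf_coeffs_eq:
  assumes "sup_finite (Tinf_remainder (fst s) A)"
  shows "Tinf_coeffs s = A"
  unfolding Tinf_coeffs_def
proof (rule the_equality)
  show "sup_finite (Tinf_remainder (fst s) A)" by fact
  fix A' assume A': "sup_finite (Tinf_remainder (fst s) A')"
  show "A' = A"
  proof (rule coefficients_unique[where W = "\<lambda>m. 5 ^ m"])
    show "(5/2) ^ m \<le> (5 :: real) ^ m" for m by (intro power_mono) auto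
    show "\<bar>5 ^ m * remainder (fst s) A' m\<bar> \<le> sup_norm (Tinf_remainder (fst s) A')" if "m \<ge> 1" for m
      using sup_finite_le[OF A' that] by (simp add: Tinf_remainder_def)
    show "\<bar>5 ^ m * remainder (fst s) A m\<bar> \<le> sup_norm (Tinf_remainder (fst s) A)" if "m \<ge> 1" for m
      using sup_finite_le[OF assms that] by (simp add: Tinf_remainder_def)
  qed
qed

lemma Tinf_coeffs: "s \<in> Tinf \<Longrightarrow> sup_finite (Tinf_remainder (fst s) (Tinf_coeffs s))"
  using Tinf_coeffs_eq[of s] unfolding Tinf_def by (auto simp: case_prod_unfold)

lemma Tinf_remainder_lincomb:
  assumes "s \<in> Tinf" "t \<in> Tinf"
  shows "sup_finite (Tinf_remainder (fst (lincomb c s d t)) (coeffs_lincomb c (Tinf_coeffs s) d (Tinf_coeffs t)))"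
    (is "sup_finite ?r''")
proof (rule sup_finiteI)
  fix m :: nat assume m: "m \<ge> 1"
  let ?r = "Tinf_remainder (fst s) (Tinf_coeffs s)" and ?r' = "Tinf_remainder (fst t) (Tinf_coeffs t)"
  have "?r'' m = c * ?r m + d * ?r' m"
    unfolding Tinf_remainder_def remainder_lincomb by (simp add: algebra_simps)
  also have "\<bar>\<dots>\<bar> \<le> \<bar>c * ?r m\<bar> + \<bar>d * ?r' m\<bar>" by (rule abs_triangle_ineq)
  also have "\<dots> \<le> \<bar>c\<bar> * sup_norm ?r + \<bar>d\<bar> * sup_norm ?r'"
    unfolding abs_mult using sup_finite_le[OF Tinf_coeffs[OF assms(1)] m] sup_finite_le[OF Tinf_coeffs[OF assms(2)] m]
    by (intro add_mono mult_left_mono) auto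
  finally show "\<bar>?r'' m\<bar> \<le> \<bar>c\<bar> * sup_norm ?r + \<bar>d\<bar> * sup_norm ?r'" .
qed

lemma Tinf_coeffs_lincomb:
  assumes "s \<in> Tinf" "t \<in> Tinf"
  shows "Tinf_coeffs (lincomb c s d t) = coeffs_lincomb c (Tinf_coeffs s) d (Tinf_coeffs t)"
  by (rule Tinf_coeffs_eq[OF Tinf_remainder_lincomb[OF assms]])

abbreviation Tinf_trace :: "seq_pair \<Rightarrow> trace" where
  "Tinf_trace s \<equiv> to_trace (Tinf_coeffs s) s"

text \<open>A Lipschitz sequence grows at most linearly, so \<open>|\<eta>\<^sub>m| \<le> m 3\<^sup>-\<^sup>m N \<le> N\<close>.\<close>

lemma Tinf_bounds:
  assumes s: "s \<in> Tinf"
  defines "N \<equiv> Tinf_full_norm s"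
  shows "bounded_trace (Tinf_trace s) N" "\<And>m. dens_bound (Tinf_trace s) m \<le> 36 * N"
proof -
  define A where "A = Tinf_coeffs s"
  define r where "r = Tinf_remainder (fst s) A"
  define h where "h m = 3 ^ m * snd s m" for m
  have r: "sup_finite r" unfolding r_def A_def by (rule Tinf_coeffs[OF s])
  have h: "lip_finite h" using s unfolding Tinf_def h_def by (auto simp: case_prod_unfold)
  have N: "N = \<bar>fst A\<bar> + \<bar>snd A\<bar> + sup_norm r + lip_norm h + \<bar>3 * snd s 1\<bar>"
    unfolding N_def Tinf_full_norm_def Tinf_norm_def r_def h_def A_def Tinf_coeffs_def
    by (simp add: case_prod_unfold Let_def)
  have "0 \<le> sup_norm r" "0 \<le> lip_norm h"
    using sup_finite_le[OF r, of 1] lip_finite_le[OF h, of 1] by linarith+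
  then have le: "\<bar>fst A\<bar> \<le> N" "\<bar>snd A\<bar> \<le> N" "sup_norm r \<le> N" "lip_norm h \<le> N" "\<bar>3 * snd s 1\<bar> \<le> N" "0 \<le> N"
    unfolding N by linarith+
  have rb: "5 ^ m * \<bar>remainder (fst s) A m\<bar> \<le> N" if "m \<ge> 1" for m
    using sup_finite_le[OF r that] le(3) by (simp add: r_def Tinf_remainder_def abs_mult)
  have hd: "\<bar>h (Suc m) - h m\<bar> \<le> N" if "m \<ge> 1" for m
    using lip_finite_le[OF h that] le(4) by simp
  have hb: "\<bar>h (Suc m)\<bar> \<le> real (Suc m) * N" for m
  proof (induction m)
    case 0
    then show ?case using le(5) by (simp add: h_def)
  next
    case (Suc m)
    then show ?case using hd[of "Suc m"] by (simp add: algebra_simps)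
  qed
  have "\<bar>snd s m\<bar> \<le> N" if m: "m \<ge> 1" for m
  proof -
    obtain n where n: "m = Suc n" using m by (cases m) auto
    have "m \<le> 3 ^ m" by (rule less_imp_le[OF power_gt_expt]) simp
    then have "real m \<le> real (3 ^ m)" by (simp only: of_nat_le_iff)
    then have "real m * N \<le> 3 ^ m * N" using le(6) by (intro mult_right_mono) auto
    moreover have "3 ^ m * \<bar>snd s m\<bar> \<le> real m * N" using hb[of n] unfolding n[symmetric] by (simp add: h_def abs_mult)
    ultimately have "3 ^ m * \<bar>snd s m\<bar> \<le> 3 ^ m * N" by (rule order_trans[rotated])
    then show ?thesis by simp
  qed
  moreover have "\<bar>remainder (fst s) A m\<bar> \<le> N * (3/5) ^ m" if m: "m \<ge> 1" for m
  proof -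
    have "5 ^ m * \<bar>remainder (fst s) A m\<bar> \<le> N * 1" using rb[OF m] by simp
    also have "\<dots> \<le> N * 3 ^ m" using le(6) by (intro mult_left_mono) auto
    finally show ?thesis by (simp add: power_divide le_divide_eq mult.commute)
  qed
  ultimately show "bounded_trace (Tinf_trace s) N"
    unfolding bounded_trace_def to_trace_def A_def[symmetric] using le by simp
  fix m
  have "\<bar>theta (Tinf_trace s) (Suc m) - theta (Tinf_trace s) m\<bar> \<le> N"
  proof (cases "m = 0")
    case False
    then show ?thesis using hd[of m] by (simp add: theta_def to_trace_def h_def)
  qed (use le(6) in \<open>simp add: theta_def\<close>)
  then show "dens_bound (Tinf_trace s) m \<le> 36 * N"
    unfolding dens_bound_def using rb[of "Suc m"] by (simp add: to_trace_def A_def[symmetric])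
qed

lemma Tinf_summable:
  assumes "s \<in> Tinf" shows "summable (\<lambda>m. (dens_bound (Tinf_trace s) m)\<^sup>2 / 3 ^ m)"
proof (rule summable_comparison_test')
  show "summable (\<lambda>m. (36 * Tinf_full_norm s)\<^sup>2 * (1/3 :: real) ^ m)"
    by (intro summable_mult summable_geometric) simp
  fix m :: nat
  have "(dens_bound (Tinf_trace s) m)\<^sup>2 \<le> (36 * Tinf_full_norm s)\<^sup>2"
    using Tinf_bounds(2)[OF assms, of m] dens_bound_nonneg by (rule power_mono)
  then show "norm ((dens_bound (Tinf_trace s) m)\<^sup>2 / 3 ^ m) \<le> (36 * Tinf_full_norm s)\<^sup>2 * (1/3) ^ m"
    by (simp add: power_divide divide_right_mono)
qed

lemma Tinf_lincomb:
  assumes s: "s \<in> Tinf" and t: "t \<in> Tinf" shows "lincomb c s d t \<in> Tinf"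
proof -
  let ?h = "\<lambda>m. 3 ^ m * snd s m" and ?h' = "\<lambda>m. 3 ^ m * snd t m"
  have h: "lip_finite ?h" "lip_finite ?h'" using s t unfolding Tinf_def by (auto simp: case_prod_unfold)
  have "lip_finite (\<lambda>m. 3 ^ m * snd (lincomb c s d t) m)"
    unfolding lip_finite_def
  proof (rule bdd_aboveI[where M = "\<bar>c\<bar> * lip_norm ?h + \<bar>d\<bar> * lip_norm ?h'"], clarsimp)
    fix m :: nat assume "Suc 0 \<le> m"
    then have m: "m \<ge> 1" by simp
    have "3 * 3 ^ m * snd (lincomb c s d t) (Suc m) - 3 ^ m * snd (lincomb c s d t) m
      = c * (?h (m + 1) - ?h m) + d * (?h' (m + 1) - ?h' m)"
      by (simp add: lincomb_def algebra_simps)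
    also have "\<bar>\<dots>\<bar> \<le> \<bar>c * (?h (m + 1) - ?h m)\<bar> + \<bar>d * (?h' (m + 1) - ?h' m)\<bar>" by (rule abs_triangle_ineq)
    also have "\<dots> \<le> \<bar>c\<bar> * lip_norm ?h + \<bar>d\<bar> * lip_norm ?h'"
      unfolding abs_mult[of c] abs_mult[of d] using lip_finite_le[OF h(1) m] lip_finite_le[OF h(2) m]
      by (intro add_mono mult_left_mono) auto
    finally show "\<bar>3 * 3 ^ m * snd (lincomb c s d t) (Suc m) - 3 ^ m * snd (lincomb c s d t) m\<bar> \<le> \<bar>c\<bar> * lip_norm ?h + \<bar>d\<bar> * lip_norm ?h'" .
  qed
  then have "(fst (lincomb c s d t), snd (lincomb c s d t)) \<in> Tinf"
    unfolding Tinf_def using Tinf_remainder_lincomb[OF s t] by blast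
  then show ?thesis by simp
qed

lemma l2_finite_le:
  assumes "l2_finite c" "m \<ge> 1" shows "\<bar>c m\<bar> \<le> l2_norm c"
proof -
  have "(\<Sum>k\<in>{m}. (c k)\<^sup>2) \<le> (\<Sum>\<^sub>\<infinity>k\<in>{1..}. (c k)\<^sup>2)"
    using assms unfolding l2_finite_def by (intro finite_sum_le_infsum) auto
  then have "sqrt ((c m)\<^sup>2) \<le> l2_norm c" unfolding l2_norm_def by (intro real_sqrt_le_mono) simp
  then show ?thesis by simp
qed

lemma l2_norm_sums: "l2_finite c \<Longrightarrow> (\<lambda>m. (c (Suc m))\<^sup>2) sums (l2_norm c)\<^sup>2"
proof -
  assume c: "l2_finite c"
  have r: "range Suc = {1..}" using greaterThan_0 by (simp add: atLeast_Suc_greaterThan)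
  have "((\<lambda>m. (c m)\<^sup>2) has_sum (\<Sum>\<^sub>\<infinity>k\<in>{1..}. (c k)\<^sup>2)) (range Suc)"
    unfolding r using c unfolding l2_finite_def by (rule has_sum_infsum)
  then have "((\<lambda>m. (c m)\<^sup>2) \<circ> Suc has_sum (\<Sum>\<^sub>\<infinity>k\<in>{1..}. (c k)\<^sup>2)) UNIV"
    by (subst (asm) has_sum_reindex) auto
  then have "(\<lambda>m. (c (Suc m))\<^sup>2) sums (\<Sum>\<^sub>\<infinity>k\<in>{1..}. (c k)\<^sup>2)"
    using has_sum_imp_sums unfolding o_def by blast
  moreover have "0 \<le> (\<Sum>\<^sub>\<infinity>k\<in>{1..}. (c k)\<^sup>2)" by (intro infsum_nonneg) simp
  ultimately show ?thesis unfolding l2_norm_def by simp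
qed

lemma l2_finiteI: "summable (\<lambda>m. (c (Suc m))\<^sup>2) \<Longrightarrow> l2_finite c"
proof -
  assume c: "summable (\<lambda>m. (c (Suc m))\<^sup>2)"
  have r: "range Suc = {1..}" using greaterThan_0 by (simp add: atLeast_Suc_greaterThan)
  have "((\<lambda>m. (c m)\<^sup>2) \<circ> Suc) summable_on UNIV"
    unfolding o_def using c by (subst summable_on_UNIV_nonneg_real_iff) auto
  then show ?thesis unfolding l2_finite_def r[symmetric] by (subst summable_on_reindex) auto
qed

lemma l2_finite_lincomb:
  assumes c: "l2_finite c" and d: "l2_finite d"
  shows "l2_finite (\<lambda>m. x * c m + y * d m)"
proof (rule l2_finiteI, rule summable_comparison_test')
  show "summable (\<lambda>m. 2 * x\<^sup>2 * (c (Suc m))\<^sup>2 + 2 * y\<^sup>2 * (d (Suc m))\<^sup>2)"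
    using l2_norm_sums[OF c] l2_norm_sums[OF d] by (intro summable_add summable_mult sums_summable)
  fix m
  have "(x * c (Suc m) + y * d (Suc m))\<^sup>2 \<le> 2 * (x * c (Suc m))\<^sup>2 + 2 * (y * d (Suc m))\<^sup>2"
    using zero_le_power2[of "x * c (Suc m) - y * d (Suc m)"] by (simp add: power2_sum power2_diff)
  then show "norm ((x * c (Suc m) + y * d (Suc m))\<^sup>2) \<le> 2 * x\<^sup>2 * (c (Suc m))\<^sup>2 + 2 * y\<^sup>2 * (d (Suc m))\<^sup>2"
    by (simp add: power_mult_distrib)
qed

lemma powr_half_power2: "0 < b \<Longrightarrow> (b powr (real m / 2))\<^sup>2 = b ^ m" for b :: real
  by (simp add: power2_eq_square powr_add[symmetric] powr_realpow)

lemma T2_weight: "(5/2) ^ m \<le> (25/3 :: real) powr (real m / 2)"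
proof (rule power2_le_imp_le)
  have "((5/2 :: real) ^ m)\<^sup>2 = ((5/2)\<^sup>2) ^ m" by (simp add: power_mult[symmetric] mult.commute)
  also have "\<dots> \<le> (25/3) ^ m" by (intro power_mono) (auto simp: power2_eq_square)
  also have "\<dots> = ((25/3) powr (real m / 2))\<^sup>2" by (simp add: powr_half_power2)
  finally show "((5/2 :: real) ^ m)\<^sup>2 \<le> ((25/3) powr (real m / 2))\<^sup>2" .
qed simp

definition T2_coeffs :: "seq_pair \<Rightarrow> real \<times> real" where
  "T2_coeffs s = (THE A. l2_finite (T2_remainder (fst s) A))"

lemma T2_coeffs_eq:
  assumes "l2_finite (T2_remainder (fst s) A)"
  shows "T2_coeffs s = A"
  unfolding T2_coeffs_def
proof (rule the_equality)
  show "l2_finite (T2_remainder (fst s) A)" by fact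
  fix A' assume A': "l2_finite (T2_remainder (fst s) A')"
  show "A' = A"
  proof (rule coefficients_unique[OF T2_weight])
    show "\<bar>(25/3) powr (real m / 2) * remainder (fst s) A' m\<bar> \<le> l2_norm (T2_remainder (fst s) A')" if "m \<ge> 1" for m
      using l2_finite_le[OF A' that] by (simp add: T2_remainder_def)
    show "\<bar>(25/3) powr (real m / 2) * remainder (fst s) A m\<bar> \<le> l2_norm (T2_remainder (fst s) A)" if "m \<ge> 1" for m
      using l2_finite_le[OF assms that] by (simp add: T2_remainder_def)
  qed
qed

lemma T2_coeffs: "s \<in> T2 \<Longrightarrow> l2_finite (T2_remainder (fst s) (T2_coeffs s))"
  using T2_coeffs_eq[of s] unfolding T2_def by (auto simp: case_prod_unfold)

lemma T2_remainder_lincomb: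
  assumes "s \<in> T2" "t \<in> T2"
  shows "l2_finite (T2_remainder (fst (lincomb c s d t)) (coeffs_lincomb c (T2_coeffs s) d (T2_coeffs t)))"
proof -
  have "T2_remainder (fst (lincomb c s d t)) (coeffs_lincomb c (T2_coeffs s) d (T2_coeffs t))
    = (\<lambda>m. c * T2_remainder (fst s) (T2_coeffs s) m + d * T2_remainder (fst t) (T2_coeffs t) m)"
    by (rule ext) (unfold T2_remainder_def remainder_lincomb, simp add: algebra_simps)
  then show ?thesis by (simp only: l2_finite_lincomb[OF T2_coeffs[OF assms(1)] T2_coeffs[OF assms(2)]])
qed

lemma T2_coeffs_lincomb:
  assumes "s \<in> T2" "t \<in> T2"
  shows "T2_coeffs (lincomb c s d t) = (coeffs_lincomb c (T2_coeffs s) d (T2_coeffs t))"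
  by (rule T2_coeffs_eq[OF T2_remainder_lincomb[OF assms]])

lemma T2_lincomb:
  assumes s: "s \<in> T2" and t: "t \<in> T2" shows "lincomb c s d t \<in> T2"
proof -
  let ?h = "\<lambda>m. 3 powr (real m / 2) * snd s m" and ?h' = "\<lambda>m. 3 powr (real m / 2) * snd t m"
  have "l2_finite ?h" "l2_finite ?h'" using s t unfolding T2_def by (auto simp: case_prod_unfold)
  then have "l2_finite (\<lambda>m. c * ?h m + d * ?h' m)" by (rule l2_finite_lincomb)
  moreover have "(\<lambda>m. c * ?h m + d * ?h' m) = (\<lambda>m. 3 powr (real m / 2) * snd (lincomb c s d t) m)"
    by (rule ext) (simp add: lincomb_def algebra_simps)
  ultimately have "l2_finite (\<lambda>m. 3 powr (real m / 2) * snd (lincomb c s d t) m)" by simp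
  then have "(fst (lincomb c s d t), snd (lincomb c s d t)) \<in> T2"
    unfolding T2_def using T2_remainder_lincomb[OF s t] by blast
  then show ?thesis by simp
qed

abbreviation T2_trace :: "seq_pair \<Rightarrow> trace" where
  "T2_trace s \<equiv> to_trace (T2_coeffs s) s"

text \<open>In the weighted sum of the squares, \<open>3\<^sup>-\<^sup>m (5\<^sup>m a'\<^sub>m)\<^sup>2 = (25/3)\<^sup>m a'\<^sub>m\<^sup>2\<close> and
\<open>3\<^sup>-\<^sup>m \<theta>\<^sub>m\<^sup>2 = 3\<^sup>m \<eta>\<^sub>m\<^sup>2\<close> are the summands of the norm.\<close>

lemma T2_bounds:
  assumes s: "s \<in> T2"
  defines "N \<equiv> T2_norm s"
  shows "bounded_trace (T2_trace s) N" "summable (\<lambda>m. (dens_bound (T2_trace s) m)\<^sup>2 / 3 ^ m)"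
    "(\<Sum>m. (dens_bound (T2_trace s) m)\<^sup>2 / 3 ^ m) \<le> (76 * N)\<^sup>2" "0 \<le> N"
proof -
  define A where "A = T2_coeffs s"
  define r where "r = T2_remainder (fst s) A"
  define h where "h m = 3 powr (real m / 2) * snd s m" for m
  define P where "P = T2_trace s"
  have r: "l2_finite r" unfolding r_def A_def by (rule T2_coeffs[OF s])
  have h: "l2_finite h" using s unfolding T2_def h_def by (auto simp: case_prod_unfold)
  have N: "N = sqrt ((fst A)\<^sup>2 + (snd A)\<^sup>2 + (l2_norm r)\<^sup>2 + (l2_norm h)\<^sup>2)"
    unfolding N_def T2_norm_def r_def h_def A_def T2_coeffs_def
    by (simp add: case_prod_unfold Let_def)
  show N0: "0 \<le> N" unfolding N by simp
  have N2: "N\<^sup>2 = (fst A)\<^sup>2 + (snd A)\<^sup>2 + (l2_norm r)\<^sup>2 + (l2_norm h)\<^sup>2" unfolding N by simp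
  have le: "\<bar>fst A\<bar> \<le> N" "\<bar>snd A\<bar> \<le> N" "\<bar>l2_norm r\<bar> \<le> N" "\<bar>l2_norm h\<bar> \<le> N"
    unfolding N by (rule real_le_rsqrt, simp)+
  have "\<bar>snd s m\<bar> \<le> N" if m: "m \<ge> 1" for m
  proof -
    have "(1 :: real) \<le> 3 powr (real m / 2)" by (rule ge_one_powr_ge_zero) auto
    then have "1 * \<bar>snd s m\<bar> \<le> 3 powr (real m / 2) * \<bar>snd s m\<bar>" by (intro mult_right_mono) auto
    also have "\<dots> = \<bar>h m\<bar>" by (simp add: h_def abs_mult)
    also have "\<dots> \<le> N" using l2_finite_le[OF h m] le(4) by linarith
    finally show ?thesis by simp
  qed
  moreover have "\<bar>remainder (fst s) A m\<bar> \<le> N * (3/5) ^ m" if m: "m \<ge> 1" for m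
  proof -
    have "(5/3 :: real) ^ m \<le> (25/3) powr (real m / 2)"
      by (rule order_trans[OF _ T2_weight]) (intro power_mono, auto)
    then have "(5/3) ^ m * \<bar>remainder (fst s) A m\<bar> \<le> (25/3) powr (real m / 2) * \<bar>remainder (fst s) A m\<bar>"
      by (intro mult_right_mono) auto
    also have "\<dots> = \<bar>r m\<bar>" by (simp add: r_def T2_remainder_def abs_mult)
    also have "\<dots> \<le> N" using l2_finite_le[OF r m] le(3) by linarith
    finally show ?thesis by (simp add: power_divide field_simps)
  qed
  ultimately show "bounded_trace (T2_trace s) N"
    unfolding bounded_trace_def to_trace_def A_def[symmetric] using le by simp
  define x where "x m = (r (Suc m))\<^sup>2" for m
  define y where "y m = (h (Suc m))\<^sup>2" for m
  \<comment> \<open>The square of the previous entry, where theta P 0 contributes nothing: theta has no increment at 0.\<close>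
  define z where "z m = (case m of 0 \<Rightarrow> 0 | Suc k \<Rightarrow> y k)" for m
  have x: "x sums (l2_norm r)\<^sup>2" unfolding x_def by (rule l2_norm_sums[OF r])
  have y: "y sums (l2_norm h)\<^sup>2" unfolding y_def by (rule l2_norm_sums[OF h])
  have z: "z sums (l2_norm h)\<^sup>2"
  proof -
    have "(\<lambda>m. z (Suc m)) sums (l2_norm h)\<^sup>2" using y by (simp add: z_def)
    moreover have "z 0 = 0" by (simp add: z_def)
    ultimately show ?thesis using sums_Suc[of z "(l2_norm h)\<^sup>2"] by simp
  qed
  have pw: "(dens_bound P m)\<^sup>2 / 3 ^ m \<le> 3456 * x m + 1728 * y m + 576 * z m" for m
  proof -
    define R where "R = 5 ^ Suc m * \<bar>rest P (Suc m)\<bar>"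
    define T where "T = theta P (Suc m) - theta P m"
    have x': "R\<^sup>2 / 3 ^ m = 3 * x m"
      unfolding x_def r_def T2_remainder_def power_mult_distrib powr_half_power2[of "25/3", simplified] R_def P_def to_trace_def A_def[symmetric]
      by (simp add: power_divide power_mult_distrib power_mult[symmetric] power2_eq_square field_simps flip: power_mult_distrib)
    have t1: "(theta P (Suc m))\<^sup>2 / 3 ^ m = 3 * y m"
      unfolding y_def h_def power_mult_distrib powr_half_power2[of 3, simplified] theta_def P_def to_trace_def
      by (simp add: power2_eq_square field_simps)
    have T: "T\<^sup>2 / 3 ^ m \<le> 6 * y m + 2 * z m"
    proof (cases m)
      case 0
      then have "T = 0" by (simp add: T_def theta_def)
      moreover have "0 \<le> y m" by (simp add: y_def)
      ultimately show ?thesis using 0 by (simp add: z_def)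
    next
      case (Suc k)
      have t2: "(theta P m)\<^sup>2 / 3 ^ m = z m"
        unfolding Suc z_def y_def h_def power_mult_distrib powr_half_power2[of 3, simplified] theta_def P_def to_trace_def
        by (simp add: power2_eq_square field_simps powr_half_power2)
      have "T\<^sup>2 \<le> 2 * (theta P (Suc m))\<^sup>2 + 2 * (theta P m)\<^sup>2"
        unfolding T_def using zero_le_power2[of "theta P (Suc m) + theta P m"] by (simp add: power2_sum power2_diff)
      then have "T\<^sup>2 / 3 ^ m \<le> (2 * (theta P (Suc m))\<^sup>2 + 2 * (theta P m)\<^sup>2) / 3 ^ m" by (rule divide_right_mono) simp
      also have "\<dots> = 2 * ((theta P (Suc m))\<^sup>2 / 3 ^ m) + 2 * ((theta P m)\<^sup>2 / 3 ^ m)" by (simp add: add_divide_distrib)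
      finally show ?thesis unfolding t1 t2 by simp
    qed
    have "(dens_bound P m)\<^sup>2 = (24 * R + 12 * \<bar>T\<bar>)\<^sup>2" unfolding dens_bound_def R_def T_def ..
    also have "\<dots> \<le> 1152 * R\<^sup>2 + 288 * T\<^sup>2"
      using zero_le_power2[of "24 * R - 12 * \<bar>T\<bar>"] by (simp add: power2_sum power2_diff power_mult_distrib)
    finally have "(dens_bound P m)\<^sup>2 / 3 ^ m \<le> (1152 * R\<^sup>2 + 288 * T\<^sup>2) / 3 ^ m" by (rule divide_right_mono) simp
    also have "\<dots> = 1152 * (R\<^sup>2 / 3 ^ m) + 288 * (T\<^sup>2 / 3 ^ m)" by (simp add: add_divide_distrib)
    finally show ?thesis unfolding x' using T by linarith
  qed
  have major: "(\<lambda>m. 3456 * x m + 1728 * y m + 576 * z m) sums (3456 * (l2_norm r)\<^sup>2 + 1728 * (l2_norm h)\<^sup>2 + 576 * (l2_norm h)\<^sup>2)"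
    by (intro sums_add sums_mult x y z)
  have sm: "summable (\<lambda>m. (dens_bound P m)\<^sup>2 / 3 ^ m)"
    by (rule summable_comparison_test'[OF sums_summable[OF major]]) (use pw in simp)
  then show "summable (\<lambda>m. (dens_bound (T2_trace s) m)\<^sup>2 / 3 ^ m)" unfolding P_def .
  have "(\<Sum>m. (dens_bound P m)\<^sup>2 / 3 ^ m) \<le> (\<Sum>m. 3456 * x m + 1728 * y m + 576 * z m)"
    by (rule suminf_le[OF pw sm sums_summable[OF major]])
  also have "\<dots> = 3456 * (l2_norm r)\<^sup>2 + 1728 * (l2_norm h)\<^sup>2 + 576 * (l2_norm h)\<^sup>2"
    using major by (rule sums_unique[symmetric])
  also have "\<dots> \<le> 5776 * N\<^sup>2" unfolding N2 by simp
  finally show "(\<Sum>m. (dens_bound (T2_trace s) m)\<^sup>2 / 3 ^ m) \<le> (76 * N)\<^sup>2"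
    unfolding P_def by (simp add: power_mult_distrib)
qed

section \<open>Sequences modulo constants\<close>

lemma lip_norm_shift: "lip_norm (\<lambda>m. c m + x) = lip_norm c" "lip_finite (\<lambda>m. c m + x) = lip_finite c"
  unfolding lip_norm_def lip_finite_def by simp_all

text \<open>The constant is chosen such that \<open>3\<^sup>m \<eta>\<^sub>m\<close> vanishes at \<open>m = 1\<close>. On normalised pairs the full norm and the
seminorm agree, which reduces the case of sequences modulo constants to the full trace space.\<close>

definition normalise :: "seq_pair \<Rightarrow> seq_pair" where
  "normalise s = shift_const (- (3 * snd s 1)) s"

lemma normalise:
  "fst (normalise s) = fst s" "3 ^ m * snd (normalise s) m = 3 ^ m * snd s m + - (3 * snd s 1)"
  by (simp_all add: normalise_def shift_const_def case_prod_unfold algebra_simps)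

lemma normalise_Tinf: "s \<in> Tinf \<Longrightarrow> normalise s \<in> Tinf"
proof -
  assume s: "s \<in> Tinf"
  have "(fst (normalise s), snd (normalise s)) \<in> Tinf"
    using s unfolding Tinf_def mem_Collect_eq prod.case normalise lip_norm_shift
    by (simp add: case_prod_unfold)
  then show ?thesis by simp
qed

lemma normalise_norm: "Tinf_full_norm (normalise s) = Tinf_norm s"
proof -
  have "snd (normalise s) 1 = 0" using normalise(2)[of 1 s] by simp
  moreover have "Tinf_norm (normalise s) = Tinf_norm s"
    unfolding Tinf_norm_def case_prod_unfold normalise lip_norm_shift ..
  ultimately show ?thesis unfolding Tinf_full_norm_def by simp
qed

lemma normalise_lincomb: "normalise (lincomb c s d t) = lincomb c (normalise s) d (normalise t)"
  unfolding normalise_def shift_const_def lincomb_def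
  by (auto simp: case_prod_unfold fun_eq_iff field_simps)

context gasket begin

section \<open>The extension maps\<close>

definition Tinf_ext :: "seq_pair \<Rightarrow> point \<Rightarrow> real" where "Tinf_ext s = trace_ext (Tinf_trace s)"

definition T2_ext :: "seq_pair \<Rightarrow> point \<Rightarrow> real" where "T2_ext s = trace_ext (T2_trace s)"

lemma Tinf_ext_linear:
  assumes s: "s \<in> Tinf" and t: "t \<in> Tinf" and x: "x \<in> SG q"
  shows "Tinf_ext (lincomb c s d t) x = c * Tinf_ext s x + d * Tinf_ext t x"
proof -
  have l: "Tinf_trace (lincomb c s d t) = tlin c (Tinf_trace s) d (Tinf_trace t)"
    unfolding Tinf_coeffs_lincomb[OF s t] by (rule to_trace_lincomb)
  show ?thesis unfolding Tinf_ext_def l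
    by (rule trace_ext_linear[OF Tinf_bounds(1)[OF s] Tinf_summable[OF s] Tinf_bounds(1)[OF t] Tinf_summable[OF t]
        Tinf_bounds(1)[OF Tinf_lincomb[OF s t, of c d], unfolded l] Tinf_summable[OF Tinf_lincomb[OF s t, of c d], unfolded l] x])
qed

lemma T2_ext_linear:
  assumes s: "s \<in> T2" and t: "t \<in> T2" and x: "x \<in> SG q"
  shows "T2_ext (lincomb c s d t) x = c * T2_ext s x + d * T2_ext t x"
proof -
  have l: "T2_trace (lincomb c s d t) = tlin c (T2_trace s) d (T2_trace t)"
    unfolding T2_coeffs_lincomb[OF s t] by (rule to_trace_lincomb)
  show ?thesis unfolding T2_ext_def l
    by (rule trace_ext_linear[OF T2_bounds(1,2)[OF s] T2_bounds(1,2)[OF t]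
        T2_bounds(1,2)[OF T2_lincomb[OF s t, of c d], unfolded l] x])
qed

lemma Tinf_ext_bounded:
  assumes "s \<in> Tinf"
  shows "Tinf_ext s \<in> dom_laplacian q (Linf q)" "dom_Linf_norm q (Tinf_ext s) \<le> 3637 * Tinf_full_norm s"
  using trace_in_Linf[OF Tinf_bounds(1)[OF assms] Tinf_summable[OF assms] Tinf_bounds(2)[OF assms]]
  unfolding Tinf_ext_def by simp_all

lemma T2_ext_bounded:
  assumes "s \<in> T2"
  shows "T2_ext s \<in> dom_laplacian q (L2 q)" "dom_L2_norm q (T2_ext s) \<le> 3677 * T2_norm s"
  using trace_in_L2[OF T2_bounds(1-3)[OF assms]] T2_bounds(4)[OF assms]
  unfolding T2_ext_def by simp_all

lemma Tinf_ext_restriction: "s \<in> Tinf \<Longrightarrow> has_restriction q (Tinf_ext s) s"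
  using trace_ext_restriction[OF Tinf_bounds(1) Tinf_summable, of s] unfolding Tinf_ext_def to_trace_restriction by blast

lemma T2_ext_restriction: "s \<in> T2 \<Longrightarrow> has_restriction q (T2_ext s) s"
  using trace_ext_restriction[OF T2_bounds(1,2), of s] unfolding T2_ext_def to_trace_restriction by blast

lemma Tinf_ext_bounded_linear:
  "bounded_linear_into q Tinf Tinf_full_norm (dom_laplacian q (Linf q)) (dom_Linf_norm q) Tinf_ext"
  unfolding bounded_linear_into_def using Tinf_ext_bounded Tinf_ext_linear by blast

lemma T2_ext_bounded_linear:
  "bounded_linear_into q T2 T2_norm (dom_laplacian q (L2 q)) (dom_L2_norm q) T2_ext"
  unfolding bounded_linear_into_def using T2_ext_bounded T2_ext_linear by blast

lemma normalised_ext_bounded_linear: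
  "bounded_linear_into q Tinf Tinf_norm (dom_laplacian q (Linf q)) (dom_Linf_norm q) (\<lambda>s. Tinf_ext (normalise s))"
  unfolding bounded_linear_into_def normalise_lincomb
proof (intro conjI ballI allI exI[of _ 3637])
  show "Tinf_ext (normalise s) \<in> dom_laplacian q (Linf q)" if "s \<in> Tinf" for s
    by (rule Tinf_ext_bounded(1)[OF normalise_Tinf[OF that]])
  show "Tinf_ext (lincomb c (normalise s) d (normalise t)) x = c * Tinf_ext (normalise s) x + d * Tinf_ext (normalise t) x"
    if "s \<in> Tinf" "t \<in> Tinf" "x \<in> SG q" for s t c d x
    by (rule Tinf_ext_linear[OF normalise_Tinf[OF that(1)] normalise_Tinf[OF that(2)] that(3)])
  show "dom_Linf_norm q (Tinf_ext (normalise s)) \<le> 3637 * Tinf_norm s" if "s \<in> Tinf" for s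
    using Tinf_ext_bounded(2)[OF normalise_Tinf[OF that]] unfolding normalise_norm .
qed

end

theorem theorem7p4:
  fixes q :: "3 \<Rightarrow> point"
  assumes "equilateral q"
  shows
    "(\<exists>E. bounded_linear_into q Tinf Tinf_full_norm (dom_laplacian q (Linf q)) (dom_Linf_norm q) E \<and>
          (\<forall>s\<in>Tinf. has_restriction q (E s) s)) \<and>
     (\<exists>E. bounded_linear_into q Tinf Tinf_norm (dom_laplacian q (Linf q)) (dom_Linf_norm q) E \<and>
          (\<forall>s\<in>Tinf. \<exists>c. has_restriction q (E s) (shift_const c s))) \<and>
     (\<exists>E. bounded_linear_into q T2 T2_norm (dom_laplacian q (L2 q)) (dom_L2_norm q) E \<and>
          (\<forall>s\<in>T2. has_restriction q (E s) s))"
proof -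
  interpret gasket q by unfold_locales (rule assms)
  have "\<forall>s\<in>Tinf. \<exists>c. has_restriction q (Tinf_ext (normalise s)) (shift_const c s)"
    using Tinf_ext_restriction[OF normalise_Tinf] unfolding normalise_def by blast
  then show ?thesis
    using Tinf_ext_bounded_linear Tinf_ext_restriction normalised_ext_bounded_linear
      T2_ext_bounded_linear T2_ext_restriction by blast
qed

end
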